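(* Let $+$ denote the addition operation in both $K_0(\mathbf{Mat}^{\cong})$ and $K_0(\mathbf{Mat}^{\mathrm{tc}})$. (i) In both $K_0(\mathbf{Mat}^{\cong})$ and $K_0(\mathbf{Mat}^{\mathrm{tc}})$, setting $$[M]\cdot[N]:=[M\oplus N]$$ gives a well-defined product on generators, and hence a product on $K_0(\mathbf{Mat}^{\cong})$ and $K_0(\mathbf{Mat}^{\mathrm{tc}})$. Furthermore, the operations $+$, $\cdot$ define commutative ring structures on $K_0(\mathbf{Mat}^{\cong})$ and $K_0(\mathbf{Mat}^{\mathrm{tc}})$. (ii) With these ring structures, the group homomorphisms $\rho: K_0(\mathbf{Mat}^{\mathrm{tc}})\to\mathbb{Z}[x,y]$, $\gamma:K_0(\mathbf{Mat}^{\cong})\to K_0(\mathbf{Mat}^{\mathrm{tc}})$ and $\mathcal{T}:\mathbb{Z}[\mathcal{M}]=K_0(\mathbf{Mat}^{\cong})\to\mathbb{Z}[x,y]$ become ring homomorphisms.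
   Context: **Matroids.** A matroid $M=(E,\mathcal{I})$ is a finite set $E$ (ground set) with a collection $\mathcal{I}$ of subsets (independent sets) such that $\varnothing\in\mathcal{I}$; subsets of independent sets are independent; and if $I,J\in\mathcal{I}$ with $|J|<|I|$ there is $x\in I- J$ with $J\cup\{x\}\in\mathcal{I}$. A basis is a maximal independent set. An element $e\in E$ is a loop if $\{e\}\notin\mathcal{I}$, an isthmus if it lies in every basis, and non-degenerate if it is neither. If $e$ is not an isthmus, the deletion $M\backslash e$ is the matroid on $E-\{e\}$ whose independent sets are the $I\subseteq E-\{e\}$ with $I\in\mathcal{I}$. If $e$ is not a loop, the contraction $M/e$ is the matroid on $E-\{e\}$ whose independent sets are the $I\subseteq E-\{e\}$ with $I\cup\{e\}\in\mathcal{I}$. A minor of $M$ is a matroid obtained by a sequence of deletions and/or contractions. An isomorphism of matroids is a bijection $f$ of ground sets such that $I$ is independent iff $f(I)$ is. $\mathcal{M}$ denotes the set of isomorphism classes of matroids, and $\mathbb{Z}[\mathcal{M}]$ the free abelian group on it. The direct sum $M_1\oplus M_2$ has ground set $E_1\sqcup E_2$ and independent sets $I_1\sqcup I_2$ with $I_k\in\mathcal{I}_k$. The matroids $\varepsilon$ and $\sigma$ are the one-element matroids whose element is an isthmus, respectively a loop; $\varepsilon^m$, $\sigma^n$ denote iterated direct sums ($m,n\ge 0$, the zero-fold sum being the empty matroid $\varnothing$). **Tutte polynomial.** $T(M;x,y)\in\mathbb{Z}[x,y]$ is the isomorphism invariant defined recursively by: $T(M;x,y)=T(M\backslash e;x,y)+T(M/e;x,y)$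 if $e$ is non-degenerate; $T(M;x,y)=x\,T(M/e;x,y)$ if $e$ is an isthmus; $T(M;x,y)=y\,T(M\backslash e;x,y)$ if $e$ is a loop; $T(\varnothing;x,y)=1$. $\mathcal{T}:\mathbb{Z}[\mathcal{M}]\to\mathbb{Z}[x,y]$ is the group homomorphism with $\mathcal{T}([M])=T(M;x,y)$. **Category of matroids.** $\mathbf{Mat}$ has as objects the matroids with ground set $E\subset\{1,2,\ldots\}$; a morphism $(E_1,\mathcal{I}_1)\to(E_2,\mathcal{I}_2)$ is an injective function $f:E_1\to E_2$ with $f(I)\in\mathcal{I}_2$ for all $I\in\mathcal{I}_1$. If $M'$ is a minor of $M$, the morphism $M'\to M$ given by the inclusion of ground sets is the standard inclusion. $\mathbf{Mat}_+$ is obtained from $\mathbf{Mat}$ by adding a disjoint base-point object $\ast$ (distinct from the empty matroid): the only endomorphism of $\ast$ is the identity, and there are no morphisms between $\ast$ and objects of $\mathbf{Mat}$ in either direction. One sets $M\oplus\ast=\ast\oplus M=\ast$ for all objects $M$ of $\mathbf{Mat}_+$. **Categories with covering families.** A multi-morphism in a small category is a finite (possibly empty) multi-set of morphisms $\{f_i:C_i\to B\}_{i\in I}$ with common target. Let $\mathcal{C}$ be a small category with a base-point object $\ast$ such that $\mathcal{C}(\ast,\ast)=\{\mathrm{Id}_\ast\}$ and $\mathcal{C}(C,\ast)=\varnothing$ for $C\neq\ast$. A covering family structure on $\mathcal{C}$ is a collection $\mathcal{S}$ of multi-morphisms (covering families) such that: (i) $\{\ast\to\ast\}_{i\in I}\in\mathcal{S}$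 for every finite (possibly empty) set $I$; (ii) $\{\mathrm{Id}_C\}\in\mathcal{S}$ for every object $C$; (iii) if $\{g_j:B_j\to C\}_{j\in J}\in\mathcal{S}$ and $\{f_{ij}:A_{ij}\to B_j\}_{i\in I_j}\in\mathcal{S}$ for each $j\in J$, then $\{g_j\circ f_{ij}:A_{ij}\to C\}_{j\in J,i\in I_j}\in\mathcal{S}$. The triple $(\mathcal{C},\mathcal{S},\ast)$ is a category with covering families. A morphism of such triples is a functor preserving base-points and mapping covering families to covering families. **$K_0$.** To a category with covering families $\mathcal{C}$, Bohmann–Gerhardt–Malkiewich–Merling–Zakharevich associate functorially a $K$-theory spectrum $K(\mathcal{C})$; $K_0(\mathcal{C}):=\pi_0K(\mathcal{C})$. By a known theorem of theirs, $K_0(\mathcal{C})$ is the free abelian group on the objects of $\mathcal{C}$ modulo the relations $[A]=\sum_{j\in J}[A_j]$ for every covering family $\{A_j\to A\}_{j\in J}$ in $\mathcal{S}$ (in particular $[\ast]=0$); a morphism $F$ induces $[A]\mapsto[F(A)]$. This presentation may be taken as the definition of $K_0$. **The structure $\mathcal{S}^{\cong}$.** It consists of all finite (possibly empty) families $\{\ast\to\ast\}_{i\in I}$ and all singletons $\{f:M\to N\}$ with $f$ an isomorphism in $\mathbf{Mat}_+$. Set $\mathbf{Mat}^{\cong}=(\mathbf{Mat}_+,\mathcal{S}^{\cong},\ast)$. Then $K_0(\mathbf{Mat}^{\cong})=\mathbb{Z}[\mathcal{M}]$, with the class of a matroid $M$ corresponding to its isomorphism class $[M]$. **The structure $\mathcal{S}^{\mathrm{tc}}$.**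 All rooted binary trees $T$ are finite; each vertex has at most two children; a vertex with no descendants is a leaf, otherwise it is internal; $\bullet_T$ is the root. $\mathcal{C}_T$ is the poset category on the vertices of $T$ with $w\leq v$ iff $w=v$ or $w$ is a descendant of $v$. An elementary deletion-contraction tree of shape $T$ is a functor $\mathcal{F}:\mathcal{C}_T\to\mathbf{Mat}_+$ such that: (i) $\mathcal{F}(\bullet_T)\neq\ast$; (ii) if an internal vertex $v$ has only one child $w$, then $\mathcal{F}(w)=\mathcal{F}(v)$ and $\mathcal{F}(w\to v)=\mathrm{Id}$; (iii) if an internal vertex $v$ has two children $w_1,w_2$, there is a non-degenerate element $e$ of $N:=\mathcal{F}(v)$ such that $\{\mathcal{F}(w_1),\mathcal{F}(w_2)\}$ are $N/e$ and $N\backslash e$ (one for each child, in either order), with $\mathcal{F}(w_1\to v)$ and $\mathcal{F}(w_2\to v)$ the standard inclusions into $N$. A deletion-contraction tree of shape $T$ is a functor $\mathcal{C}_T\to\mathbf{Mat}_+$ naturally isomorphic to an elementary one; it is rooted at $M$ if its value at $\bullet_T$ is $M$. If $v_1,\ldots,v_p$ are the leaves of $T$, the collection of leaf-to-root morphisms of $\mathcal{F}$ is $\{\mathcal{F}(v_j\to\bullet_T):\mathcal{F}(v_j)\to\mathcal{F}(\bullet_T)\}_{j=1,\ldots,p}$. $\mathcal{S}^{\mathrm{tc}}$ consists of all finite (possibly empty) families $\{\ast\to\ast\}_{i\in I}$ and, for $M\neq\ast$, all multi-morphisms $\{f_j:N_j\to M\}_{j=1,\ldots,p}$ that are the collection of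 leaf-to-root morphisms of some deletion-contraction tree rooted at $M$ (these are called Tutte coverings of $M$). $\mathcal{S}^{\mathrm{tc}}$ is a covering family structure on $\mathbf{Mat}_+$, and $\mathbf{Mat}^{\mathrm{tc}}=(\mathbf{Mat}_+,\mathcal{S}^{\mathrm{tc}},\ast)$. **The maps.** Every covering family in $\mathcal{S}^{\cong}$ is in $\mathcal{S}^{\mathrm{tc}}$, so the identity functor of $\mathbf{Mat}_+$ underlies a morphism $\Gamma:\mathbf{Mat}^{\cong}\to\mathbf{Mat}^{\mathrm{tc}}$; $\gamma:K_0(\mathbf{Mat}^{\cong})\to K_0(\mathbf{Mat}^{\mathrm{tc}})$ is the induced homomorphism. The group $K_0(\mathbf{Mat}^{\mathrm{tc}})$ is free abelian on the classes $[\varepsilon^m\oplus\sigma^n]$, $m,n\geq0$, and $\rho:K_0(\mathbf{Mat}^{\mathrm{tc}})\to\mathbb{Z}[x,y]$ is the isomorphism of abelian groups with $\rho([\varepsilon^m\oplus\sigma^n])=x^my^n$; it satisfies $\rho\circ\gamma=\mathcal{T}$. *)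

theory Defs
  imports
    "HOL-Algebra.Algebra"
    "HOL-Decision_Procs.Algebra_Aux"
    "HOL-Computational_Algebra.Polynomial"
    "HOL-Library.Multiset"
    "HOL-Library.Sublist"
begin

section \<open>Matroids\<close>

record 'a matroid =
  ground :: "'a set"
  indeps :: "'a set set"

definition is_matroid :: "'a matroid \<Rightarrow> bool" where
  "is_matroid M \<longleftrightarrow>
     finite (ground M) \<and>
     indeps M \<subseteq> Pow (ground M) \<and>
     {} \<in> indeps M \<and>
     (\<forall>I J. I \<in> indeps M \<and> J \<subseteq> I \<longrightarrow> J \<in> indeps M) \<and>
     (\<forall>I J. I \<in> indeps M \<and> J \<in> indeps M \<and> card J < card I \<longrightarrow>
        (\<exists>x\<in>I - J. J \<union> {x} \<in> indeps M))"

definition basis :: "'a matroid \<Rightarrow> 'a set \<Rightarrow> bool" where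
  "basis M B \<longleftrightarrow> B \<in> indeps M \<and> (\<forall>I\<in>indeps M. B \<subseteq> I \<longrightarrow> I = B)"

definition loop :: "'a matroid \<Rightarrow> 'a \<Rightarrow> bool" where
  "loop M e \<longleftrightarrow> e \<in> ground M \<and> {e} \<notin> indeps M"

definition isthmus :: "'a matroid \<Rightarrow> 'a \<Rightarrow> bool" where
  "isthmus M e \<longleftrightarrow> e \<in> ground M \<and> (\<forall>B. basis M B \<longrightarrow> e \<in> B)"

definition nondegenerate :: "'a matroid \<Rightarrow> 'a \<Rightarrow> bool" where
  "nondegenerate M e \<longleftrightarrow> e \<in> ground M \<and> \<not> loop M e \<and> \<not> isthmus M e"

text \<open>Deletion is only used for elements that are not isthmuses, contraction only for elements
  that are not loops.\<close>

definition deletion :: "'a matroid \<Rightarrow> 'a \<Rightarrow> 'a matroid" where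
  "deletion M e = \<lparr>ground = ground M - {e},
                   indeps = {I. I \<subseteq> ground M - {e} \<and> I \<in> indeps M}\<rparr>"

definition contraction :: "'a matroid \<Rightarrow> 'a \<Rightarrow> 'a matroid" where
  "contraction M e = \<lparr>ground = ground M - {e},
                      indeps = {I. I \<subseteq> ground M - {e} \<and> I \<union> {e} \<in> indeps M}\<rparr>"

definition matroid_iso :: "'a matroid \<Rightarrow> 'b matroid \<Rightarrow> bool" where
  "matroid_iso M N \<longleftrightarrow>
     (\<exists>f. bij_betw f (ground M) (ground N) \<and>
          (\<forall>I. I \<subseteq> ground M \<longrightarrow> (I \<in> indeps M \<longleftrightarrow> f ` I \<in> indeps N)))"

definition empty_matroid :: "'a matroid" where
  "empty_matroid = \<lparr>ground = {}, indeps = {{}}\<rparr>"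

definition direct_sum :: "'a matroid \<Rightarrow> 'b matroid \<Rightarrow> ('a + 'b) matroid" where
  "direct_sum M N = \<lparr>ground = ground M <+> ground N,
                     indeps = {I <+> J | I J. I \<in> indeps M \<and> J \<in> indeps N}\<rparr>"

definition relabel :: "('a \<Rightarrow> 'b) \<Rightarrow> 'a matroid \<Rightarrow> 'b matroid" where
  "relabel f M = \<lparr>ground = f ` ground M, indeps = (\<lambda>I. f ` I) ` indeps M\<rparr>"


section \<open>The Tutte polynomial\<close>

text \<open>\<open>\<int>[x,y]\<close> is rendered as \<open>\<int>[x][y]\<close>, with \<open>y\<close> the outer variable.\<close>

definition var_x :: "int poly poly" where "var_x = [:[:0, 1:]:]"
definition var_y :: "int poly poly" where "var_y = [:0, 1:]"

definition tutte_invariant :: "('a matroid \<Rightarrow> int poly poly) \<Rightarrow> bool" where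
  "tutte_invariant T \<longleftrightarrow>
     (\<forall>M N. is_matroid M \<and> is_matroid N \<and> matroid_iso M N \<longrightarrow> T M = T N) \<and>
     T empty_matroid = 1 \<and>
     (\<forall>M e. is_matroid M \<longrightarrow>
        (nondegenerate M e \<longrightarrow> T M = T (deletion M e) + T (contraction M e)) \<and>
        (isthmus M e \<longrightarrow> T M = var_x * T (contraction M e)) \<and>
        (loop M e \<longrightarrow> T M = var_y * T (deletion M e)))"

definition tutte :: "'a matroid \<Rightarrow> int poly poly" where
  "tutte = (THE T. T \<in> extensional {M. is_matroid M} \<and> tutte_invariant T)"


section \<open>Categories with covering families\<close>

text \<open>\<open>cmp C g f\<close> is the composite \<open>g \<circ> f\<close>; it is meaningful only if \<open>tgt C f = src C g\<close>.\<close>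

record ('o, 'a) cat =
  obs :: "'o set"
  arrs :: "'a set"
  src :: "'a \<Rightarrow> 'o"
  tgt :: "'a \<Rightarrow> 'o"
  ident :: "'o \<Rightarrow> 'a"
  cmp :: "'a \<Rightarrow> 'a \<Rightarrow> 'a"

definition iso_arr :: "('o, 'a, 'm) cat_scheme \<Rightarrow> 'a \<Rightarrow> bool" where
  "iso_arr C f \<longleftrightarrow> f \<in> arrs C \<and>
     (\<exists>g\<in>arrs C. src C g = tgt C f \<and> tgt C g = src C f \<and>
        cmp C g f = ident C (src C f) \<and> cmp C f g = ident C (tgt C f))"

record ('o, 'a, 'p, 'b) functr =
  on_obs :: "'o \<Rightarrow> 'p"
  on_arrs :: "'a \<Rightarrow> 'b"

definition is_functor ::
  "('o, 'a, 'm) cat_scheme \<Rightarrow> ('p, 'b, 'n) cat_scheme \<Rightarrow> ('o, 'a, 'p, 'b) functr \<Rightarrow> bool" where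
  "is_functor C D F \<longleftrightarrow>
     (\<forall>x\<in>obs C. on_obs F x \<in> obs D) \<and>
     (\<forall>f\<in>arrs C. on_arrs F f \<in> arrs D \<and>
        src D (on_arrs F f) = on_obs F (src C f) \<and> tgt D (on_arrs F f) = on_obs F (tgt C f)) \<and>
     (\<forall>x\<in>obs C. on_arrs F (ident C x) = ident D (on_obs F x)) \<and>
     (\<forall>f\<in>arrs C. \<forall>g\<in>arrs C. tgt C f = src C g \<longrightarrow>
        on_arrs F (cmp C g f) = cmp D (on_arrs F g) (on_arrs F f))"

definition id_functor :: "('o, 'a, 'o, 'a) functr" where
  "id_functor = \<lparr>on_obs = (\<lambda>x. x), on_arrs = (\<lambda>f. f)\<rparr>"

definition naturally_isomorphic ::
  "('o, 'a, 'm) cat_scheme \<Rightarrow> ('p, 'b, 'n) cat_scheme \<Rightarrow>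
   ('o, 'a, 'p, 'b) functr \<Rightarrow> ('o, 'a, 'p, 'b) functr \<Rightarrow> bool" where
  "naturally_isomorphic C D F G \<longleftrightarrow>
     (\<exists>\<eta>. (\<forall>x\<in>obs C. iso_arr D (\<eta> x) \<and>
              src D (\<eta> x) = on_obs F x \<and> tgt D (\<eta> x) = on_obs G x) \<and>
          (\<forall>f\<in>arrs C. cmp D (on_arrs G f) (\<eta> (src C f)) = cmp D (\<eta> (tgt C f)) (on_arrs F f)))"

text \<open>A multi-morphism is a pair \<open>(B, F)\<close> of its target and a multiset of morphisms with target
  \<open>B\<close>; recording \<open>B\<close> matters for empty families.\<close>

record ('o, 'a) covcat = "('o, 'a) cat" +
  basept :: 'o
  coverings :: "('o \<times> 'a multiset) set"


section \<open>\<open>K\<^sub>0\<close>\<close>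

text \<open>Groups from \<open>HOL-Algebra\<close> are written multiplicatively, so the \<open>monoid.mult\<close> of the groups
  below is the operation \<open>+\<close> of the (additive) abelian groups.\<close>

definition K0_relations :: "('o, 'a, 'm) covcat_scheme \<Rightarrow> ('o \<Rightarrow>\<^sub>0 int) set" where
  "K0_relations C = {frag_of A - (\<Sum>f\<in>#F. frag_of (src C f)) | A F. (A, F) \<in> coverings C}"

definition K0 :: "('o, 'a, 'm) covcat_scheme \<Rightarrow> ('o \<Rightarrow>\<^sub>0 int) set monoid" where
  "K0 C = free_Abelian_group (obs C) Mod generate (free_Abelian_group (obs C)) (K0_relations C)"

definition K0_class :: "('o, 'a, 'm) covcat_scheme \<Rightarrow> 'o \<Rightarrow> ('o \<Rightarrow>\<^sub>0 int) set" where
  "K0_class C A =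
     generate (free_Abelian_group (obs C)) (K0_relations C) #>\<^bsub>free_Abelian_group (obs C)\<^esub> frag_of A"

text \<open>The unique map in \<open>H\<close> (a set of maps out of the group \<open>G\<close>) that sends \<open>c s\<close> to \<open>\<phi> s\<close> for all
  \<open>s \<in> S\<close>.\<close>

definition the_map_with ::
  "('g \<Rightarrow> 'h) set \<Rightarrow> ('g, 'm) monoid_scheme \<Rightarrow> 's set \<Rightarrow> ('s \<Rightarrow> 'g) \<Rightarrow> ('s \<Rightarrow> 'h) \<Rightarrow> 'g \<Rightarrow> 'h" where
  "the_map_with H G S c \<phi> =
     (THE h. h \<in> H \<and> h \<in> extensional (carrier G) \<and> (\<forall>s\<in>S. h (c s) = \<phi> s))"

definition K0_map ::
  "('o, 'a, 'm) covcat_scheme \<Rightarrow> ('p, 'b, 'n) covcat_scheme \<Rightarrow> ('o, 'a, 'p, 'b) functr \<Rightarrow>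
   ('o \<Rightarrow>\<^sub>0 int) set \<Rightarrow> ('p \<Rightarrow>\<^sub>0 int) set" where
  "K0_map C D F =
     the_map_with (hom (K0 C) (K0 D)) (K0 C) (obs C) (K0_class C) (\<lambda>A. K0_class D (on_obs F A))"

text \<open>\<open>p\<close> is a biadditive operation on \<open>K\<^sub>0\<close> given on generators by the operation \<open>s\<close> on objects.\<close>

definition K0_product ::
  "('o, 'a, 'm) covcat_scheme \<Rightarrow> ('o \<Rightarrow> 'o \<Rightarrow> 'o) \<Rightarrow>
   (('o \<Rightarrow>\<^sub>0 int) set \<Rightarrow> ('o \<Rightarrow>\<^sub>0 int) set \<Rightarrow> ('o \<Rightarrow>\<^sub>0 int) set) \<Rightarrow> bool" where
  "K0_product C s p \<longleftrightarrow>
     p \<in> carrier (K0 C) \<rightarrow>\<^sub>E carrier (K0 C) \<rightarrow>\<^sub>E carrier (K0 C) \<and>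
     (\<forall>a\<in>carrier (K0 C). \<forall>b\<in>carrier (K0 C). \<forall>c\<in>carrier (K0 C).
        p (a \<otimes>\<^bsub>K0 C\<^esub> b) c = p a c \<otimes>\<^bsub>K0 C\<^esub> p b c \<and>
        p c (a \<otimes>\<^bsub>K0 C\<^esub> b) = p c a \<otimes>\<^bsub>K0 C\<^esub> p c b) \<and>
     (\<forall>A\<in>obs C. \<forall>B\<in>obs C. p (K0_class C A) (K0_class C B) = K0_class C (s A B))"

definition K0_ring ::
  "('o, 'a, 'm) covcat_scheme \<Rightarrow> ('o \<Rightarrow> 'o \<Rightarrow> 'o) \<Rightarrow> 'o \<Rightarrow> ('o \<Rightarrow>\<^sub>0 int) set ring" where
  "K0_ring C s u =
     \<lparr>carrier = carrier (K0 C), monoid.mult = (THE p. K0_product C s p), one = K0_class C u,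
      ring.zero = \<one>\<^bsub>K0 C\<^esub>, ring.add = monoid.mult (K0 C)\<rparr>"


section \<open>The category of matroids\<close>

definition Mat_obs :: "nat matroid set" where
  "Mat_obs = {M. is_matroid M \<and> 0 \<notin> ground M}"

text \<open>Objects of \<open>Mat\<^sub>+\<close>: \<open>Some M\<close> for a matroid \<open>M\<close>, and \<open>None\<close> for the base-point. Morphisms are
  triples (source, underlying function, target), where the function is undefined off the ground set
  of the source; the base-point has no elements.\<close>

type_synonym mat_ob = "nat matroid option"
type_synonym mat_arr = "mat_ob \<times> (nat \<Rightarrow> nat) \<times> mat_ob"

definition elements :: "mat_ob \<Rightarrow> nat set" where
  "elements A = (case A of None \<Rightarrow> {} | Some M \<Rightarrow> ground M)"

definition incl :: "mat_ob \<Rightarrow> mat_ob \<Rightarrow> mat_arr" where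
  "incl A B = (A, restrict (\<lambda>x. x) (elements A), B)"

definition Mat_plus :: "(mat_ob, mat_arr) cat" where
  "Mat_plus =
     \<lparr>obs = insert None (Some ` Mat_obs),
      arrs = insert (incl None None)
        {(Some M, f, Some N) | M f N. M \<in> Mat_obs \<and> N \<in> Mat_obs \<and>
           f \<in> ground M \<rightarrow>\<^sub>E ground N \<and> inj_on f (ground M) \<and>
           (\<forall>I\<in>indeps M. f ` I \<in> indeps N)},
      src = (\<lambda>(A, f, B). A),
      tgt = (\<lambda>(A, f, B). B),
      ident = (\<lambda>A. incl A A),
      cmp = (\<lambda>(B', g, C) (A, f, B). (A, compose (elements A) g f, C))\<rparr>"

definition base_families :: "(mat_ob \<times> mat_arr multiset) set" where
  "base_families = {(None, replicate_mset n (ident Mat_plus None)) | n. True}"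

definition Mat_iso :: "(mat_ob, mat_arr) covcat" where
  "Mat_iso = cat.extend Mat_plus
     \<lparr>basept = None,
      coverings = base_families \<union> {(tgt Mat_plus f, {#f#}) | f. iso_arr Mat_plus f}\<rparr>"

subsection \<open>Tutte coverings\<close>

text \<open>The vertices of a rooted binary tree are given by their addresses: the root is \<open>[]\<close>, and the
  (at most two) children of \<open>v\<close> are among \<open>v @ [False]\<close> and \<open>v @ [True]\<close>. Hence \<open>w\<close> is \<open>v\<close> or a
  descendant of \<open>v\<close> iff \<open>v\<close> is a prefix of \<open>w\<close>.\<close>

definition binary_tree :: "bool list set \<Rightarrow> bool" where
  "binary_tree T \<longleftrightarrow> finite T \<and> [] \<in> T \<and> (\<forall>w\<in>T. \<forall>v. prefix v w \<longrightarrow> v \<in> T)"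

definition children :: "bool list set \<Rightarrow> bool list \<Rightarrow> bool list set" where
  "children T v = {w \<in> T. \<exists>b. w = v @ [b]}"

definition leaves :: "bool list set \<Rightarrow> bool list set" where
  "leaves T = {v \<in> T. children T v = {}}"

text \<open>The arrow \<open>(w, v)\<close> goes from \<open>w\<close> to \<open>v\<close>.\<close>

definition tree_cat :: "bool list set \<Rightarrow> (bool list, bool list \<times> bool list) cat" where
  "tree_cat T =
     \<lparr>obs = T,
      arrs = {(w, v). w \<in> T \<and> v \<in> T \<and> prefix v w},
      src = fst, tgt = snd,
      ident = (\<lambda>v. (v, v)),
      cmp = (\<lambda>g f. (fst f, snd g))\<rparr>"

type_synonym tree_functor = "(bool list, bool list \<times> bool list, mat_ob, mat_arr) functr"

definition elementary_dc_tree :: "bool list set \<Rightarrow> tree_functor \<Rightarrow> bool" where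
  "elementary_dc_tree T F \<longleftrightarrow>
     is_functor (tree_cat T) Mat_plus F \<and>
     on_obs F [] \<noteq> None \<and>
     (\<forall>v\<in>T. \<forall>w. children T v = {w} \<longrightarrow>
        on_obs F w = on_obs F v \<and> on_arrs F (w, v) = ident Mat_plus (on_obs F v)) \<and>
     (\<forall>v\<in>T. \<forall>w1 w2. w1 \<noteq> w2 \<and> children T v = {w1, w2} \<longrightarrow>
        (\<exists>N e. on_obs F v = Some N \<and> nondegenerate N e \<and>
           ((on_obs F w1 = Some (contraction N e) \<and> on_obs F w2 = Some (deletion N e)) \<or>
            (on_obs F w1 = Some (deletion N e) \<and> on_obs F w2 = Some (contraction N e))) \<and>
           on_arrs F (w1, v) = incl (on_obs F w1) (Some N) \<and>
           on_arrs F (w2, v) = incl (on_obs F w2) (Some N)))"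

definition dc_tree :: "bool list set \<Rightarrow> tree_functor \<Rightarrow> bool" where
  "dc_tree T F \<longleftrightarrow> is_functor (tree_cat T) Mat_plus F \<and>
     (\<exists>G. elementary_dc_tree T G \<and> naturally_isomorphic (tree_cat T) Mat_plus F G)"

definition leaf_to_root :: "bool list set \<Rightarrow> tree_functor \<Rightarrow> mat_arr multiset" where
  "leaf_to_root T F = image_mset (\<lambda>v. on_arrs F (v, [])) (mset_set (leaves T))"

definition Mat_tc :: "(mat_ob, mat_arr) covcat" where
  "Mat_tc = cat.extend Mat_plus
     \<lparr>basept = None,
      coverings = base_families \<union>
        {(Some M, leaf_to_root T F) | M T F.
           binary_tree T \<and> dc_tree T F \<and> on_obs F [] = Some M}\<rparr>"

subsection \<open>Direct sums in \<open>Mat\<^sub>+\<close>\<close>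

text \<open>Objects of \<open>Mat\<close> have their ground set in \<open>{1,2,...}\<close>, so the disjoint union is realised by
  the odd (left summand) and the even (right summand) positive integers.\<close>

definition Mat_sum :: "nat matroid \<Rightarrow> nat matroid \<Rightarrow> nat matroid" where
  "Mat_sum M N = relabel (case_sum (\<lambda>n. 2 * n - 1) (\<lambda>n. 2 * n)) (direct_sum M N)"

definition osum :: "mat_ob \<Rightarrow> mat_ob \<Rightarrow> mat_ob" where
  "osum A B = (case (A, B) of (Some M, Some N) \<Rightarrow> Some (Mat_sum M N) | _ \<Rightarrow> None)"

definition eps :: "nat matroid" where
  "eps = \<lparr>ground = {1}, indeps = {{}, {1}}\<rparr>"

definition sig :: "nat matroid" where
  "sig = \<lparr>ground = {1}, indeps = {{}}\<rparr>"

definition Mat_power :: "nat matroid \<Rightarrow> nat \<Rightarrow> nat matroid" where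
  "Mat_power M n = (Mat_sum M ^^ n) empty_matroid"


section \<open>The rings and the maps between them\<close>

abbreviation K0_iso_ring :: "(mat_ob \<Rightarrow>\<^sub>0 int) set ring" where
  "K0_iso_ring \<equiv> K0_ring Mat_iso osum (Some empty_matroid)"

abbreviation K0_tc_ring :: "(mat_ob \<Rightarrow>\<^sub>0 int) set ring" where
  "K0_tc_ring \<equiv> K0_ring Mat_tc osum (Some empty_matroid)"

abbreviation Zxy :: "int poly poly ring" where
  "Zxy \<equiv> cring_class_ops"

definition \<gamma> :: "(mat_ob \<Rightarrow>\<^sub>0 int) set \<Rightarrow> (mat_ob \<Rightarrow>\<^sub>0 int) set" where
  "\<gamma> = K0_map Mat_iso Mat_tc id_functor"

definition \<rho> :: "(mat_ob \<Rightarrow>\<^sub>0 int) set \<Rightarrow> int poly poly" where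
  "\<rho> = the_map_with (iso (K0 Mat_tc) (add_monoid Zxy)) (K0 Mat_tc) UNIV
         (\<lambda>(m, n). K0_class Mat_tc (Some (Mat_sum (Mat_power eps m) (Mat_power sig n))))
         (\<lambda>(m, n). var_x ^ m * var_y ^ n)"

text \<open>The group \<open>\<int>[\<M>]\<close>, the homomorphism \<open>\<T>\<close> on it, and its identification with
  \<open>K\<^sub>0(Mat\<^sup>\<cong>)\<close>.\<close>

definition iso_class :: "nat matroid \<Rightarrow> nat matroid set" where
  "iso_class M = {N \<in> Mat_obs. matroid_iso M N}"

definition ZM :: "(nat matroid set \<Rightarrow>\<^sub>0 int) monoid" where
  "ZM = free_Abelian_group (iso_class ` Mat_obs)"

definition tutte_hom :: "(nat matroid set \<Rightarrow>\<^sub>0 int) \<Rightarrow> int poly poly" where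
  "tutte_hom = the_map_with (hom ZM (add_monoid Zxy)) ZM Mat_obs
                 (\<lambda>M. frag_of (iso_class M)) tutte"

definition K0_iso_to_ZM :: "(mat_ob \<Rightarrow>\<^sub>0 int) set \<Rightarrow> (nat matroid set \<Rightarrow>\<^sub>0 int)" where
  "K0_iso_to_ZM = the_map_with (iso (K0 Mat_iso) ZM) (K0 Mat_iso) Mat_obs
                    (\<lambda>M. K0_class Mat_iso (Some M)) (\<lambda>M. frag_of (iso_class M))"

definition \<T> :: "(mat_ob \<Rightarrow>\<^sub>0 int) set \<Rightarrow> int poly poly" where
  "\<T> = tutte_hom \<circ> K0_iso_to_ZM"

end

theory Submission
  imports Defs
begin

text \<open>The Tutte polynomial exists as the rank generating sum
  \<open>\<Sum>A\<subseteq>E. (x - 1)\<^bsup>r E - r A\<^esup> (y - 1)\<^bsup>card A - r A\<^esup>\<close>, which visibly turns direct sums into products. It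
  vanishes on the relations of \<open>K\<^sub>0(Mat\<^sup>t\<^sup>c)\<close>, and because deletion-contraction reduces every matroid
  to the matroids \<open>\<epsilon>\<^sup>m \<oplus> \<sigma>\<^sup>n\<close>, whose polynomials \<open>x\<^sup>m y\<^sup>n\<close> form a basis, it identifies
  \<open>K\<^sub>0(Mat\<^sup>t\<^sup>c)\<close> with \<open>\<int>[x,y]\<close>. Likewise \<open>K\<^sub>0(Mat\<^sup>\<cong>)\<close> is the monoid ring over \<open>\<int>\<close> of the commutative
  monoid of isomorphism classes under direct sum. In both cases \<open>K\<^sub>0\<close> embeds in a commutative ring in
  which direct sum is multiplication, so the product is well defined and the ring axioms are inherited.
  The three maps are multiplicative because they are so on the classes of matroids.\<close>

section \<open>Rank\<close>

text \<open>Checking directly that direct sums respect Tutte coverings would mean adding a fixed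
  summand, with relabelled ground sets, to every vertex of a deletion-contraction tree. The
  embedding avoids this: the image of \<open>K0\<close> is spanned by images of objects, hence
  closed under multiplication, and injectivity pulls the product back. The work moves to
  injectivity, which in both cases comes from an additive section: coefficients of a polynomial
  become coefficients of split matroids for \<open>Mat_tc\<close>, and each isomorphism class gets a
  chosen representative for \<open>Mat_iso\<close>. The base-point goes to 0, which fits both its
  empty covering and its absorbing role in \<open>osum\<close>.

  The explicit rank sum also settles existence, since the recursion alone does not show that
  different orders of eliminating elements agree. As \<open>tutte\<close>, \<rho>, \<gamma> and the
  two factors of \<T> are definite descriptions, nothing can be said of them before a concrete map
  is shown to be the only candidate. Multiplicativity of \<gamma> is read off in \<int>[x,y],
  because its target embeds there.\<close>

definition rank :: "'a matroid \<Rightarrow> 'a set \<Rightarrow> nat" where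
  "rank M A = Max (card ` {I \<in> indeps M. I \<subseteq> A})"

lemma is_matroidD:
  assumes "is_matroid M"
  shows is_matroid_finite: "finite (ground M)"
    and is_matroid_subset: "I \<in> indeps M \<Longrightarrow> I \<subseteq> ground M"
    and is_matroid_empty: "{} \<in> indeps M"
    and is_matroid_down: "I \<in> indeps M \<Longrightarrow> J \<subseteq> I \<Longrightarrow> J \<in> indeps M"
    and is_matroid_augment:
      "I \<in> indeps M \<Longrightarrow> J \<in> indeps M \<Longrightarrow> card J < card I \<Longrightarrow> \<exists>x\<in>I - J. insert x J \<in> indeps M"
  using assms unfolding is_matroid_def by auto

lemma is_matroid_Pow: "is_matroid M \<Longrightarrow> indeps M \<subseteq> Pow (ground M)"
  by (simp add: is_matroid_def)

lemma is_matroid_finite_indep: "is_matroid M \<Longrightarrow> I \<in> indeps M \<Longrightarrow> finite I"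
  by (meson finite_subset is_matroid_finite is_matroid_subset)

lemma finite_indeps: "is_matroid M \<Longrightarrow> finite (indeps M)"
  by (rule finite_subset[of _ "Pow (ground M)"]) (auto dest: is_matroid_subset is_matroid_finite)

lemma card_le_rank:
  assumes "is_matroid M" "I \<in> indeps M" "I \<subseteq> A"
  shows "card I \<le> rank M A"
  unfolding rank_def using assms by (intro Max_ge) (auto simp: finite_indeps)

lemma rank_witness:
  assumes "is_matroid M"
  shows "\<exists>I\<in>indeps M. I \<subseteq> A \<and> card I = rank M A"
proof -
  have "rank M A \<in> card ` {I \<in> indeps M. I \<subseteq> A}"
    unfolding rank_def using is_matroid_empty[OF assms] finite_indeps[OF assms] by (intro Max_in) auto
  then obtain I where "rank M A = card I" "I \<in> {I \<in> indeps M. I \<subseteq> A}" by (rule imageE)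
  thus ?thesis by (intro bexI[of _ I]) simp_all
qed

text \<open>As long as \<open>J\<close> is smaller than a largest independent subset of
  \<open>A\<close>, augmentation supplies one more element from that subset, so the deficit to the
  rank decreases.\<close>

lemma rank_extend:
  assumes M: "is_matroid M" and J: "J \<in> indeps M" "J \<subseteq> A"
  shows "\<exists>I\<in>indeps M. J \<subseteq> I \<and> I \<subseteq> A \<and> card I = rank M A"
  using J
proof (induction "rank M A - card J" arbitrary: J)
  case 0
  then have "card J = rank M A" using card_le_rank[OF M] by (metis diff_is_0_eq le_antisym)
  with 0 show ?case by blast
next
  case (Suc n)
  obtain I where I: "I \<in> indeps M" "I \<subseteq> A" "card I = rank M A" using rank_witness[OF M] by blast
  with Suc.hyps(2) have "card J < card I" by simp
  then obtain x where x: "x \<in> I - J" "insert x J \<in> indeps M"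
    using is_matroid_augment[OF M I(1) Suc.prems(1)] by blast
  have "card (insert x J) = Suc (card J)"
    using x is_matroid_finite_indep[OF M Suc.prems(1)] by simp
  then have "n = rank M A - card (insert x J)" using Suc.hyps(2) by simp
  from Suc.hyps(1)[OF this x(2)] show ?case using x I Suc.prems by blast
qed

lemma rank_mono:
  assumes "is_matroid M" "A \<subseteq> B"
  shows "rank M A \<le> rank M B"
  using rank_witness[OF assms(1), of A] card_le_rank[OF assms(1)] assms(2) by (metis subset_trans)

lemma rank_le_card:
  assumes "is_matroid M" "finite A"
  shows "rank M A \<le> card A"
  using rank_witness[OF assms(1), of A] card_mono[OF assms(2)] by metis

lemma basis_card:
  assumes M: "is_matroid M" and B: "basis M B"
  shows "card B = rank M (ground M)"
proof -
  have "B \<in> indeps M" using B by (simp add: basis_def)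
  then obtain I where "I \<in> indeps M" "B \<subseteq> I" "card I = rank M (ground M)"
    using rank_extend[OF M, of B "ground M"] is_matroid_subset[OF M] by blast
  thus ?thesis using B by (auto simp: basis_def)
qed

lemma indep_extends_to_basis:
  assumes M: "is_matroid M" and J: "J \<in> indeps M"
  shows "\<exists>B. basis M B \<and> J \<subseteq> B"
proof -
  obtain I where I: "I \<in> indeps M" "J \<subseteq> I" "card I = rank M (ground M)"
    using rank_extend[OF M J is_matroid_subset[OF M J]] by blast
  have "K = I" if "K \<in> indeps M" "I \<subseteq> K" for K
    using that I card_le_rank[OF M that(1) is_matroid_subset[OF M that(1)]]
      is_matroid_finite_indep[OF M that(1)] by (metis card_subset_eq card_mono le_antisym)
  thus ?thesis using I unfolding basis_def by blast
qed

section \<open>Loops, isthmuses and minors\<close>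

lemma not_loop_singleton: "e \<in> ground M \<Longrightarrow> \<not> loop M e \<Longrightarrow> {e} \<in> indeps M"
  by (simp add: loop_def)

lemma isthmus_not_loop:
  assumes M: "is_matroid M" and e: "isthmus M e"
  shows "\<not> loop M e"
proof -
  obtain B where "basis M B" using indep_extends_to_basis[OF M is_matroid_empty[OF M]] by blast
  then have "e \<in> B" "B \<in> indeps M" using e by (auto simp: isthmus_def basis_def)
  then show ?thesis using is_matroid_down[OF M, of B "{e}"] by (simp add: loop_def)
qed

text \<open>A basis through \<open>I\<close> contains the isthmus \<open>e\<close> as well, and
  subsets of a basis are independent.\<close>

lemma isthmus_insert_indep:
  assumes M: "is_matroid M" and e: "isthmus M e" and I: "I \<in> indeps M"
  shows "insert e I \<in> indeps M"
proof -
  obtain B where B: "basis M B" "I \<subseteq> B" using indep_extends_to_basis[OF M I] by blast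
  then have "e \<in> B" "B \<in> indeps M" using e by (auto simp: isthmus_def basis_def)
  thus ?thesis using is_matroid_down[OF M, of B "insert e I"] B by blast
qed

lemma loop_notin_indep: "is_matroid M \<Longrightarrow> loop M e \<Longrightarrow> I \<in> indeps M \<Longrightarrow> e \<notin> I"
  using is_matroid_down[of M I "{e}"] by (auto simp: loop_def)

section \<open>Deletion and contraction: matroid axioms and ranks\<close>

lemma ground_deletion [simp]: "ground (deletion M e) = ground M - {e}"
  and ground_contraction [simp]: "ground (contraction M e) = ground M - {e}"
  by (simp_all add: deletion_def contraction_def)

lemma indeps_deletion: "is_matroid M \<Longrightarrow> I \<in> indeps (deletion M e) \<longleftrightarrow> e \<notin> I \<and> I \<in> indeps M"
  by (auto simp: deletion_def dest: is_matroid_subset)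

lemma indeps_contraction:
  "is_matroid M \<Longrightarrow> I \<in> indeps (contraction M e) \<longleftrightarrow> e \<notin> I \<and> insert e I \<in> indeps M"
  by (auto simp: contraction_def dest: is_matroid_subset)

lemma is_matroid_deletion:
  assumes M: "is_matroid M"
  shows "is_matroid (deletion M e)"
  unfolding is_matroid_def
proof (intro conjI allI impI)
  show "finite (ground (deletion M e))" using is_matroid_finite[OF M] by simp
  show "indeps (deletion M e) \<subseteq> Pow (ground (deletion M e))" by (auto simp: deletion_def)
  show "{} \<in> indeps (deletion M e)" by (simp add: indeps_deletion[OF M] is_matroid_empty[OF M])
next
  fix I J assume "I \<in> indeps (deletion M e) \<and> J \<subseteq> I"
  thus "J \<in> indeps (deletion M e)" using is_matroid_down[OF M, of I J] by (auto simp: indeps_deletion[OF M])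
next
  fix I J assume "I \<in> indeps (deletion M e) \<and> J \<in> indeps (deletion M e) \<and> card J < card I"
  thus "\<exists>x\<in>I - J. J \<union> {x} \<in> indeps (deletion M e)"
    using is_matroid_augment[OF M, of I J] by (auto simp: indeps_deletion[OF M])
qed

lemma is_matroid_contraction:
  assumes M: "is_matroid M" and e: "{e} \<in> indeps M"
  shows "is_matroid (contraction M e)"
  unfolding is_matroid_def
proof (intro conjI allI impI)
  show "finite (ground (contraction M e))" using is_matroid_finite[OF M] by simp
  show "indeps (contraction M e) \<subseteq> Pow (ground (contraction M e))" by (auto simp: contraction_def)
  show "{} \<in> indeps (contraction M e)" by (simp add: indeps_contraction[OF M] e)
next
  fix I J assume "I \<in> indeps (contraction M e) \<and> J \<subseteq> I"
  thus "J \<in> indeps (contraction M e)"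
    using is_matroid_down[OF M, of "insert e I" "insert e J"] by (auto simp: indeps_contraction[OF M])
next
  fix I J assume *: "I \<in> indeps (contraction M e) \<and> J \<in> indeps (contraction M e) \<and> card J < card I"
  then have IJ: "e \<notin> I" "insert e I \<in> indeps M" "e \<notin> J" "insert e J \<in> indeps M"
    by (auto simp: indeps_contraction[OF M])
  then have "finite I" "finite J" using is_matroid_finite_indep[OF M] by fastforce+
  then have "card (insert e J) < card (insert e I)" using * IJ by simp
  then obtain x where "x \<in> insert e I - insert e J" "insert x (insert e J) \<in> indeps M"
    using is_matroid_augment[OF M IJ(2) IJ(4)] by blast
  thus "\<exists>x\<in>I - J. J \<union> {x} \<in> indeps (contraction M e)"
    using IJ by (intro bexI[of _ x]) (auto simp: indeps_contraction[OF M] insert_commute)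
qed

lemma rank_deletion:
  assumes M: "is_matroid M" and "e \<notin> A"
  shows "rank (deletion M e) A = rank M A"
proof -
  have "{I \<in> indeps (deletion M e). I \<subseteq> A} = {I \<in> indeps M. I \<subseteq> A}"
    using assms by (auto simp: indeps_deletion[OF M])
  thus ?thesis by (simp add: rank_def)
qed

text \<open>Adding and removing \<open>e\<close> matches independent sets of the contraction with
  independent sets of \<open>M\<close> through \<open>e\<close>; the latter still reach the full
  rank of \<open>insert e A\<close>, because \<open>{e}\<close> extends to a largest independent
  subset.\<close>

lemma rank_contraction:
  assumes M: "is_matroid M" and e: "{e} \<in> indeps M" and A: "e \<notin> A"
  shows "rank M (insert e A) = Suc (rank (contraction M e) A)"
proof -
  note C = is_matroid_contraction[OF M e]
  obtain I where I: "I \<in> indeps (contraction M e)" "I \<subseteq> A" "card I = rank (contraction M e) A"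
    using rank_witness[OF C] by blast
  then have I': "e \<notin> I" "insert e I \<in> indeps M" by (auto simp: indeps_contraction[OF M])
  then have "finite I" using is_matroid_finite_indep[OF M I'(2)] by simp
  then have 1: "Suc (rank (contraction M e) A) \<le> rank M (insert e A)"
    using card_le_rank[OF M I'(2), of "insert e A"] I I' by (simp add: subset_insertI2)
  obtain J where J: "J \<in> indeps M" "{e} \<subseteq> J" "J \<subseteq> insert e A" "card J = rank M (insert e A)"
    using rank_extend[OF M e, of "insert e A"] by blast
  have "J - {e} \<in> indeps (contraction M e)" "J - {e} \<subseteq> A"
    using J by (auto simp: indeps_contraction[OF M] insert_absorb)
  from card_le_rank[OF C this] have "card (J - {e}) \<le> rank (contraction M e) A" .
  moreover have "card J = Suc (card (J - {e}))"
    using J is_matroid_finite_indep[OF M J(1)] by (metis card_Suc_Diff1 insert_subset)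
  ultimately show ?thesis using 1 J by simp
qed

text \<open>Contracting an isthmus leaves the same independent sets as deleting it, so the
  contraction formula can be evaluated with ranks in \<open>M\<close>.\<close>

lemma rank_insert_isthmus:
  assumes M: "is_matroid M" and e: "isthmus M e" and A: "e \<notin> A"
  shows "rank M (insert e A) = Suc (rank M A)"
proof -
  have "I \<in> indeps (contraction M e) \<longleftrightarrow> I \<in> indeps (deletion M e)" for I
    using is_matroid_down[OF M, of "insert e I" I] isthmus_insert_indep[OF M e]
    by (auto simp: indeps_deletion[OF M] indeps_contraction[OF M])
  then have "indeps (contraction M e) = indeps (deletion M e)" by blast
  then have "rank (contraction M e) A = rank M A"
    using rank_deletion[OF M A] by (simp add: rank_def)
  thus ?thesis
    using rank_contraction[OF M _ A] isthmus_not_loop[OF M e] e by (simp add: loop_def isthmus_def)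
qed

lemma rank_insert_loop:
  assumes M: "is_matroid M" and e: "loop M e"
  shows "rank M (insert e A) = rank M A"
proof -
  have "{I \<in> indeps M. I \<subseteq> insert e A} = {I \<in> indeps M. I \<subseteq> A}"
    using loop_notin_indep[OF assms] by blast
  thus ?thesis by (simp add: rank_def)
qed

text \<open>Some basis avoids \<open>e\<close>, and all bases have full rank.\<close>

lemma rank_ground_not_isthmus:
  assumes M: "is_matroid M" and e: "e \<in> ground M" "\<not> isthmus M e"
  shows "rank M (ground M - {e}) = rank M (ground M)"
proof -
  obtain B where B: "basis M B" "e \<notin> B" using e by (auto simp: isthmus_def)
  have "B \<in> indeps M" using B by (simp add: basis_def)
  then have "rank M (ground M) \<le> rank M (ground M - {e})"
    using card_le_rank[OF M, of B "ground M - {e}"] basis_card[OF M B(1)] B is_matroid_subset[OF M] by auto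
  thus ?thesis using rank_mono[OF M, of "ground M - {e}" "ground M"] by simp
qed

section \<open>The rank generating polynomial\<close>

text \<open>One summand of the corank-nullity polynomial. The subtractions are truncated, but the
  rank of a subset is at most the rank of the ground set and its own cardinality, so in every use
  both exponents are true differences.\<close>

definition rank_term :: "nat \<Rightarrow> nat \<Rightarrow> nat \<Rightarrow> int poly poly" where
  "rank_term r s k = (var_x - 1) ^ (r - s) * (var_y - 1) ^ (k - s)"

definition rank_poly :: "'a matroid \<Rightarrow> int poly poly" where
  "rank_poly M = (\<Sum>A\<in>Pow (ground M). rank_term (rank M (ground M)) (rank M A) (card A))"

lemma sum_Pow_split:
  assumes "finite E" "e \<in> E"
  shows "sum f (Pow E) = sum f (Pow (E - {e})) + (\<Sum>A\<in>Pow (E - {e}). f (insert e A))"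
proof -
  have "Pow E = Pow (insert e (E - {e}))" using assms by (simp add: insert_absorb)
  also have "\<dots> = Pow (E - {e}) \<union> insert e ` Pow (E - {e})" by (rule Pow_insert)
  finally have "sum f (Pow E) = sum f (Pow (E - {e})) + sum f (insert e ` Pow (E - {e}))"
    using assms by (simp only:) (intro sum.union_disjoint, auto)
  moreover have "sum f (insert e ` Pow (E - {e})) = (\<Sum>A\<in>Pow (E - {e}). f (insert e A))"
    by (subst sum.reindex) (auto simp: inj_on_def)
  ultimately show ?thesis by simp
qed

text \<open>Passing from \<open>A\<close> in the contraction to \<open>insert e A\<close> in
  \<open>M\<close> raises the total rank, the rank and the cardinality by one each, so both
  exponents stay the same.\<close>

lemma rank_poly_contraction:
  assumes M: "is_matroid M" and e: "e \<in> ground M" "\<not> loop M e"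
  shows "(\<Sum>A\<in>Pow (ground M - {e}).
            rank_term (rank M (ground M)) (rank M (insert e A)) (card (insert e A))) =
         rank_poly (contraction M e)"
proof -
  have s: "{e} \<in> indeps M" using e by (rule not_loop_singleton)
  have g: "rank M (ground M) = Suc (rank (contraction M e) (ground M - {e}))"
    using rank_contraction[OF M s, of "ground M - {e}"] e by (simp add: insert_absorb)
  show ?thesis unfolding rank_poly_def ground_contraction
  proof (rule sum.cong)
    fix A assume A: "A \<in> Pow (ground M - {e})"
    then have "finite A" "e \<notin> A" using is_matroid_finite[OF M] by (auto intro: finite_subset)
    with g rank_contraction[OF M s, of A]
    show "rank_term (rank M (ground M)) (rank M (insert e A)) (card (insert e A)) =
      rank_term (rank (contraction M e) (ground M - {e})) (rank (contraction M e) A) (card A)"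
      by (simp add: rank_term_def)
  qed simp
qed

lemma rank_poly_deletion:
  assumes M: "is_matroid M"
  shows "rank_poly (deletion M e) =
    (\<Sum>A\<in>Pow (ground M - {e}). rank_term (rank M (ground M - {e})) (rank M A) (card A))"
  unfolding rank_poly_def by (auto intro!: sum.cong simp: rank_deletion[OF M] subset_Diff_insert)

text \<open>Subsets avoiding \<open>e\<close> yield the deletion, whose total rank is unchanged
  because \<open>e\<close> is no isthmus; subsets containing \<open>e\<close> yield the
  contraction.\<close>

lemma rank_poly_nondegenerate:
  assumes M: "is_matroid M" and e: "nondegenerate M e"
  shows "rank_poly M = rank_poly (deletion M e) + rank_poly (contraction M e)"
proof -
  have e': "e \<in> ground M" "\<not> loop M e" "\<not> isthmus M e" using e by (auto simp: nondegenerate_def)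
  show ?thesis
    unfolding rank_poly_contraction[OF M e'(1,2), symmetric] rank_poly_deletion[OF M]
      rank_ground_not_isthmus[OF M e'(1,3)]
    unfolding rank_poly_def by (rule sum_Pow_split[OF is_matroid_finite[OF M] e'(1)])
qed

text \<open>Dropping an isthmus from a subset raises the corank by one and keeps the nullity. The
  subsets without \<open>e\<close> therefore contribute x - 1 times what those with \<open>e\<close>
  contribute, and the two together give the factor x.\<close>

lemma rank_poly_isthmus:
  assumes M: "is_matroid M" and e: "isthmus M e"
  shows "rank_poly M = var_x * rank_poly (contraction M e)"
proof -
  have e': "e \<in> ground M" "\<not> loop M e" using e isthmus_not_loop[OF M e] by (auto simp: isthmus_def)
  have g: "rank M (ground M) = Suc (rank M (ground M - {e}))"
    using rank_insert_isthmus[OF M e, of "ground M - {e}"] e' by (simp add: insert_absorb)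
  have "rank_term (rank M (ground M)) (rank M A) (card A) =
      (var_x - 1) * rank_term (rank M (ground M)) (rank M (insert e A)) (card (insert e A))"
    if A: "A \<in> Pow (ground M - {e})" for A
  proof -
    have "finite A" "e \<notin> A" using A is_matroid_finite[OF M] by (auto intro: finite_subset)
    moreover have "rank M A \<le> rank M (ground M - {e})" using A by (intro rank_mono[OF M]) auto
    ultimately show ?thesis
      using rank_insert_isthmus[OF M e, of A] g by (simp add: rank_term_def Suc_diff_le mult_ac)
  qed
  then have "(\<Sum>A\<in>Pow (ground M - {e}). rank_term (rank M (ground M)) (rank M A) (card A)) =
      (var_x - 1) * rank_poly (contraction M e)"
    unfolding rank_poly_contraction[OF M e', symmetric] sum_distrib_left by (rule sum.cong[OF refl])
  then show ?thesis
    unfolding rank_poly_def[of M] sum_Pow_split[OF is_matroid_finite[OF M] e'(1)]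
      rank_poly_contraction[OF M e'] by (simp add: algebra_simps)
qed

text \<open>Dual to the isthmus case: adding a loop to a subset raises the nullity by one and keeps
  the corank, so the factor is 1 + (y - 1).\<close>

lemma rank_poly_loop:
  assumes M: "is_matroid M" and e: "loop M e"
  shows "rank_poly M = var_y * rank_poly (deletion M e)"
proof -
  have e': "e \<in> ground M" using e by (auto simp: loop_def)
  have g: "rank M (ground M - {e}) = rank M (ground M)"
    using rank_insert_loop[OF M e, of "ground M - {e}"] e' by (simp add: insert_absorb)
  have "rank_term (rank M (ground M)) (rank M (insert e A)) (card (insert e A)) =
      (var_y - 1) * rank_term (rank M (ground M)) (rank M A) (card A)"
    if A: "A \<in> Pow (ground M - {e})" for A
  proof -
    have "finite A" "e \<notin> A" using A is_matroid_finite[OF M] by (auto intro: finite_subset)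
    then show ?thesis
      using rank_insert_loop[OF M e, of A] rank_le_card[OF M, of A]
      by (simp add: rank_term_def Suc_diff_le mult_ac)
  qed
  then have "(\<Sum>A\<in>Pow (ground M - {e}). rank_term (rank M (ground M)) (rank M (insert e A)) (card (insert e A))) =
      (var_y - 1) * rank_poly (deletion M e)"
    unfolding rank_poly_deletion[OF M] g sum_distrib_left by (rule sum.cong[OF refl])
  then show ?thesis
    unfolding rank_poly_def[of M] sum_Pow_split[OF is_matroid_finite[OF M] e']
    using rank_poly_deletion[OF M, of e] g by (simp add: algebra_simps)
qed

section \<open>Isomorphism invariance, and the rank sum as the Tutte polynomial\<close>

lemma rank_image:
  assumes f: "inj_on f (ground M)" "A \<subseteq> ground M" "indeps M \<subseteq> Pow (ground M)" "indeps N \<subseteq> Pow (f ` ground M)"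
    and I: "\<And>I. I \<subseteq> ground M \<Longrightarrow> I \<in> indeps M \<longleftrightarrow> f ` I \<in> indeps N"
  shows "rank N (f ` A) = rank M A"
proof -
  have "{J \<in> indeps N. J \<subseteq> f ` A} = (`) f ` {I \<in> indeps M. I \<subseteq> A}"
  proof (intro equalityI subsetI)
    fix J assume J: "J \<in> {J \<in> indeps N. J \<subseteq> f ` A}"
    then obtain I where "I \<subseteq> A" "J = f ` I" by (auto simp: subset_image_iff)
    with J I[of I] f show "J \<in> (`) f ` {I \<in> indeps M. I \<subseteq> A}" by auto
  qed (use I f in auto)
  then have "card ` {J \<in> indeps N. J \<subseteq> f ` A} = card ` {I \<in> indeps M. I \<subseteq> A}"
    using f by (auto simp: image_image card_image inj_on_subset intro!: image_cong)
  thus ?thesis by (simp add: rank_def)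
qed

lemma rank_poly_iso:
  assumes M: "is_matroid M" and N: "is_matroid N" and iso: "matroid_iso M N"
  shows "rank_poly M = rank_poly N"
proof -
  obtain f where f: "bij_betw f (ground M) (ground N)"
    and I: "\<And>I. I \<subseteq> ground M \<Longrightarrow> I \<in> indeps M \<longleftrightarrow> f ` I \<in> indeps N"
    using iso unfolding matroid_iso_def by blast
  have inj: "inj_on f (ground M)" and im: "f ` ground M = ground N" using f by (auto simp: bij_betw_def)
  have r: "rank N (f ` A) = rank M A" if "A \<subseteq> ground M" for A
    by (rule rank_image[OF inj that is_matroid_Pow[OF M] _ I]) (simp_all add: is_matroid_Pow[OF N] im)
  have "rank_poly N = (\<Sum>A\<in>Pow (ground M). rank_term (rank N (ground N)) (rank N (f ` A)) (card (f ` A)))"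
    unfolding rank_poly_def im[symmetric] image_Pow_surj[OF refl, symmetric]
    by (subst sum.reindex[OF inj_on_image_Pow[OF inj]]) simp
  also have "\<dots> = rank_poly M"
    unfolding rank_poly_def
    using r[of "ground M"] by (intro sum.cong) (auto simp: r im card_image inj_on_subset[OF inj])
  finally show ?thesis by simp
qed

lemma rank_poly_empty: "rank_poly empty_matroid = 1"
  by (simp add: rank_poly_def empty_matroid_def rank_term_def)

lemma is_matroid_ground_empty:
  assumes "is_matroid M" "ground M = {}"
  shows "M = empty_matroid"
proof -
  have "indeps M = {{}}" using is_matroid_subset[OF assms(1)] is_matroid_empty[OF assms(1)] assms(2) by auto
  thus ?thesis using assms(2) by (simp add: empty_matroid_def)
qed

text \<open>Every element is non-degenerate, an isthmus or a loop, and the rule for its kind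
  expresses the value through minors with one element fewer.\<close>

lemma tutte_invariant_unique:
  assumes T: "tutte_invariant T" and T': "tutte_invariant T'" and M: "is_matroid M"
  shows "T M = T' M"
  using M
proof (induction "card (ground M)" arbitrary: M)
  case 0
  then have "M = empty_matroid" using is_matroid_ground_empty is_matroid_finite by fastforce
  thus ?case using T T' by (simp add: tutte_invariant_def)
next
  case (Suc n)
  then obtain e where e: "e \<in> ground M" by fastforce
  then have c: "n = card (ground M - {e})" using Suc by simp
  have IH: "T (deletion M e) = T' (deletion M e)"
    using Suc.hyps(1)[of "deletion M e"] c is_matroid_deletion[OF Suc.prems] by simp
  \<comment> \<open>Contracting a loop need not produce a matroid, so the induction hypothesis is
    available only under this condition; the loop rule does not contract.\<close>
  have IH': "T (contraction M e) = T' (contraction M e)" if "\<not> loop M e"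
    using Suc.hyps(1)[of "contraction M e"] c is_matroid_contraction[OF Suc.prems] not_loop_singleton[OF e that] by simp
  consider "nondegenerate M e" | "isthmus M e" | "loop M e" using e by (auto simp: nondegenerate_def)
  then show ?case
  proof cases
    case 1
    then show ?thesis using T T' IH IH' Suc.prems unfolding tutte_invariant_def nondegenerate_def by metis
  next
    case 2
    then show ?thesis using T T' IH' isthmus_not_loop[OF Suc.prems] Suc.prems unfolding tutte_invariant_def by metis
  next
    case 3
    then show ?thesis using T T' IH Suc.prems unfolding tutte_invariant_def by metis
  qed
qed

lemma is_matroid_empty_matroid [simp]: "is_matroid empty_matroid"
  by (simp add: is_matroid_def empty_matroid_def)

lemma tutte_eq_rank_poly:
  fixes M :: "'a matroid"
  assumes "is_matroid M"
  shows "tutte M = rank_poly M"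
proof -
  \<comment> \<open>The description of \<open>tutte\<close> admits only functions that are
    \<open>undefined\<close> off the matroids. Each recursion rule must therefore be accompanied by
    the fact that the minors in it are matroids again.\<close>
  let ?R = "restrict rank_poly {M :: 'a matroid. is_matroid M}"
  have "tutte_invariant ?R"
    unfolding tutte_invariant_def
  proof (intro conjI allI impI)
    fix M N :: "'a matroid" assume "is_matroid M \<and> is_matroid N \<and> matroid_iso M N"
    thus "?R M = ?R N" using rank_poly_iso[of M N] by simp
  next
    show "?R (empty_matroid :: 'a matroid) = 1" by (simp add: rank_poly_empty)
  next
    fix M :: "'a matroid" and e assume M: "is_matroid M"
    { assume e: "nondegenerate M e"
      then have "is_matroid (contraction M e)"
        using M by (auto intro!: is_matroid_contraction not_loop_singleton simp: nondegenerate_def)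
      thus "?R M = ?R (deletion M e) + ?R (contraction M e)"
        using M is_matroid_deletion[OF M] rank_poly_nondegenerate[OF M e] by simp }
    { assume e: "isthmus M e"
      then have "is_matroid (contraction M e)"
        using M isthmus_not_loop[OF M e]
        by (auto intro!: is_matroid_contraction not_loop_singleton simp: isthmus_def)
      thus "?R M = var_x * ?R (contraction M e)" using M rank_poly_isthmus[OF M e] by simp }
    { assume e: "loop M e"
      thus "?R M = var_y * ?R (deletion M e)" using M is_matroid_deletion[OF M] rank_poly_loop[OF M e] by simp }
  qed
  then have "(tutte :: 'a matroid \<Rightarrow> _) = ?R"
    unfolding tutte_def
  proof (intro the_equality)
    fix T :: "'a matroid \<Rightarrow> int poly poly"
    assume "T \<in> extensional {M. is_matroid M} \<and> tutte_invariant T"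
    then show "T = ?R"
      using tutte_invariant_unique[of T ?R] \<open>tutte_invariant ?R\<close> by (intro extensionalityI[of _ "{M. is_matroid M}"]) auto
  qed simp
  from fun_cong[OF this, of M] show ?thesis using assms by (simp only: restrict_apply mem_Collect_eq if_True)
qed

section \<open>Homomorphisms out of \<open>K\<^sub>0\<close>\<close>

definition frag_lift :: "('o \<Rightarrow> 'r::ring_1) \<Rightarrow> ('o \<Rightarrow>\<^sub>0 int) \<Rightarrow> 'r" where
  "frag_lift \<Phi> a = (\<Sum>i\<in>Poly_Mapping.keys a. of_int (Poly_Mapping.lookup a i) * \<Phi> i)"

text \<open>Terms may cancel in \<open>a + b\<close>, so additivity has to compare three sums over
  one common finite index set.\<close>

lemma frag_lift_superset:
  assumes "finite S" "Poly_Mapping.keys a \<subseteq> S"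
  shows "frag_lift \<Phi> a = (\<Sum>i\<in>S. of_int (Poly_Mapping.lookup a i) * \<Phi> i)"
  unfolding frag_lift_def using assms by (intro sum.mono_neutral_left) (auto simp: in_keys_iff)

lemma additive_frag_lift: "additive (frag_lift \<Phi>)"
proof
  fix a b :: "'a \<Rightarrow>\<^sub>0 int"
  let ?S = "Poly_Mapping.keys a \<union> Poly_Mapping.keys b"
  have "Poly_Mapping.keys (a + b) \<subseteq> ?S" by (rule keys_add)
  then show "frag_lift \<Phi> (a + b) = frag_lift \<Phi> a + frag_lift \<Phi> b"
    using frag_lift_superset[of ?S a \<Phi>] frag_lift_superset[of ?S b \<Phi>] frag_lift_superset[of ?S "a + b" \<Phi>]
    by (simp add: lookup_add sum.distrib distrib_right)
qed

lemma frag_lift_of [simp]: "frag_lift \<Phi> (frag_of A) = \<Phi> A"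
  by (simp add: frag_lift_def)

lemma additive_sum_mset:
  assumes "additive h"
  shows "h (\<Sum>x\<in>#F. f x) = (\<Sum>x\<in>#F. h (f x))"
  by (induction F) (simp_all add: additive.zero[OF assms] additive.add[OF assms])

text \<open>The exit from the definite descriptions behind \<rho>, \<gamma> and the factors of \<T>.
  Uniqueness is asked only on the carrier; extensionality takes care of the rest.\<close>

lemma the_map_with_eqI:
  assumes "h \<in> H" "h \<in> extensional (carrier G)" "\<And>s. s \<in> S \<Longrightarrow> h (c s) = \<phi> s"
    and "\<And>h' x. h' \<in> H \<Longrightarrow> (\<And>s. s \<in> S \<Longrightarrow> h' (c s) = \<phi> s) \<Longrightarrow> x \<in> carrier G \<Longrightarrow> h' x = h x"
  shows "the_map_with H G S c \<phi> = h"
  unfolding the_map_with_def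
proof (rule the_equality)
  show "h \<in> H \<and> h \<in> extensional (carrier G) \<and> (\<forall>s\<in>S. h (c s) = \<phi> s)" using assms by blast
next
  fix h' assume *: "h' \<in> H \<and> h' \<in> extensional (carrier G) \<and> (\<forall>s\<in>S. h' (c s) = \<phi> s)"
  show "h' = h"
  proof (rule extensionalityI[of _ "carrier G"])
    fix x assume "x \<in> carrier G"
    with * show "h' x = h x" by (intro assms(4)) auto
  qed (use * assms(2) in auto)
qed

lemma frag_keys_induct [consumes 1, case_names zero diff of]:
  assumes "Poly_Mapping.keys x \<subseteq> S" "P 0"
    and "\<And>x y. Poly_Mapping.keys x \<subseteq> S \<Longrightarrow> Poly_Mapping.keys y \<subseteq> S \<Longrightarrow> P x \<Longrightarrow> P y \<Longrightarrow> P (x - y)"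
    and "\<And>a. a \<in> S \<Longrightarrow> P (frag_of a)"
  shows "P x"
  by (rule free_Abelian_group_induct[OF assms])

lemma keys_diff_subset:
  "Poly_Mapping.keys a \<subseteq> S \<Longrightarrow> Poly_Mapping.keys b \<subseteq> S \<Longrightarrow> Poly_Mapping.keys (a - b :: 'b \<Rightarrow>\<^sub>0 int) \<subseteq> S"
  using keys_diff[of a b] by blast

lemma keys_add_subset:
  "Poly_Mapping.keys a \<subseteq> S \<Longrightarrow> Poly_Mapping.keys b \<subseteq> S \<Longrightarrow> Poly_Mapping.keys (a + b :: 'b \<Rightarrow>\<^sub>0 int) \<subseteq> S"
  using keys_add[of a b] by blast

text \<open>The assumption places all relations inside the free group on the objects, so that they
  generate a subgroup and \<open>K0\<close> is an honest quotient.\<close>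

locale K0_presentation =
  fixes C :: "('o, 'a, 'm) covcat_scheme"
  assumes relations_keys: "r \<in> K0_relations C \<Longrightarrow> Poly_Mapping.keys r \<subseteq> obs C"
begin

abbreviation F where "F \<equiv> free_Abelian_group (obs C)"

definition H where "H = generate F (K0_relations C)"

text \<open>The quotient map on all formal combinations; \<open>K0_class\<close> is its value on a
  single generator.\<close>

definition cls :: "('o \<Rightarrow>\<^sub>0 int) \<Rightarrow> ('o \<Rightarrow>\<^sub>0 int) set" where
  "cls a = H #>\<^bsub>F\<^esub> a"

lemma subgroup_H: "subgroup H F"
  unfolding H_def by (rule group.generate_is_subgroup) (use relations_keys in auto)

lemma H_keys: "a \<in> H \<Longrightarrow> Poly_Mapping.keys a \<subseteq> obs C"
  using subgroup.mem_carrier[OF subgroup_H] by simp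

lemma H_zero: "0 \<in> H"
  using subgroup.one_closed[OF subgroup_H] by simp

lemma H_add: "a \<in> H \<Longrightarrow> b \<in> H \<Longrightarrow> a + b \<in> H"
  using subgroup.m_closed[OF subgroup_H, of a b] by simp

lemma H_minus: "a \<in> H \<Longrightarrow> - a \<in> H"
  using subgroup.m_inv_closed[OF subgroup_H, of a] H_keys[of a] by simp

lemma H_diff: "a \<in> H \<Longrightarrow> b \<in> H \<Longrightarrow> a - b \<in> H"
  using H_add[of a "- b"] H_minus by simp

lemma H_relation: "r \<in> K0_relations C \<Longrightarrow> r \<in> H"
  unfolding H_def by (rule generate.incl)

lemma H_covering:
  "(A, G) \<in> coverings C \<Longrightarrow> frag_of A - (\<Sum>f\<in>#G. frag_of (src C f)) \<in> H"
  by (rule H_relation) (auto simp: K0_relations_def)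

lemma additive_vanishes_on_H:
  assumes h: "additive h" and r: "\<And>r. r \<in> K0_relations C \<Longrightarrow> h r = 0" and a: "a \<in> H"
  shows "h a = 0"
  using a[unfolded H_def]
proof (induction rule: generate.induct)
  case (inv x)
  then show ?case using r[of x] relations_keys[of x] by (simp add: additive.minus[OF h])
qed (simp_all add: r additive.zero[OF h] additive.add[OF h])

lemma K0_eq: "K0 C = F Mod H"
  by (simp add: K0_def H_def)

lemma K0_class_eq: "K0_class C A = cls (frag_of A)"
  by (simp add: K0_class_def cls_def H_def)

lemma comm_group_K0: "comm_group (K0 C)"
  unfolding K0_eq by (rule comm_group.abelian_FactGroup[OF abelian_free_Abelian_group subgroup_H])

lemma group_K0: "group (K0 C)"
  using comm_group_K0 by (rule comm_group.axioms)

lemma carrier_K0: "carrier (K0 C) = cls ` {a. Poly_Mapping.keys a \<subseteq> obs C}"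
  unfolding K0_eq carrier_FactGroup by (auto simp: cls_def)

lemma cls_in_K0: "Poly_Mapping.keys a \<subseteq> obs C \<Longrightarrow> cls a \<in> carrier (K0 C)"
  by (auto simp: carrier_K0)

lemma K0_E:
  assumes "U \<in> carrier (K0 C)"
  shows "\<exists>a. Poly_Mapping.keys a \<subseteq> obs C \<and> U = cls a"
  using assms unfolding carrier_K0 by blast

lemma K0_class_in_K0: "A \<in> obs C \<Longrightarrow> K0_class C A \<in> carrier (K0 C)"
  unfolding K0_class_eq by (rule cls_in_K0) simp

lemma cls_add:
  assumes "Poly_Mapping.keys a \<subseteq> obs C" "Poly_Mapping.keys b \<subseteq> obs C"
  shows "cls a \<otimes>\<^bsub>K0 C\<^esub> cls b = cls (a + b)"
proof -
  have "normal H F" by (rule comm_group.subgroup_imp_normal[OF abelian_free_Abelian_group subgroup_H])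
  from normal.rcos_sum[OF this, of a b] show ?thesis
    using assms by (simp add: K0_eq cls_def)
qed

lemma cls_zero: "cls 0 = \<one>\<^bsub>K0 C\<^esub>"
  using group.coset_mult_one[OF group_free_Abelian_group subgroup.subset[OF subgroup_H]]
  by (simp add: cls_def K0_eq)

lemma cls_eq_iff:
  assumes "Poly_Mapping.keys a \<subseteq> obs C" "Poly_Mapping.keys b \<subseteq> obs C"
  shows "cls a = cls b \<longleftrightarrow> a - b \<in> H"
proof -
  have "a \<in> cls b \<longleftrightarrow> a - b \<in> H"
    unfolding cls_def using subgroup.rcos_module[OF subgroup_H group_free_Abelian_group, of b a] assms by simp
  moreover have "a \<in> cls b \<longleftrightarrow> cls a = cls b"
    unfolding cls_def
    using group.repr_independence[OF group_free_Abelian_group _ _ subgroup_H, of a b] assms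
      group.rcos_self[OF group_free_Abelian_group _ subgroup_H, of a] by auto
  ultimately show ?thesis by simp
qed

text \<open>The classes of objects generate the quotient. This is the uniqueness argument behind the
  maps out of \<open>K0\<close> as well as behind the product.\<close>

lemma hom_eq_on_K0:
  assumes f: "f \<in> hom (K0 C) G" and g: "g \<in> hom (K0 C) G" and G: "group G"
    and eq: "\<And>A. A \<in> obs C \<Longrightarrow> f (K0_class C A) = g (K0_class C A)"
    and U: "U \<in> carrier (K0 C)"
  shows "f U = g U"
proof -
  interpret f: group_hom "K0 C" G f using f G group_K0 by (simp add: group_hom_def group_hom_axioms_def)
  interpret g: group_hom "K0 C" G g using g G group_K0 by (simp add: group_hom_def group_hom_axioms_def)
  have "f (cls a) = g (cls a)" if "Poly_Mapping.keys a \<subseteq> obs C" for a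
    using that
  proof (induction rule: frag_keys_induct)
    case zero
    then show ?case by (simp add: cls_zero)
  next
    case (diff x y)
    \<comment> \<open>The induction proceeds by differences, whereas homomorphisms are given through
      products: writing \<open>x\<close> as \<open>(x - y) + y\<close>, the factor at
      \<open>y\<close> cancels in \<open>G\<close>.\<close>
    have "cls (x - y) \<otimes>\<^bsub>K0 C\<^esub> cls y = cls x"
      using diff cls_add[of "x - y" y] by (simp add: keys_diff_subset)
    with diff show ?case
      using f.hom_mult[of "cls (x - y)" "cls y"] g.hom_mult[of "cls (x - y)" "cls y"]
        f.hom_closed[of "cls (x - y)"] g.hom_closed[of "cls (x - y)"] g.hom_closed[of "cls y"]
      by (simp add: cls_in_K0 keys_diff_subset)
  next
    case (of a)
    then show ?case using eq[of a] by (simp add: K0_class_eq)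
  qed
  thus ?thesis using U by (metis K0_E)
qed

text \<open>The induced map on the quotient, evaluated at a chosen representative. It is meaningful
  once \<open>h\<close> respects the relations; the restriction makes it extensional, as
  \<open>the_map_with\<close> demands.\<close>

definition lift :: "(('o \<Rightarrow>\<^sub>0 int) \<Rightarrow> 'b) \<Rightarrow> ('o \<Rightarrow>\<^sub>0 int) set \<Rightarrow> 'b" where
  "lift h = restrict (\<lambda>U. h (SOME a. Poly_Mapping.keys a \<subseteq> obs C \<and> cls a = U)) (carrier (K0 C))"

text \<open>Stated for an arbitrary target, because for \<gamma> the values are cosets, whose group
  law is not the \<open>+\<close> of a type class.\<close>

lemma lift_cls_respects:
  assumes h: "\<And>a b. Poly_Mapping.keys a \<subseteq> obs C \<Longrightarrow> Poly_Mapping.keys b \<subseteq> obs C \<Longrightarrow> a - b \<in> H \<Longrightarrow> h a = h b"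
    and a: "Poly_Mapping.keys a \<subseteq> obs C"
  shows "lift h (cls a) = h a"
proof -
  let ?b = "SOME b. Poly_Mapping.keys b \<subseteq> obs C \<and> cls b = cls a"
  have b: "Poly_Mapping.keys ?b \<subseteq> obs C \<and> cls ?b = cls a" by (rule someI) (use a in simp)
  then have "?b - a \<in> H" using a cls_eq_iff by blast
  with b a have "h ?b = h a" by (intro h) auto
  thus ?thesis using a by (simp add: lift_def cls_in_K0)
qed

lemma lift_cls:
  assumes h: "additive h" and r: "\<And>r. r \<in> K0_relations C \<Longrightarrow> h r = 0"
    and a: "Poly_Mapping.keys a \<subseteq> obs C"
  shows "lift h (cls a) = h a"
proof (rule lift_cls_respects[OF _ a])
  fix a b assume "a - b \<in> H"
  from additive_vanishes_on_H[OF h r this] show "h a = h b" by (simp add: additive.diff[OF h])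
qed

lemma lift_add:
  assumes h: "additive h" "\<And>r. r \<in> K0_relations C \<Longrightarrow> h r = 0"
    and U: "U \<in> carrier (K0 C)" "Y \<in> carrier (K0 C)"
  shows "lift h (U \<otimes>\<^bsub>K0 C\<^esub> Y) = lift h U + lift h Y"
proof -
  obtain a b where "Poly_Mapping.keys a \<subseteq> obs C" "U = cls a" "Poly_Mapping.keys b \<subseteq> obs C" "Y = cls b"
    using U by (metis K0_E)
  then show ?thesis by (simp add: cls_add lift_cls[OF h] keys_add_subset additive.add[OF h(1)])
qed

lemma lift_K0_class:
  assumes h: "additive h" "\<And>r. r \<in> K0_relations C \<Longrightarrow> h r = 0" and "A \<in> obs C"
  shows "lift h (K0_class C A) = h (frag_of A)"
  unfolding K0_class_eq using assms(3) by (intro lift_cls[OF h]) (simp_all add: keys_frag_of)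

lemma lift_extensional: "lift h \<in> extensional (carrier (K0 C))"
  by (simp add: lift_def)

text \<open>With one argument fixed, a biadditive operation is a homomorphism, hence determined by
  its values on generators. Applied to one argument and then the other, this leaves only the
  prescribed values on pairs of objects.\<close>

lemma K0_product_unique:
  assumes p: "K0_product C s p" and q: "K0_product C s q"
  shows "p = q"
proof -
  have pE: "p \<in> carrier (K0 C) \<rightarrow>\<^sub>E carrier (K0 C) \<rightarrow>\<^sub>E carrier (K0 C)"
    and qE: "q \<in> carrier (K0 C) \<rightarrow>\<^sub>E carrier (K0 C) \<rightarrow>\<^sub>E carrier (K0 C)"
    using p q by (simp_all add: K0_product_def)
  have left: "(\<lambda>U. t U Y) \<in> hom (K0 C) (K0 C)" and right: "t Y \<in> hom (K0 C) (K0 C)"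
    if "K0_product C s t" "Y \<in> carrier (K0 C)" for t Y
    using that unfolding K0_product_def hom_def by (auto dest: PiE_mem)
  have "p (K0_class C A) Y = q (K0_class C A) Y" if "A \<in> obs C" "Y \<in> carrier (K0 C)" for A Y
  proof (rule hom_eq_on_K0[OF _ _ group_K0 _ that(2)])
    show "p (K0_class C A) \<in> hom (K0 C) (K0 C)" "q (K0_class C A) \<in> hom (K0 C) (K0 C)"
      using right p q K0_class_in_K0[OF that(1)] by blast+
  qed (use p q that in \<open>simp add: K0_product_def\<close>)
  then have pq: "p U Y = q U Y" if "U \<in> carrier (K0 C)" "Y \<in> carrier (K0 C)" for U Y
    using that(2) by (intro hom_eq_on_K0[OF left[OF p] left[OF q] group_K0 _ that(1)]) auto
  show ?thesis
  proof (rule PiE_ext[OF pE qE])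
    fix U assume U: "U \<in> carrier (K0 C)"
    show "p U = q U"
      by (rule PiE_ext[OF PiE_mem[OF pE U] PiE_mem[OF qE U]]) (rule pq[OF U])
  qed
qed

text \<open>Both sides are biadditive and agree on pairs of objects, so they agree by the same
  two-stage argument as uniqueness of the product.\<close>

lemma lift_mult:
  fixes h :: "('o \<Rightarrow>\<^sub>0 int) \<Rightarrow> 'r::comm_ring_1"
  assumes h: "additive h" "\<And>r. r \<in> K0_relations C \<Longrightarrow> h r = 0"
    and p: "K0_product C s p" and s: "\<And>A B. A \<in> obs C \<Longrightarrow> B \<in> obs C \<Longrightarrow> s A B \<in> obs C"
    and hs: "\<And>A B. A \<in> obs C \<Longrightarrow> B \<in> obs C \<Longrightarrow> h (frag_of (s A B)) = h (frag_of A) * h (frag_of B)"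
    and U: "U \<in> carrier (K0 C)" and Y: "Y \<in> carrier (K0 C)"
  shows "lift h (p U Y) = lift h U * lift h Y"
proof -
  \<comment> \<open>The additive group of the coefficient type, packaged as a record so that
    agreement of homomorphisms on generators applies to it.\<close>
  let ?Z = "add_monoid (cring_class_ops :: 'r ring)"
  have Z: "group ?Z"
    using abelian_group.a_group[OF ring.is_abelian_group] cring.axioms(1)[OF cring_class] by blast
  have pC: "p U Y \<in> carrier (K0 C)" if "U \<in> carrier (K0 C)" "Y \<in> carrier (K0 C)" for U Y
    using p that unfolding K0_product_def by (meson PiE_mem)
  have pl: "p (U \<otimes>\<^bsub>K0 C\<^esub> U') Y = p U Y \<otimes>\<^bsub>K0 C\<^esub> p U' Y"
    and pr: "p Y (U \<otimes>\<^bsub>K0 C\<^esub> U') = p Y U \<otimes>\<^bsub>K0 C\<^esub> p Y U'"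
    if "U \<in> carrier (K0 C)" "U' \<in> carrier (K0 C)" "Y \<in> carrier (K0 C)" for U U' Y
    using p that unfolding K0_product_def by blast+
  note simps = cring_class_ops_def hom_def pC pl pr lift_add[OF h] algebra_simps
  have 1: "lift h (p (K0_class C A) Y) = lift h (K0_class C A) * lift h Y"
    if A: "A \<in> obs C" and Y: "Y \<in> carrier (K0 C)" for A Y
  proof -
    note K0_class_in_K0[OF A]
    then show ?thesis
    proof (intro hom_eq_on_K0[of "\<lambda>Y. lift h (p (K0_class C A) Y)" ?Z "\<lambda>Y. lift h (K0_class C A) * lift h Y", OF _ _ Z _ Y])
      fix B assume B: "B \<in> obs C"
      show "lift h (p (K0_class C A) (K0_class C B)) = lift h (K0_class C A) * lift h (K0_class C B)"
        using p A B s hs by (simp add: K0_product_def lift_K0_class[OF h])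
    qed (simp_all add: simps)
  qed
  from Y show ?thesis
    by (intro hom_eq_on_K0[of "\<lambda>U. lift h (p U Y)" ?Z "\<lambda>U. lift h U * lift h Y", OF _ _ Z _ U])
      (simp_all add: simps 1)
qed

end

section \<open>Ring structures on \<open>K\<^sub>0\<close>\<close>

text \<open>If \<open>K\<^sub>0\<close> embeds in a commutative ring so that the operation on objects becomes multiplication,
  then the image is a subring, and its structure can be pulled back.\<close>

locale K0_embedding = K0_presentation C
  for C :: "('o, 'a, 'm) covcat_scheme" +
  fixes h :: "('o \<Rightarrow>\<^sub>0 int) \<Rightarrow> 'r::comm_ring_1" and s :: "'o \<Rightarrow> 'o \<Rightarrow> 'o" and u :: 'o
  assumes additive_h: "additive h"
    and h_relation: "r \<in> K0_relations C \<Longrightarrow> h r = 0"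
    and h_kernel: "Poly_Mapping.keys a \<subseteq> obs C \<Longrightarrow> h a = 0 \<Longrightarrow> a \<in> generate (free_Abelian_group (obs C)) (K0_relations C)"
    and s_closed: "A \<in> obs C \<Longrightarrow> B \<in> obs C \<Longrightarrow> s A B \<in> obs C"
    and u_closed: "u \<in> obs C"
    and h_mult: "A \<in> obs C \<Longrightarrow> B \<in> obs C \<Longrightarrow> h (frag_of (s A B)) = h (frag_of A) * h (frag_of B)"
    and h_one: "h (frag_of u) = 1"
begin

abbreviation \<Theta> where "\<Theta> \<equiv> lift h"

lemmas \<Theta>_cls = lift_cls[OF additive_h h_relation]
lemmas \<Theta>_add = lift_add[OF additive_h h_relation]
lemmas \<Theta>_class = lift_K0_class[OF additive_h h_relation]

text \<open>The kernel of \<open>h\<close> on formal combinations is exactly the subgroup that is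
  divided out.\<close>

lemma \<Theta>_inj:
  assumes "U \<in> carrier (K0 C)" "Y \<in> carrier (K0 C)" "\<Theta> U = \<Theta> Y"
  shows "U = Y"
proof -
  obtain a b where *: "Poly_Mapping.keys a \<subseteq> obs C" "U = cls a" "Poly_Mapping.keys b \<subseteq> obs C" "Y = cls b"
    using assms by (metis K0_E)
  then have "h (a - b) = 0" using assms(3) by (simp add: \<Theta>_cls additive.diff[OF additive_h])
  then have "a - b \<in> H" using * unfolding H_def by (intro h_kernel keys_diff_subset)
  with * show ?thesis by (simp add: cls_eq_iff)
qed

text \<open>The image is spanned by the values at objects, and these are closed under multiplication
  through \<open>s\<close>; distributivity in each factor, one induction per factor, does the
  rest.\<close>

lemma h_image_mult:
  assumes a: "Poly_Mapping.keys a \<subseteq> obs C" and b: "Poly_Mapping.keys b \<subseteq> obs C"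
  shows "\<exists>c. Poly_Mapping.keys c \<subseteq> obs C \<and> h c = h a * h b"
  using a
proof (induction rule: frag_keys_induct)
  case zero
  show ?case by (rule exI[of _ 0]) (simp add: additive.zero[OF additive_h])
next
  case (diff x y)
  then obtain c d where "Poly_Mapping.keys c \<subseteq> obs C" "h c = h x * h b" "Poly_Mapping.keys d \<subseteq> obs C" "h d = h y * h b"
    by blast
  then show ?case
    by (intro exI[of _ "c - d"]) (simp add: keys_diff_subset additive.diff[OF additive_h] algebra_simps)
next
  case (of A)
  from b show ?case
  proof (induction rule: frag_keys_induct)
    case zero
    show ?case by (rule exI[of _ 0]) (simp add: additive.zero[OF additive_h])
  next
    case (diff x y)
    then obtain c d where "Poly_Mapping.keys c \<subseteq> obs C" "h c = h (frag_of A) * h x"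
      "Poly_Mapping.keys d \<subseteq> obs C" "h d = h (frag_of A) * h y"
      by blast
    then show ?case
      by (intro exI[of _ "c - d"]) (simp add: keys_diff_subset additive.diff[OF additive_h] algebra_simps)
  next
    case (of B)
    with \<open>A \<in> obs C\<close> show ?case by (intro exI[of _ "frag_of (s A B)"]) (simp add: s_closed h_mult)
  qed
qed

text \<open>Multiplication of the ring pulled back along \<open>\<Theta>\<close>: a preimage exists
  because the image is closed under products, and it is unique by injectivity. Both arguments are
  restricted to fit the extensional function space in \<open>K0_product\<close>.\<close>

definition prod :: "('o \<Rightarrow>\<^sub>0 int) set \<Rightarrow> ('o \<Rightarrow>\<^sub>0 int) set \<Rightarrow> ('o \<Rightarrow>\<^sub>0 int) set" where
  "prod = (\<lambda>U\<in>carrier (K0 C). \<lambda>Y\<in>carrier (K0 C). SOME Z. Z \<in> carrier (K0 C) \<and> \<Theta> Z = \<Theta> U * \<Theta> Y)"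

lemma prod:
  assumes "U \<in> carrier (K0 C)" "Y \<in> carrier (K0 C)"
  shows prod_closed: "prod U Y \<in> carrier (K0 C)" and \<Theta>_prod: "\<Theta> (prod U Y) = \<Theta> U * \<Theta> Y"
proof -
  obtain a b where ab: "Poly_Mapping.keys a \<subseteq> obs C" "U = cls a" "Poly_Mapping.keys b \<subseteq> obs C" "Y = cls b"
    using assms by (metis K0_E)
  obtain c where "Poly_Mapping.keys c \<subseteq> obs C" "h c = h a * h b" using h_image_mult[OF ab(1,3)] by blast
  then have "cls c \<in> carrier (K0 C) \<and> \<Theta> (cls c) = \<Theta> U * \<Theta> Y" using ab by (simp add: \<Theta>_cls cls_in_K0)
  from someI[of "\<lambda>Z. Z \<in> carrier (K0 C) \<and> \<Theta> Z = \<Theta> U * \<Theta> Y", OF this]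
  show "prod U Y \<in> carrier (K0 C)" "\<Theta> (prod U Y) = \<Theta> U * \<Theta> Y"
    using assms by (simp_all add: prod_def)
qed

lemma K0_closed: "U \<in> carrier (K0 C) \<Longrightarrow> Y \<in> carrier (K0 C) \<Longrightarrow> U \<otimes>\<^bsub>K0 C\<^esub> Y \<in> carrier (K0 C)"
  by (rule monoid.m_closed[OF group.is_monoid[OF group_K0]])

text \<open>After applying the injective \<open>\<Theta>\<close>, biadditivity becomes
  distributivity in the ring, and the prescribed values become the multiplicativity of
  \<open>h\<close> on objects.\<close>

lemma K0_product_prod: "K0_product C s prod"
  unfolding K0_product_def
proof (intro conjI ballI)
  show "prod \<in> carrier (K0 C) \<rightarrow>\<^sub>E carrier (K0 C) \<rightarrow>\<^sub>E carrier (K0 C)"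
  proof (rule PiE_I)
    fix U assume U: "U \<in> carrier (K0 C)"
    show "prod U \<in> carrier (K0 C) \<rightarrow>\<^sub>E carrier (K0 C)"
      by (rule PiE_I) (use U in \<open>simp_all add: prod_closed, simp add: prod_def\<close>)
  qed (simp add: prod_def)
next
  fix a b c assume abc: "a \<in> carrier (K0 C)" "b \<in> carrier (K0 C)" "c \<in> carrier (K0 C)"
  show "prod (a \<otimes>\<^bsub>K0 C\<^esub> b) c = prod a c \<otimes>\<^bsub>K0 C\<^esub> prod b c"
    "prod c (a \<otimes>\<^bsub>K0 C\<^esub> b) = prod c a \<otimes>\<^bsub>K0 C\<^esub> prod c b"
    using abc by (intro \<Theta>_inj; simp add: K0_closed prod_closed \<Theta>_prod \<Theta>_add algebra_simps)+
next
  fix A B assume AB: "A \<in> obs C" "B \<in> obs C"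
  show "prod (K0_class C A) (K0_class C B) = K0_class C (s A B)"
    using AB by (intro \<Theta>_inj)
      (simp_all add: K0_class_in_K0 prod_closed s_closed \<Theta>_prod \<Theta>_class h_mult)
qed

lemma ex1_K0_product: "\<exists>!p. K0_product C s p"
  using K0_product_prod K0_product_unique by blast

lemma the_K0_product: "(THE p. K0_product C s p) = prod"
  using K0_product_prod K0_product_unique by blast

text \<open>Well-definedness on generators costs nothing once a product exists: both sides are its
  value at the same pair of classes.\<close>

lemma K0_class_mult_cong:
  assumes "M \<in> obs C" "M' \<in> obs C" "N \<in> obs C" "N' \<in> obs C"
    and "K0_class C M = K0_class C M'" "K0_class C N = K0_class C N'"
  shows "K0_class C (s M N) = K0_class C (s M' N')"
  using K0_product_prod assms unfolding K0_product_def by metis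

lemma K0_ring_simps:
  "carrier (K0_ring C s u) = carrier (K0 C)" "U \<otimes>\<^bsub>K0_ring C s u\<^esub> Y = prod U Y"
  "\<one>\<^bsub>K0_ring C s u\<^esub> = K0_class C u" "\<zero>\<^bsub>K0_ring C s u\<^esub> = \<one>\<^bsub>K0 C\<^esub>"
  "U \<oplus>\<^bsub>K0_ring C s u\<^esub> Y = U \<otimes>\<^bsub>K0 C\<^esub> Y"
  by (simp_all add: K0_ring_def the_K0_product)

lemma cring_K0_ring: "cring (K0_ring C s u)"
proof (rule cringI)
  interpret K: comm_group "K0 C" by (rule comm_group_K0)
  show "abelian_group (K0_ring C s u)"
    by (rule abelian_groupI)
      (simp_all add: K0_ring_simps K.m_ac K.l_inv_ex)
  show "comm_monoid (K0_ring C s u)"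
  proof (rule comm_monoidI; unfold K0_ring_simps)
    show "K0_class C u \<in> carrier (K0 C)" by (simp add: K0_class_in_K0 u_closed)
    show "prod (K0_class C u) U = U" if "U \<in> carrier (K0 C)" for U
      using that by (intro \<Theta>_inj)
        (simp_all add: K0_class_in_K0 u_closed prod_closed \<Theta>_prod \<Theta>_class h_one)
    show "prod U V = prod V U" if "U \<in> carrier (K0 C)" "V \<in> carrier (K0 C)" for U V
      using that by (intro \<Theta>_inj) (simp_all add: prod_closed \<Theta>_prod mult_ac)
    show "prod (prod U V) W = prod U (prod V W)"
      if "U \<in> carrier (K0 C)" "V \<in> carrier (K0 C)" "W \<in> carrier (K0 C)" for U V W
      using that by (intro \<Theta>_inj) (simp_all add: prod_closed \<Theta>_prod mult_ac)
  qed (rule prod_closed)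
  show "(U \<oplus>\<^bsub>K0_ring C s u\<^esub> Y) \<otimes>\<^bsub>K0_ring C s u\<^esub> Z =
      U \<otimes>\<^bsub>K0_ring C s u\<^esub> Z \<oplus>\<^bsub>K0_ring C s u\<^esub> Y \<otimes>\<^bsub>K0_ring C s u\<^esub> Z"
    if "U \<in> carrier (K0_ring C s u)" "Y \<in> carrier (K0_ring C s u)" "Z \<in> carrier (K0_ring C s u)" for U Y Z
    using that K0_product_prod unfolding K0_ring_simps K0_product_def by blast
qed

text \<open>Here \<open>g\<close> may differ from the embedding \<open>h\<close> that defines the
  ring; the Tutte map on \<open>K0 Mat_iso\<close> is such a case, being far from injective
  there.\<close>

lemma lift_ring_hom:
  fixes g :: "('o \<Rightarrow>\<^sub>0 int) \<Rightarrow> 'q::comm_ring_1"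
  assumes g: "additive g" "\<And>r. r \<in> K0_relations C \<Longrightarrow> g r = 0"
    and gs: "\<And>A B. A \<in> obs C \<Longrightarrow> B \<in> obs C \<Longrightarrow> g (frag_of (s A B)) = g (frag_of A) * g (frag_of B)"
    and gu: "g (frag_of u) = 1"
  shows "lift g \<in> ring_hom (K0_ring C s u) cring_class_ops"
  by (rule ring_hom_memI)
    (simp_all add: K0_ring_simps cring_class_ops_def lift_mult[OF g K0_product_prod s_closed gs]
      lift_add[OF g] lift_K0_class[OF g] u_closed gu)

end

no_notation set_add (infixl "<+>\<index>" 60) \<comment> \<open>clashes with disjoint sums of sets\<close>

section \<open>Isomorphisms and direct sums\<close>

lemma matroid_isoI:
  assumes "bij_betw f (ground M) (ground N)"
    and "\<And>I. I \<subseteq> ground M \<Longrightarrow> I \<in> indeps M \<longleftrightarrow> f ` I \<in> indeps N"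
  shows "matroid_iso M N"
  using assms unfolding matroid_iso_def by blast

lemma matroid_iso_refl: "matroid_iso M M"
  by (rule matroid_isoI[of id]) auto

lemma matroid_iso_sym:
  assumes "matroid_iso M N"
  shows "matroid_iso N M"
proof -
  obtain f where f: "bij_betw f (ground M) (ground N)"
    and I: "\<And>I. I \<subseteq> ground M \<Longrightarrow> I \<in> indeps M \<longleftrightarrow> f ` I \<in> indeps N"
    using assms unfolding matroid_iso_def by blast
  let ?g = "inv_into (ground M) f"
  show ?thesis
  proof (rule matroid_isoI[of ?g])
    show g: "bij_betw ?g (ground N) (ground M)" using f by (rule bij_betw_inv_into)
    fix J assume J: "J \<subseteq> ground N"
    then have "f ` ?g ` J = J" using f by (simp add: image_inv_into_cancel bij_betw_def)
    moreover have "?g ` J \<subseteq> ground M" using J g by (auto simp: bij_betw_def)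
    ultimately show "J \<in> indeps N \<longleftrightarrow> ?g ` J \<in> indeps M" using I[of "?g ` J"] by simp
  qed
qed

lemma matroid_iso_trans:
  assumes "matroid_iso M N" "matroid_iso N P"
  shows "matroid_iso M P"
proof -
  obtain f where f: "bij_betw f (ground M) (ground N)"
    and fI: "\<And>I. I \<subseteq> ground M \<Longrightarrow> I \<in> indeps M \<longleftrightarrow> f ` I \<in> indeps N"
    using assms(1) unfolding matroid_iso_def by blast
  obtain g where g: "bij_betw g (ground N) (ground P)"
    and gI: "\<And>I. I \<subseteq> ground N \<Longrightarrow> I \<in> indeps N \<longleftrightarrow> g ` I \<in> indeps P"
    using assms(2) unfolding matroid_iso_def by blast
  show ?thesis
  proof (rule matroid_isoI[of "g \<circ> f"])
    show "bij_betw (g \<circ> f) (ground M) (ground P)" using f g by (rule bij_betw_trans)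
    fix I assume I: "I \<subseteq> ground M"
    then have "f ` I \<subseteq> ground N" using f by (auto simp: bij_betw_def)
    with I show "I \<in> indeps M \<longleftrightarrow> (g \<circ> f) ` I \<in> indeps P" using fI gI by (simp add: image_comp)
  qed
qed

lemma relabel_iso:
  assumes f: "inj_on f (ground M)" and M: "indeps M \<subseteq> Pow (ground M)"
  shows "matroid_iso M (relabel f M)"
proof (rule matroid_isoI[of f])
  show "bij_betw f (ground M) (ground (relabel f M))" using f by (simp add: bij_betw_def relabel_def)
  fix I assume "I \<subseteq> ground M"
  then show "I \<in> indeps M \<longleftrightarrow> f ` I \<in> indeps (relabel f M)"
    using inj_on_image_eq_iff[OF f, of I] M by (auto simp: relabel_def)
qed

lemma is_matroid_relabel:
  assumes M: "is_matroid M" and f: "inj_on f (ground M)"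
  shows "is_matroid (relabel f M)"
  unfolding is_matroid_def
proof (intro conjI allI impI)
  show "finite (ground (relabel f M))" using is_matroid_finite[OF M] by (simp add: relabel_def)
  show "indeps (relabel f M) \<subseteq> Pow (ground (relabel f M))"
    using is_matroid_Pow[OF M] by (auto simp: relabel_def)
  show "{} \<in> indeps (relabel f M)" using is_matroid_empty[OF M] by (auto simp: relabel_def)
next
  fix I J assume *: "I \<in> indeps (relabel f M) \<and> J \<subseteq> I"
  then obtain K where K: "K \<in> indeps M" "I = f ` K" by (auto simp: relabel_def)
  with * obtain L where "L \<subseteq> K" "J = f ` L" by (auto simp: subset_image_iff)
  with K is_matroid_down[OF M, of K L] show "J \<in> indeps (relabel f M)" by (auto simp: relabel_def)
next
  fix I J assume *: "I \<in> indeps (relabel f M) \<and> J \<in> indeps (relabel f M) \<and> card J < card I"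
  then obtain K L where KL: "K \<in> indeps M" "I = f ` K" "L \<in> indeps M" "J = f ` L" by (auto simp: relabel_def)
  then have sub: "K \<subseteq> ground M" "L \<subseteq> ground M" using is_matroid_subset[OF M] by blast+
  then have "card L < card K"
    using * KL by (simp add: card_image[OF inj_on_subset[OF f]])
  then obtain x where x: "x \<in> K - L" "insert x L \<in> indeps M" using is_matroid_augment[OF M KL(1,3)] by blast
  have "f x \<in> I - J" using x KL sub f by (auto simp: inj_on_def)
  moreover have "J \<union> {f x} \<in> indeps (relabel f M)"
    using x KL by (auto simp: relabel_def intro!: image_eqI[of _ _ "insert x L"])
  ultimately show "\<exists>y\<in>I - J. J \<union> {y} \<in> indeps (relabel f M)" by blast
qed

section \<open>Direct sums of matroids\<close>

lemma Plus_vimage: "(Inl -` S) <+> (Inr -` S) = S"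
  by (auto elim: sumE) (metis sumE InlI InrI vimageI2)

lemma vimage_Plus [simp]: "Inl -` (A <+> B) = A" "Inr -` (A <+> B) = B"
  by auto

lemma ground_direct_sum [simp]: "ground (direct_sum M N) = ground M <+> ground N"
  by (simp add: direct_sum_def)

text \<open>Preimages under the two injections replace the existential pair of independent sets, so
  later arguments can treat the two components separately.\<close>

lemma indeps_direct_sum:
  "S \<in> indeps (direct_sum M N) \<longleftrightarrow> Inl -` S \<in> indeps M \<and> Inr -` S \<in> indeps N"
proof
  assume "Inl -` S \<in> indeps M \<and> Inr -` S \<in> indeps N"
  then show "S \<in> indeps (direct_sum M N)"
    unfolding direct_sum_def
    by (auto intro!: exI[of _ "Inl -` S"] exI[of _ "Inr -` S"] simp only: Plus_vimage matroid.simps mem_Collect_eq)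
next
  assume "S \<in> indeps (direct_sum M N)"
  then obtain I J where "S = I <+> J" "I \<in> indeps M" "J \<in> indeps N" by (auto simp: direct_sum_def)
  then show "Inl -` S \<in> indeps M \<and> Inr -` S \<in> indeps N" by (simp only: vimage_Plus)
qed

lemma Plus_in_indeps_direct_sum [simp]:
  "A <+> B \<in> indeps (direct_sum M N) \<longleftrightarrow> A \<in> indeps M \<and> B \<in> indeps N"
  by (simp add: indeps_direct_sum)

lemma finite_vimage_Inl_Inr:
  "finite S \<Longrightarrow> finite (Inl -` S)" "finite S \<Longrightarrow> finite (Inr -` S)"
  by (simp_all add: finite_vimageI)

lemma card_sum_type:
  assumes "finite S"
  shows "card S = card (Inl -` S) + card (Inr -` S)"
  using card_Plus[of "Inl -` S" "Inr -` S"] finite_vimage_Inl_Inr[OF assms] by (simp add: Plus_vimage)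

lemma is_matroid_direct_sum:
  assumes M: "is_matroid M" and N: "is_matroid N"
  shows "is_matroid (direct_sum M N)"
  unfolding is_matroid_def
proof (intro conjI allI impI)
  show "finite (ground (direct_sum M N))" using is_matroid_finite[OF M] is_matroid_finite[OF N] by simp
  show sub: "indeps (direct_sum M N) \<subseteq> Pow (ground (direct_sum M N))"
    using is_matroid_Pow[OF M] is_matroid_Pow[OF N] by (auto simp: direct_sum_def)
  show "{} \<in> indeps (direct_sum M N)"
    by (simp add: indeps_direct_sum is_matroid_empty[OF M] is_matroid_empty[OF N])
  fix I J
  show "J \<in> indeps (direct_sum M N)" if "I \<in> indeps (direct_sum M N) \<and> J \<subseteq> I"
    using that is_matroid_down[OF M, of "Inl -` I" "Inl -` J"] is_matroid_down[OF N, of "Inr -` I" "Inr -` J"]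
    by (auto simp: indeps_direct_sum)
  assume *: "I \<in> indeps (direct_sum M N) \<and> J \<in> indeps (direct_sum M N) \<and> card J < card I"
  have fin: "finite (ground M <+> ground N)" using is_matroid_finite[OF M] is_matroid_finite[OF N] by simp
  have "finite I" "finite J" by (rule finite_subset[OF _ fin]; use sub * in auto)+
  \<comment> \<open>If \<open>J\<close> is smaller than \<open>I\<close>, then it is smaller in at
    least one component; augmenting there leaves the other component untouched.\<close>
  with * card_sum_type[of I] card_sum_type[of J]
  consider "card (Inl -` J) < card (Inl -` I)" | "card (Inr -` J) < card (Inr -` I)" by linarith
  then show "\<exists>x\<in>I - J. J \<union> {x} \<in> indeps (direct_sum M N)"
  proof cases
    case 1
    then obtain x where "x \<in> Inl -` I - Inl -` J" "insert x (Inl -` J) \<in> indeps M"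
      using is_matroid_augment[OF M, of "Inl -` I" "Inl -` J"] * by (auto simp: indeps_direct_sum)
    moreover have "Inl -` (J \<union> {Inl x}) = insert x (Inl -` J)" "Inr -` (J \<union> {Inl x}) = Inr -` J" by auto
    ultimately show ?thesis using * by (intro bexI[of _ "Inl x"]) (auto simp: indeps_direct_sum)
  next
    case 2
    then obtain x where "x \<in> Inr -` I - Inr -` J" "insert x (Inr -` J) \<in> indeps N"
      using is_matroid_augment[OF N, of "Inr -` I" "Inr -` J"] * by (auto simp: indeps_direct_sum)
    moreover have "Inr -` (J \<union> {Inr x}) = insert x (Inr -` J)" "Inl -` (J \<union> {Inr x}) = Inl -` J" by auto
    ultimately show ?thesis using * by (intro bexI[of _ "Inr x"]) (auto simp: indeps_direct_sum)
  qed
qed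

lemma direct_sum_iso_cong:
  assumes "matroid_iso M M'" "matroid_iso N N'"
  shows "matroid_iso (direct_sum M N) (direct_sum M' N')"
proof -
  obtain f where f: "bij_betw f (ground M) (ground M')"
    and fI: "\<And>I. I \<subseteq> ground M \<Longrightarrow> I \<in> indeps M \<longleftrightarrow> f ` I \<in> indeps M'"
    using assms(1) unfolding matroid_iso_def by blast
  obtain g where g: "bij_betw g (ground N) (ground N')"
    and gI: "\<And>I. I \<subseteq> ground N \<Longrightarrow> I \<in> indeps N \<longleftrightarrow> g ` I \<in> indeps N'"
    using assms(2) unfolding matroid_iso_def by blast
  show ?thesis
  proof (rule matroid_isoI[of "map_sum f g"])
    have "map_sum f g ` (ground M <+> ground N) = f ` ground M <+> g ` ground N"
      by (auto simp: Plus_def image_Un image_image)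
    moreover have "inj_on (map_sum f g) (ground M <+> ground N)"
      using f g by (intro inj_onI) (elim PlusE; auto simp: bij_betw_def dest: inj_onD)
    ultimately show "bij_betw (map_sum f g) (ground (direct_sum M N)) (ground (direct_sum M' N'))"
      using f g by (simp add: bij_betw_def)
    fix I assume I: "I \<subseteq> ground (direct_sum M N)"
    have "Inl -` map_sum f g ` I = f ` (Inl -` I)" "Inr -` map_sum f g ` I = g ` (Inr -` I)"
      by (force simp: image_iff map_sum_def split: sum.splits)+
    moreover have "Inl -` I \<subseteq> ground M" "Inr -` I \<subseteq> ground N" using I by auto
    ultimately show "I \<in> indeps (direct_sum M N) \<longleftrightarrow> map_sum f g ` I \<in> indeps (direct_sum M' N')"
      using fI gI by (simp add: indeps_direct_sum)
  qed
qed

lemma direct_sum_iso_commute: "matroid_iso (direct_sum M N) (direct_sum N M)"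
proof (rule matroid_isoI[of "case_sum Inr Inl"])
  show "bij_betw (case_sum Inr Inl) (ground (direct_sum M N)) (ground (direct_sum N M))"
    by (rule bij_betw_byWitness[of _ "case_sum Inr Inl"]) auto
  fix I :: "('a + 'b) set"
  have "Inl -` case_sum Inr Inl ` I = Inr -` I" "Inr -` case_sum Inr Inl ` I = Inl -` I"
    by (force simp: image_iff split: sum.splits)+
  then show "I \<in> indeps (direct_sum M N) \<longleftrightarrow> case_sum Inr Inl ` I \<in> indeps (direct_sum N M)"
    by (auto simp: indeps_direct_sum)
qed

lemma direct_sum_iso_assoc:
  "matroid_iso (direct_sum (direct_sum M N) P) (direct_sum M (direct_sum N P))"
proof (rule matroid_isoI)
  let ?f = "case_sum (case_sum Inl (Inr \<circ> Inl)) (Inr \<circ> Inr)"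
  let ?g = "case_sum (Inl \<circ> Inl) (case_sum (Inl \<circ> Inr) Inr)"
  show "bij_betw ?f (ground (direct_sum (direct_sum M N) P)) (ground (direct_sum M (direct_sum N P)))"
    by (rule bij_betw_byWitness[of _ ?g]) auto
  fix I :: "(('a + 'b) + 'c) set"
  have "Inl -` ?f ` I = Inl -` Inl -` I" "Inl -` Inr -` ?f ` I = Inr -` Inl -` I"
    "Inr -` Inr -` ?f ` I = Inr -` I"
    by (force simp: image_iff split: sum.splits)+
  then show "I \<in> indeps (direct_sum (direct_sum M N) P) \<longleftrightarrow> ?f ` I \<in> indeps (direct_sum M (direct_sum N P))"
    by (auto simp: indeps_direct_sum)
qed

text \<open>The branch \<open>undefined\<close> of the bijection is never reached, since the left
  summand contributes no elements.\<close>

lemma direct_sum_iso_empty: "matroid_iso (direct_sum empty_matroid M) M"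
proof (rule matroid_isoI[of "case_sum undefined id"])
  show "bij_betw (case_sum undefined id) (ground (direct_sum empty_matroid M)) (ground M)"
    by (rule bij_betw_byWitness[of _ Inr]) (auto simp: empty_matroid_def)
  fix I assume "I \<subseteq> ground (direct_sum empty_matroid M)"
  then have "I = Inr ` (Inr -` I)" "Inl -` I = {}" by (auto simp: empty_matroid_def)
  moreover from this(1) have "case_sum undefined id ` I = Inr -` I" by (metis (no_types, lifting) id_apply image_cong image_ident image_image sum.simps(6))
  ultimately show "I \<in> indeps (direct_sum empty_matroid M) \<longleftrightarrow> case_sum undefined id ` I \<in> indeps M"
    by (simp add: indeps_direct_sum empty_matroid_def)
qed

subsection \<open>The rank polynomial of a direct sum\<close>

lemma rank_direct_sum:
  assumes M: "is_matroid M" and N: "is_matroid N"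
  shows "rank (direct_sum M N) (A <+> B) = rank M A + rank N B"
proof (rule antisym)
  note MN = is_matroid_direct_sum[OF M N]
  obtain S where S: "S \<in> indeps (direct_sum M N)" "S \<subseteq> A <+> B" "card S = rank (direct_sum M N) (A <+> B)"
    using rank_witness[OF MN] by blast
  have "card (Inl -` S) \<le> rank M A" "card (Inr -` S) \<le> rank N B"
    using S by (auto simp: indeps_direct_sum intro!: card_le_rank M N)
  then show "rank (direct_sum M N) (A <+> B) \<le> rank M A + rank N B"
    using card_sum_type[OF is_matroid_finite_indep[OF MN S(1)]] S(3) by simp
  obtain I where I: "I \<in> indeps M" "I \<subseteq> A" "card I = rank M A" using rank_witness[OF M] by blast
  obtain J where J: "J \<in> indeps N" "J \<subseteq> B" "card J = rank N B" using rank_witness[OF N] by blast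
  have "card (I <+> J) \<le> rank (direct_sum M N) (A <+> B)"
    using I J by (intro card_le_rank[OF MN]) auto
  then show "rank M A + rank N B \<le> rank (direct_sum M N) (A <+> B)"
    using I J is_matroid_finite_indep[OF M] is_matroid_finite_indep[OF N] by (simp add: card_Plus)
qed

text \<open>The inequalities keep the truncated subtractions additive; without truncation this is
  just the exponent law.\<close>

lemma rank_term_add:
  assumes "s \<le> r" "s' \<le> r'" "s \<le> k" "s' \<le> k'"
  shows "rank_term (r + r') (s + s') (k + k') = rank_term r s k * rank_term r' s' k'"
proof -
  have "r + r' - (s + s') = (r - s) + (r' - s')" "k + k' - (s + s') = (k - s) + (k' - s')"
    using assms by auto
  thus ?thesis by (simp add: rank_term_def power_add mult_ac)
qed

text \<open>Subsets of the disjoint union are pairs of subsets, and ranks and cardinalities add. The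
  terms thus multiply, and the double sum factors.\<close>

lemma rank_poly_direct_sum:
  assumes M: "is_matroid M" and N: "is_matroid N"
  shows "rank_poly (direct_sum M N) = rank_poly M * rank_poly N"
proof -
  have bij: "bij_betw (\<lambda>(A, B). A <+> B) (Pow (ground M) \<times> Pow (ground N)) (Pow (ground M <+> ground N))"
    by (rule bij_betw_byWitness[of _ "\<lambda>S. (Inl -` S, Inr -` S)"]) (auto simp: Plus_vimage)
  have "rank_poly (direct_sum M N) =
      (\<Sum>(A, B)\<in>Pow (ground M) \<times> Pow (ground N).
        rank_term (rank M (ground M) + rank N (ground N)) (rank M A + rank N B) (card (A <+> B)))"
    unfolding rank_poly_def ground_direct_sum sum.reindex_bij_betw[OF bij, symmetric]
    by (simp add: rank_direct_sum[OF M N] case_prod_unfold)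
  also have "\<dots> = (\<Sum>(A, B)\<in>Pow (ground M) \<times> Pow (ground N).
      rank_term (rank M (ground M)) (rank M A) (card A) * rank_term (rank N (ground N)) (rank N B) (card B))"
  proof (intro sum.cong refl, clarify)
    fix A B assume AB: "A \<subseteq> ground M" "B \<subseteq> ground N"
    then have fin: "finite A" "finite B"
      using is_matroid_finite[OF M] is_matroid_finite[OF N] by (auto intro: finite_subset)
    show "rank_term (rank M (ground M) + rank N (ground N)) (rank M A + rank N B) (card (A <+> B)) =
      rank_term (rank M (ground M)) (rank M A) (card A) * rank_term (rank N (ground N)) (rank N B) (card B)"
      unfolding card_Plus[OF fin]
      by (intro rank_term_add rank_mono rank_le_card M N AB fin)
  qed
  also have "\<dots> = rank_poly M * rank_poly N"
    unfolding rank_poly_def sum_product sum.cartesian_product by simp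
  finally show ?thesis .
qed

section \<open>Matroids without non-degenerate elements\<close>

text \<open>\<open>split_type M m n\<close> says that \<open>M\<close> is isomorphic to \<open>\<epsilon>\<^sup>m \<oplus> \<sigma>\<^sup>n\<close>, with \<open>K\<close> the set of its isthmuses.\<close>

definition split_type :: "'a matroid \<Rightarrow> nat \<Rightarrow> nat \<Rightarrow> bool" where
  "split_type M m n \<longleftrightarrow>
     finite (ground M) \<and> (\<exists>K\<subseteq>ground M. indeps M = Pow K \<and> card K = m \<and> card (ground M - K) = n)"

text \<open>A bijection between the isthmuses is glued to one between the loops; independence only
  asks whether a set consists of isthmuses.\<close>

lemma split_type_iso:
  assumes "split_type M m n" "split_type N m n"
  shows "matroid_iso M N"
proof -
  obtain K where K: "finite (ground M)" "K \<subseteq> ground M" "indeps M = Pow K" "card K = m" "card (ground M - K) = n"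
    using assms(1) by (auto simp: split_type_def)
  obtain L where L: "finite (ground N)" "L \<subseteq> ground N" "indeps N = Pow L" "card L = m" "card (ground N - L) = n"
    using assms(2) by (auto simp: split_type_def)
  have fin: "finite K" "finite L" using K L by (auto intro: finite_subset)
  obtain f where f: "bij_betw f K L" using finite_same_card_bij[OF fin] K L by auto
  obtain g where g: "bij_betw g (ground M - K) (ground N - L)"
    using finite_same_card_bij[of "ground M - K" "ground N - L"] K L by auto
  let ?h = "\<lambda>x. if x \<in> K then f x else g x"
  have h: "bij_betw ?h (ground M) (ground N)"
  proof -
    have "bij_betw ?h (K \<union> (ground M - K)) (L \<union> (ground N - L))"
    proof (rule bij_betw_combine)
      have "bij_betw ?h K L \<longleftrightarrow> bij_betw f K L" by (rule bij_betw_cong) simp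
      then show "bij_betw ?h K L" using f by simp
      have "bij_betw ?h (ground M - K) (ground N - L) \<longleftrightarrow> bij_betw g (ground M - K) (ground N - L)"
        by (rule bij_betw_cong) simp
      then show "bij_betw ?h (ground M - K) (ground N - L)" using g by simp
    qed auto
    then show ?thesis using K L by (simp add: Un_absorb1)
  qed
  show ?thesis
  proof (rule matroid_isoI[OF h])
    fix I assume "I \<subseteq> ground M"
    moreover have "?h ` K \<subseteq> L" using f by (auto simp: bij_betw_def)
    moreover have "?h x \<notin> L" if "x \<in> ground M - K" for x using g that by (auto simp: bij_betw_def)
    ultimately show "I \<in> indeps M \<longleftrightarrow> ?h ` I \<in> indeps N"
      unfolding K L by (smt (verit, best) DiffI PowD PowI image_subset_iff subsetD subsetI)
  qed
qed

lemma split_type_direct_sum: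
  assumes "split_type M m n" "split_type N m' n'"
  shows "split_type (direct_sum M N) (m + m') (n + n')"
proof -
  obtain K where K: "finite (ground M)" "K \<subseteq> ground M" "indeps M = Pow K" "card K = m" "card (ground M - K) = n"
    using assms(1) by (auto simp: split_type_def)
  obtain L where L: "finite (ground N)" "L \<subseteq> ground N" "indeps N = Pow L" "card L = m'" "card (ground N - L) = n'"
    using assms(2) by (auto simp: split_type_def)
  have fin: "finite K" "finite L" using K L by (auto intro: finite_subset)
  have "(ground M <+> ground N) - (K <+> L) = (ground M - K) <+> (ground N - L)" by auto
  moreover have "indeps (direct_sum M N) = Pow (K <+> L)"
  proof (rule Set.set_eqI)
    fix S
    have "S \<subseteq> K <+> L \<longleftrightarrow> Inl -` S \<subseteq> K \<and> Inr -` S \<subseteq> L"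
      by (auto simp: subset_iff split_sum_all)
    then show "S \<in> indeps (direct_sum M N) \<longleftrightarrow> S \<in> Pow (K <+> L)"
      by (simp add: indeps_direct_sum K L)
  qed
  ultimately show ?thesis
    unfolding split_type_def using K L fin
    by (intro conjI exI[of _ "K <+> L"]) (auto simp: card_Plus)
qed

lemma split_type_relabel:
  assumes "split_type M m n" and f: "inj_on f (ground M)"
  shows "split_type (relabel f M) m n"
proof -
  obtain K where K: "finite (ground M)" "K \<subseteq> ground M" "indeps M = Pow K" "card K = m" "card (ground M - K) = n"
    using assms(1) by (auto simp: split_type_def)
  have "f ` ground M - f ` K = f ` (ground M - K)" using K f by (simp add: inj_on_image_set_diff)
  moreover have "card (f ` K) = card K" "card (f ` (ground M - K)) = card (ground M - K)"
    using K f by (auto intro!: card_image intro: inj_on_subset)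
  ultimately show ?thesis
    unfolding split_type_def relabel_def using K
    by (intro conjI exI[of _ "f ` K"]) (auto simp: image_Pow_surj)
qed

text \<open>Independent sets contain no loops, hence only isthmuses here; conversely every basis
  contains all isthmuses, so any set of them is independent.\<close>

lemma split_type_degenerate:
  assumes M: "is_matroid M" and deg: "\<And>e. \<not> nondegenerate M e"
  shows "\<exists>m n. split_type M m n"
proof -
  let ?K = "{e \<in> ground M. isthmus M e}"
  have "indeps M = Pow ?K"
  proof (intro equalityI subsetI)
    fix I assume I: "I \<in> indeps M"
    show "I \<in> Pow ?K"
    proof
      show "I \<subseteq> ?K"
        using I is_matroid_subset[OF M I] deg loop_notin_indep[OF M _ I] by (auto simp: nondegenerate_def)
    qed
  next
    fix I assume I: "I \<in> Pow ?K"
    obtain B where B: "basis M B" using indep_extends_to_basis[OF M is_matroid_empty[OF M]] by blast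
    then have "I \<subseteq> B" using I by (auto simp: isthmus_def)
    then show "I \<in> indeps M" using B is_matroid_down[OF M, of B I] by (simp add: basis_def)
  qed
  then show ?thesis using is_matroid_finite[OF M] unfolding split_type_def by blast
qed

section \<open>Direct sums in Mat\<close>

lemma Mat_obsD: "M \<in> Mat_obs \<Longrightarrow> is_matroid M" "M \<in> Mat_obs \<Longrightarrow> n \<in> ground M \<Longrightarrow> 0 < n"
  by (auto simp: Mat_obs_def intro: gr0I)

text \<open>The parity of the code tells the summand apart. Positivity of the labels matters: with
  truncated subtraction, a label 0 on the left would get the code 0, which is even.\<close>

lemma Mat_sum_inj:
  assumes "M \<in> Mat_obs" "N \<in> Mat_obs"
  shows "inj_on (case_sum (\<lambda>n. 2 * n - 1) (\<lambda>n. 2 * n)) (ground (direct_sum M N))"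
proof (rule inj_on_inverseI[of _ "\<lambda>k. if even k then Inr (k div 2) else Inl (Suc k div 2)"])
  have odd: "odd (2 * n - 1) \<and> Suc (2 * n - 1) div 2 = n" if "0 < n" for n :: nat using that by presburger
  fix a assume "a \<in> ground (direct_sum M N)"
  then show "(if even (case_sum (\<lambda>n. 2 * n - 1) (\<lambda>n. 2 * n) a)
      then Inr (case_sum (\<lambda>n. 2 * n - 1) (\<lambda>n. 2 * n) a div 2)
      else Inl (Suc (case_sum (\<lambda>n. 2 * n - 1) (\<lambda>n. 2 * n) a) div 2)) = a"
    using Mat_obsD(2)[OF assms(1)] odd unfolding ground_direct_sum
    by (elim PlusE) (simp_all only: sum.case simp_thms if_False if_True, simp)
qed

lemma Mat_sum_iso:
  assumes "M \<in> Mat_obs" "N \<in> Mat_obs"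
  shows "matroid_iso (direct_sum M N) (Mat_sum M N)"
  unfolding Mat_sum_def using assms
  by (intro relabel_iso Mat_sum_inj is_matroid_Pow is_matroid_direct_sum Mat_obsD)

lemma Mat_sum_in_Mat_obs:
  assumes "M \<in> Mat_obs" "N \<in> Mat_obs"
  shows "Mat_sum M N \<in> Mat_obs"
proof -
  have "is_matroid (Mat_sum M N)"
    unfolding Mat_sum_def using assms
    by (intro is_matroid_relabel Mat_sum_inj is_matroid_direct_sum Mat_obsD)
  moreover have "0 \<notin> ground (Mat_sum M N)"
    using Mat_obsD(2)[OF assms(1)] Mat_obsD(2)[OF assms(2)] by (fastforce simp: Mat_sum_def relabel_def)
  ultimately show ?thesis by (simp add: Mat_obs_def)
qed

lemma Mat_sum_iso_cong:
  assumes "M \<in> Mat_obs" "N \<in> Mat_obs" "M' \<in> Mat_obs" "N' \<in> Mat_obs" "matroid_iso M M'" "matroid_iso N N'"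
  shows "matroid_iso (Mat_sum M N) (Mat_sum M' N')"
  using direct_sum_iso_cong[OF assms(5,6)] Mat_sum_iso[OF assms(1,2)] Mat_sum_iso[OF assms(3,4)]
  by (meson matroid_iso_sym matroid_iso_trans)

lemma Mat_sum_iso_commute:
  assumes "M \<in> Mat_obs" "N \<in> Mat_obs"
  shows "matroid_iso (Mat_sum M N) (Mat_sum N M)"
  using direct_sum_iso_commute[of M N] Mat_sum_iso[OF assms] Mat_sum_iso[OF assms(2,1)]
  by (meson matroid_iso_sym matroid_iso_trans)

lemma Mat_sum_iso_assoc:
  assumes M: "M \<in> Mat_obs" and N: "N \<in> Mat_obs" and P: "P \<in> Mat_obs"
  shows "matroid_iso (Mat_sum (Mat_sum M N) P) (Mat_sum M (Mat_sum N P))"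
proof -
  have "matroid_iso (Mat_sum (Mat_sum M N) P) (direct_sum (direct_sum M N) P)"
    using Mat_sum_iso[OF Mat_sum_in_Mat_obs[OF M N] P]
      direct_sum_iso_cong[OF Mat_sum_iso[OF M N] matroid_iso_refl[of P]]
    by (meson matroid_iso_sym matroid_iso_trans)
  moreover have "matroid_iso (direct_sum M (direct_sum N P)) (Mat_sum M (Mat_sum N P))"
    using Mat_sum_iso[OF M Mat_sum_in_Mat_obs[OF N P]]
      direct_sum_iso_cong[OF matroid_iso_refl[of M] Mat_sum_iso[OF N P]]
    by (meson matroid_iso_sym matroid_iso_trans)
  ultimately show ?thesis using direct_sum_iso_assoc[of M N P] by (meson matroid_iso_trans)
qed

lemma empty_matroid_in_Mat_obs: "empty_matroid \<in> Mat_obs"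
  by (simp add: Mat_obs_def) (simp add: empty_matroid_def)

lemma Mat_sum_iso_empty:
  assumes "M \<in> Mat_obs"
  shows "matroid_iso (Mat_sum empty_matroid M) M"
  using direct_sum_iso_empty[of M] Mat_sum_iso[OF empty_matroid_in_Mat_obs assms]
  by (meson matroid_iso_sym matroid_iso_trans)

section \<open>Tutte polynomials and split types of sums in Mat\<close>

lemma tutte_iso:
  "is_matroid M \<Longrightarrow> is_matroid N \<Longrightarrow> matroid_iso M N \<Longrightarrow> tutte M = tutte N"
  by (simp add: tutte_eq_rank_poly rank_poly_iso)

lemma tutte_Mat_sum:
  assumes "M \<in> Mat_obs" "N \<in> Mat_obs"
  shows "tutte (Mat_sum M N) = tutte M * tutte N"
proof -
  note D = Mat_obsD(1)[OF assms(1)] Mat_obsD(1)[OF assms(2)]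
  have "rank_poly (direct_sum M N) = rank_poly (Mat_sum M N)"
    using Mat_sum_iso[OF assms] Mat_obsD(1)[OF Mat_sum_in_Mat_obs[OF assms]]
    by (intro rank_poly_iso is_matroid_direct_sum D)
  then show ?thesis
    using Mat_obsD(1)[OF Mat_sum_in_Mat_obs[OF assms]] D
    by (simp add: tutte_eq_rank_poly rank_poly_direct_sum)
qed

lemma split_type_Mat_sum:
  assumes "M \<in> Mat_obs" "N \<in> Mat_obs" "split_type M m n" "split_type N m' n'"
  shows "split_type (Mat_sum M N) (m + m') (n + n')"
  unfolding Mat_sum_def using assms by (intro split_type_relabel split_type_direct_sum Mat_sum_inj)

lemma split_type_atoms:
  shows split_type_empty: "split_type (empty_matroid :: nat matroid) 0 0"
    and split_type_eps: "split_type eps 1 0" and split_type_sig: "split_type sig 0 1"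
proof -
  show "split_type (empty_matroid :: nat matroid) 0 0" by (auto simp: split_type_def empty_matroid_def)
  have "indeps eps = Pow {1}" by (auto simp: eps_def)
  then show "split_type eps 1 0" unfolding split_type_def by (intro conjI exI[of _ "{1}"]) (auto simp: eps_def)
  have "indeps sig = Pow {}" by (auto simp: sig_def)
  then show "split_type sig 0 1" unfolding split_type_def by (intro conjI exI[of _ "{}"]) (auto simp: sig_def)
qed

lemma is_matroid_split_type:
  assumes "split_type M m n"
  shows "is_matroid M"
proof -
  obtain K where K: "finite (ground M)" "K \<subseteq> ground M" "indeps M = Pow K"
    using assms by (auto simp: split_type_def)
  have "\<exists>x\<in>I - J. insert x J \<subseteq> K" if "I \<subseteq> K" "J \<subseteq> K" "card J < card I" for I J
  proof -
    have "finite J" using that(2) K by (meson finite_subset)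
    then have "\<not> I \<subseteq> J" using that(3) card_mono[of J I] by auto
    then show ?thesis using that by blast
  qed
  then show ?thesis using K by (auto simp: is_matroid_def)
qed

lemma atoms_in_Mat_obs: "eps \<in> Mat_obs" "sig \<in> Mat_obs"
  using split_type_atoms[THEN is_matroid_split_type] by (simp_all add: Mat_obs_def eps_def sig_def)

lemma Mat_power_in_Mat_obs: "M \<in> Mat_obs \<Longrightarrow> Mat_power M n \<in> Mat_obs"
  by (induction n) (simp_all add: Mat_power_def empty_matroid_in_Mat_obs Mat_sum_in_Mat_obs)

lemma split_type_Mat_power:
  assumes "M \<in> Mat_obs" "split_type M a b"
  shows "split_type (Mat_power M n) (n * a) (n * b)"
proof (induction n)
  case (Suc n)
  then show ?case
    using split_type_Mat_sum[OF assms(1) Mat_power_in_Mat_obs[OF assms(1)] assms(2) Suc] by (simp add: Mat_power_def)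
qed (simp add: Mat_power_def split_type_atoms)

text \<open>The normal forms reached by deletion-contraction, and the generators used to
  characterise \<rho>.\<close>

definition monomial_matroid :: "nat \<Rightarrow> nat \<Rightarrow> nat matroid" where
  "monomial_matroid m n = Mat_sum (Mat_power eps m) (Mat_power sig n)"

lemma monomial_matroid_in_Mat_obs: "monomial_matroid m n \<in> Mat_obs"
  unfolding monomial_matroid_def by (intro Mat_sum_in_Mat_obs Mat_power_in_Mat_obs atoms_in_Mat_obs)

lemma split_type_monomial_matroid: "split_type (monomial_matroid m n) m n"
  using split_type_Mat_sum[OF Mat_power_in_Mat_obs[OF atoms_in_Mat_obs(1)] Mat_power_in_Mat_obs[OF atoms_in_Mat_obs(2)]
      split_type_Mat_power[OF atoms_in_Mat_obs(1) split_type_eps, of m]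
      split_type_Mat_power[OF atoms_in_Mat_obs(2) split_type_sig, of n]]
  by (simp add: monomial_matroid_def)

lemma tutte_empty: "tutte empty_matroid = 1"
  by (simp add: tutte_eq_rank_poly rank_poly_empty)

lemma tutte_Mat_power: "M \<in> Mat_obs \<Longrightarrow> tutte (Mat_power M n) = tutte M ^ n"
proof (induction n)
  case (Suc n)
  then show ?case using tutte_Mat_sum[OF Suc.prems Mat_power_in_Mat_obs[OF Suc.prems], of n] by (simp add: Mat_power_def)
qed (simp add: Mat_power_def tutte_empty)

lemma tutte_eps: "tutte eps = var_x"
proof -
  have "isthmus eps 1" by (auto simp: isthmus_def basis_def eps_def)
  from rank_poly_isthmus[OF Mat_obsD(1)[OF atoms_in_Mat_obs(1)] this]
  have "rank_poly eps = var_x * rank_poly (contraction eps 1)" .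
  moreover have "contraction eps 1 = empty_matroid"
    by (auto simp: contraction_def eps_def empty_matroid_def)
  ultimately show ?thesis
    using Mat_obsD(1)[OF atoms_in_Mat_obs(1)] by (simp add: tutte_eq_rank_poly rank_poly_empty)
qed

lemma tutte_sig: "tutte sig = var_y"
proof -
  have "loop sig 1" by (auto simp: loop_def sig_def)
  from rank_poly_loop[OF Mat_obsD(1)[OF atoms_in_Mat_obs(2)] this]
  have "rank_poly sig = var_y * rank_poly (deletion sig 1)" .
  moreover have "deletion sig 1 = empty_matroid"
    by (auto simp: deletion_def sig_def empty_matroid_def)
  ultimately show ?thesis
    using Mat_obsD(1)[OF atoms_in_Mat_obs(2)] by (simp add: tutte_eq_rank_poly rank_poly_empty)
qed

lemma tutte_monomial_matroid: "tutte (monomial_matroid m n) = var_x ^ m * var_y ^ n"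
  unfolding monomial_matroid_def
  by (simp add: tutte_Mat_sum Mat_power_in_Mat_obs atoms_in_Mat_obs tutte_Mat_power tutte_eps tutte_sig)

section \<open>The category of matroids\<close>

lemma Mat_plus_simps:
  "obs Mat_plus = insert None (Some ` Mat_obs)"
  "src Mat_plus (A, f, B) = A" "tgt Mat_plus (A, f, B) = B" "ident Mat_plus A = incl A A"
  "cmp Mat_plus (B', g, C) (A, f, B) = (A, compose (elements A) g f, C)"
  by (simp_all add: Mat_plus_def)

lemma extend_Mat_plus_simps [simp]:
  "obs Mat_iso = obs Mat_plus" "src Mat_iso = src Mat_plus"
  "coverings Mat_iso = base_families \<union> {(tgt Mat_plus f, {#f#}) | f. iso_arr Mat_plus f}"
  "obs Mat_tc = obs Mat_plus" "src Mat_tc = src Mat_plus"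
  "coverings Mat_tc = base_families \<union>
     {(Some M, leaf_to_root T F) | M T F. binary_tree T \<and> dc_tree T F \<and> on_obs F [] = Some M}"
  by (simp_all add: Mat_iso_def Mat_tc_def cat.extend_def)

lemma elements_simps [simp]: "elements None = {}" "elements (Some M) = ground M"
  by (simp_all add: elements_def)

lemma Mat_arr_cases [consumes 1, case_names base mat]:
  assumes "a \<in> arrs Mat_plus"
  obtains "a = incl None None"
  | M f N where "a = (Some M, f, Some N)" "M \<in> Mat_obs" "N \<in> Mat_obs"
      "f \<in> ground M \<rightarrow>\<^sub>E ground N" "inj_on f (ground M)" "\<And>I. I \<in> indeps M \<Longrightarrow> f ` I \<in> indeps N"
  using assms by (auto simp: Mat_plus_def)

lemma Mat_arrI:
  assumes "M \<in> Mat_obs" "N \<in> Mat_obs"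
      "f \<in> ground M \<rightarrow>\<^sub>E ground N" "inj_on f (ground M)" "\<And>I. I \<in> indeps M \<Longrightarrow> f ` I \<in> indeps N"
  shows "(Some M, f, Some N) \<in> arrs Mat_plus"
  using assms by (auto simp: Mat_plus_def)

lemma base_incl_in_arrs: "incl None None \<in> arrs Mat_plus"
  by (simp add: Mat_plus_def)

lemma incl_in_arrs:
  assumes "M \<in> Mat_obs" "N \<in> Mat_obs" "ground M \<subseteq> ground N" "indeps M \<subseteq> indeps N"
  shows "incl (Some M) (Some N) \<in> arrs Mat_plus"
  unfolding incl_def elements_simps
proof (rule Mat_arrI)
  show "restrict (\<lambda>x. x) (ground M) \<in> ground M \<rightarrow>\<^sub>E ground N" using assms(3) by auto
  show "restrict (\<lambda>x. x) (ground M) ` I \<in> indeps N" if "I \<in> indeps M" for I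
  proof -
    have "restrict (\<lambda>x. x) (ground M) ` I = I"
      using is_matroid_subset[OF Mat_obsD(1)[OF assms(1)] that] by (auto simp: subset_iff image_iff)
    then show ?thesis using assms(4) that by auto
  qed
qed (use assms in \<open>auto simp: inj_on_def\<close>)

lemma ident_in_arrs: "A \<in> obs Mat_plus \<Longrightarrow> incl A A \<in> arrs Mat_plus"
  by (auto simp: Mat_plus_simps base_incl_in_arrs intro: incl_in_arrs)

lemma src_incl [simp]: "src Mat_plus (incl A B) = A" and tgt_incl [simp]: "tgt Mat_plus (incl A B) = B"
  by (simp_all add: incl_def Mat_plus_simps)

lemma cmp_incl:
  assumes "elements A \<subseteq> elements B"
  shows "cmp Mat_plus (incl B C) (incl A B) = incl A C"
  using assms by (auto simp: incl_def Mat_plus_simps compose_def intro!: restrict_ext)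

lemma Mat_ident_laws:
  assumes "a \<in> arrs Mat_plus"
  shows Mat_ident_left: "cmp Mat_plus (incl (tgt Mat_plus a) (tgt Mat_plus a)) a = a"
    and Mat_ident_right: "cmp Mat_plus a (incl (src Mat_plus a) (src Mat_plus a)) = a"
proof -
  let ?l = "cmp Mat_plus (incl (tgt Mat_plus a) (tgt Mat_plus a)) a"
  let ?r = "cmp Mat_plus a (incl (src Mat_plus a) (src Mat_plus a))"
  from assms have "?l = a \<and> ?r = a"
  proof (cases rule: Mat_arr_cases)
    case base
    then show ?thesis by (simp add: cmp_incl)
  next
    case (mat M f N)
    then have "compose (ground M) (\<lambda>x\<in>ground N. x) f = f" "compose (ground M) f (\<lambda>x\<in>ground M. x) = f"
      by (auto intro!: Id_compose compose_Id simp: PiE_def)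
    with mat show ?thesis by (simp add: Mat_plus_simps incl_def)
  qed
  then show "?l = a" "?r = a" by simp_all
qed

lemma iso_arr_ident: "A \<in> obs Mat_plus \<Longrightarrow> iso_arr Mat_plus (incl A A)"
  unfolding iso_arr_def using ident_in_arrs[of A]
  by (intro conjI bexI[of _ "incl A A"]) (simp_all add: cmp_incl, simp_all add: Mat_plus_simps)

definition obj_iso :: "mat_ob \<Rightarrow> mat_ob \<Rightarrow> bool" where
  "obj_iso A B \<longleftrightarrow> A = None \<and> B = None \<or>
     (\<exists>M N. A = Some M \<and> B = Some N \<and> M \<in> Mat_obs \<and> N \<in> Mat_obs \<and> matroid_iso M N)"

text \<open>A morphism preserves independence only forwards; the reverse implication comes from
  applying the inverse morphism to the image of a set.\<close>

lemma iso_arr_imp_obj_iso: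
  assumes "iso_arr Mat_plus a"
  shows "obj_iso (src Mat_plus a) (tgt Mat_plus a)"
proof -
  obtain b where a: "a \<in> arrs Mat_plus" and b: "b \<in> arrs Mat_plus"
    and ab: "src Mat_plus b = tgt Mat_plus a" "tgt Mat_plus b = src Mat_plus a"
      "cmp Mat_plus b a = ident Mat_plus (src Mat_plus a)" "cmp Mat_plus a b = ident Mat_plus (tgt Mat_plus a)"
    using assms unfolding iso_arr_def by blast
  from a show ?thesis
  proof (cases rule: Mat_arr_cases)
    case base
    then show ?thesis by (simp add: obj_iso_def)
  next
    case (mat M f N)
    note f = mat
    from b obtain g where g: "b = (Some N, g, Some M)" "g \<in> ground N \<rightarrow>\<^sub>E ground M"
      "\<And>I. I \<in> indeps N \<Longrightarrow> g ` I \<in> indeps M"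
      using ab f by (cases rule: Mat_arr_cases) (auto simp: Mat_plus_simps incl_def)
    have "compose (ground M) g f = (\<lambda>x\<in>ground M. x)" "compose (ground N) f g = (\<lambda>x\<in>ground N. x)"
      using ab(3,4) f(1) g(1) by (simp_all add: Mat_plus_simps incl_def)
    then have gf: "\<And>x. x \<in> ground M \<Longrightarrow> g (f x) = x" and fg: "\<And>y. y \<in> ground N \<Longrightarrow> f (g y) = y"
      by (metis compose_eq restrict_apply')+
    have "matroid_iso M N"
    proof (rule matroid_isoI[of f])
      show "bij_betw f (ground M) (ground N)"
        using f(4) g(2) gf fg by (intro bij_betw_byWitness[of _ g]) auto
      fix I assume I: "I \<subseteq> ground M"
      then have "g ` f ` I = I" using gf by (force simp: image_image subset_iff)
      then show "I \<in> indeps M \<longleftrightarrow> f ` I \<in> indeps N" using f(6)[of I] g(3)[of "f ` I"] by auto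
    qed
    then show ?thesis using f by (simp add: obj_iso_def Mat_plus_simps)
  qed
qed

lemma matroid_iso_imp_iso_arr:
  assumes M: "M \<in> Mat_obs" and N: "N \<in> Mat_obs" and iso: "matroid_iso M N"
  shows "\<exists>a. iso_arr Mat_plus a \<and> src Mat_plus a = Some M \<and> tgt Mat_plus a = Some N"
proof -
  obtain f where f: "bij_betw f (ground M) (ground N)"
    and I: "\<And>I. I \<subseteq> ground M \<Longrightarrow> I \<in> indeps M \<longleftrightarrow> f ` I \<in> indeps N"
    using iso unfolding matroid_iso_def by blast
  define f' where "f' = restrict f (ground M)"
  define g' where "g' = restrict (inv_into (ground M) f) (ground N)"
  have g: "bij_betw (inv_into (ground M) f) (ground N) (ground M)" using f by (rule bij_betw_inv_into)
  have f'_im: "f' ` I = f ` I" if "I \<subseteq> ground M" for I using that by (auto simp: f'_def subset_iff image_iff)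
  have g'_im: "g' ` J = inv_into (ground M) f ` J" if "J \<subseteq> ground N" for J
    using that by (auto simp: g'_def subset_iff image_iff)
  have "(Some M, f', Some N) \<in> arrs Mat_plus"
  proof (rule Mat_arrI[OF M N])
    show "f' \<in> ground M \<rightarrow>\<^sub>E ground N" using f by (auto simp: f'_def bij_betw_def)
    show "inj_on f' (ground M)" using f by (simp add: f'_def bij_betw_def)
    fix J assume J: "J \<in> indeps M"
    then have "J \<subseteq> ground M" by (rule is_matroid_subset[OF Mat_obsD(1)[OF M]])
    then show "f' ` J \<in> indeps N" using I J f'_im by simp
  qed
  moreover have "(Some N, g', Some M) \<in> arrs Mat_plus"
  proof (rule Mat_arrI[OF N M])
    show "g' \<in> ground N \<rightarrow>\<^sub>E ground M" using g by (auto simp: g'_def bij_betw_def)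
    show "inj_on g' (ground N)" using g by (simp add: g'_def bij_betw_def)
    fix J assume J: "J \<in> indeps N"
    then have sub: "J \<subseteq> ground N" by (rule is_matroid_subset[OF Mat_obsD(1)[OF N]])
    then have "f ` g' ` J = J" using f g'_im[OF sub] by (simp add: image_inv_into_cancel bij_betw_def)
    moreover have "g' ` J \<subseteq> ground M" using g sub g'_im[OF sub] by (auto simp: bij_betw_def)
    ultimately show "g' ` J \<in> indeps M" using I[of "g' ` J"] J by simp
  qed
  moreover have "compose (ground M) g' f' = (\<lambda>x\<in>ground M. x)" "compose (ground N) f' g' = (\<lambda>x\<in>ground N. x)"
    using f g by (auto simp: compose_def f'_def g'_def bij_betw_def f_inv_into_f intro!: restrict_ext)
  ultimately have "iso_arr Mat_plus (Some M, f', Some N)"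
    unfolding iso_arr_def by (intro conjI bexI[of _ "(Some N, g', Some M)"]) (auto simp: Mat_plus_simps incl_def)
  then show ?thesis by (intro exI[of _ "(Some M, f', Some N)"]) (simp add: Mat_plus_simps)
qed

section \<open>Relations from isomorphisms\<close>

text \<open>The empty family covers the base-point, so its generator is itself a relation.\<close>

lemma base_family_relation:
  "frag_of None \<in> K0_relations Mat_iso" "frag_of None \<in> K0_relations Mat_tc"
proof -
  have "(None, {#}) \<in> base_families" unfolding base_families_def by (auto intro!: exI[of _ 0])
  then show "frag_of None \<in> K0_relations Mat_iso" "frag_of None \<in> K0_relations Mat_tc"
    unfolding K0_relations_def by (auto intro!: exI[of _ None] exI[of _ "{#}"])
qed

lemma base_family_sources:
  "(A, G) \<in> base_families \<Longrightarrow> A = None \<and> (\<forall>f\<in>#G. src Mat_plus f = None)"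
  by (auto simp: base_families_def Mat_plus_simps(4) split: if_splits)

lemma base_relation_vanishes:
  assumes h: "additive h" "h (frag_of None) = 0" and G: "(A, G) \<in> base_families"
  shows "h (frag_of A - (\<Sum>f\<in>#G. frag_of (src Mat_plus f))) = 0"
proof -
  have "(\<Sum>f\<in>#G. h (frag_of (src Mat_plus f))) = (\<Sum>f\<in>#G. 0)"
    using base_family_sources[OF G] h(2) by (intro arg_cong[of _ _ sum_mset] image_mset_cong) simp
  then show ?thesis
    using base_family_sources[OF G] h by (simp add: additive.diff[OF h(1)] additive_sum_mset[OF h(1)])
qed

lemma K0_relations_Mat_iso_cases:
  assumes "r \<in> K0_relations Mat_iso"
  obtains A G where "(A, G) \<in> base_families" "r = frag_of A - (\<Sum>f\<in>#G. frag_of (src Mat_plus f))"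
  | A B where "obj_iso A B" "r = frag_of B - frag_of A"
proof -
  obtain A G where "(A, G) \<in> coverings Mat_iso" and r: "r = frag_of A - (\<Sum>f\<in>#G. frag_of (src Mat_iso f))"
    using assms unfolding K0_relations_def by blast
  then consider "(A, G) \<in> base_families" | f where "A = tgt Mat_plus f" "G = {#f#}" "iso_arr Mat_plus f"
    by auto
  then show thesis
  proof cases
    case 1
    then show thesis using r that(1) by simp
  next
    case 2
    then show thesis using r iso_arr_imp_obj_iso[of f] that(2) by simp
  qed
qed

lemma iso_relation_in_Mat_iso:
  assumes "M \<in> Mat_obs" "N \<in> Mat_obs" "matroid_iso M N"
  shows "frag_of (Some N) - frag_of (Some M) \<in> K0_relations Mat_iso"
proof -
  obtain a where a: "iso_arr Mat_plus a" "src Mat_plus a = Some M" "tgt Mat_plus a = Some N"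
    using matroid_iso_imp_iso_arr[OF assms] by blast
  then have "(tgt Mat_plus a, {#a#}) \<in> coverings Mat_iso" unfolding extend_Mat_plus_simps by blast
  then have "(Some N, {#a#}) \<in> coverings Mat_iso" by (simp only: a)
  then have "frag_of (Some N) - (\<Sum>f\<in>#{#a#}. frag_of (src Mat_iso f)) \<in> K0_relations Mat_iso"
    unfolding K0_relations_def by blast
  then show ?thesis using a by simp
qed

lemma obj_iso_obs: "obj_iso A B \<Longrightarrow> A \<in> obs Mat_plus \<and> B \<in> obs Mat_plus"
  by (auto simp: obj_iso_def Mat_plus_simps)

lemma keys_sum_mset_frag_of:
  "Poly_Mapping.keys (\<Sum>x\<in>#G. frag_of (f x)) \<subseteq> f ` set_mset G"
proof (induction G)
  case (add x G)
  then show ?case using keys_add[of "frag_of (f x)" "\<Sum>x\<in>#G. frag_of (f x)"] by (auto simp: keys_frag_of)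
qed simp

lemma keys_relation:
  assumes "A \<in> S" "\<And>x. x \<in># G \<Longrightarrow> f x \<in> S"
  shows "Poly_Mapping.keys (frag_of A - (\<Sum>x\<in>#G. frag_of (f x))) \<subseteq> S"
  using keys_diff[of "frag_of A" "\<Sum>x\<in>#G. frag_of (f x)"] keys_sum_mset_frag_of[of f G] assms
  by (auto simp: keys_frag_of)

interpretation iso: K0_presentation Mat_iso
proof
  fix r assume "r \<in> K0_relations Mat_iso"
  then show "Poly_Mapping.keys r \<subseteq> obs Mat_iso"
  proof (cases rule: K0_relations_Mat_iso_cases)
    case (1 A G)
    show ?thesis
      unfolding 1(2) using base_family_sources[OF 1(1)] by (intro keys_relation) (simp_all add: Mat_plus_simps)
  next
    case (2 A B)
    then show ?thesis using obj_iso_obs[OF 2(1)] keys_diff[of "frag_of B" "frag_of A"] by (auto simp: keys_frag_of)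
  qed
qed

lemma vanishes_on_Mat_iso_relations:
  assumes h: "additive h" "h (frag_of None) = 0"
    and iso: "\<And>M N. M \<in> Mat_obs \<Longrightarrow> N \<in> Mat_obs \<Longrightarrow> matroid_iso M N \<Longrightarrow> h (frag_of (Some M)) = h (frag_of (Some N))"
    and r: "r \<in> K0_relations Mat_iso"
  shows "h r = 0"
  using r
proof (cases rule: K0_relations_Mat_iso_cases)
  case (1 A G)
  then show ?thesis using base_relation_vanishes[OF h] by simp
next
  case (2 A B)
  then show ?thesis using iso by (auto simp: obj_iso_def additive.diff[OF h(1)])
qed

section \<open>Tutte coverings\<close>

lemma tree_cat_simps:
  "obs (tree_cat T) = T" "(w, v) \<in> arrs (tree_cat T) \<longleftrightarrow> w \<in> T \<and> v \<in> T \<and> prefix v w"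
  "src (tree_cat T) (w, v) = w" "tgt (tree_cat T) (w, v) = v" "ident (tree_cat T) v = (v, v)"
  "cmp (tree_cat T) (v', u) (w, v) = (w, u)"
  by (simp_all add: tree_cat_def)

lemma prefix_strict_child:
  assumes "prefix v w" "v \<noteq> w"
  shows "\<exists>b. prefix (v @ [b]) w"
proof -
  obtain zs where zs: "w = v @ zs" "zs \<noteq> []" using assms by (auto simp: prefix_def)
  then show ?thesis by (cases zs) (auto simp: prefix_def)
qed

lemma children_cases:
  obtains "children T v = {}" | w where "children T v = {w}" | w1 w2 where "w1 \<noteq> w2" "children T v = {w1, w2}"
proof -
  have "children T v \<subseteq> {v @ [False], v @ [True]}" by (auto simp: children_def)
  then have "children T v \<in> {{}, {v @ [False]}, {v @ [True]}, {v @ [False], v @ [True]}}" by blast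
  then show thesis using that by auto
qed

text \<open>Induction on the number of vertices at or below \<open>v\<close>. An only child carries
  the same object, two children carry the deletion and the contraction, and the leaves below
  \<open>v\<close> are distributed among its children.\<close>

lemma elementary_dc_tree_leaf_sum:
  fixes \<phi> :: "mat_ob \<Rightarrow> 'r::ab_group_add"
  assumes T: "binary_tree T" and G: "elementary_dc_tree T G"
    and dc: "\<And>M e. M \<in> Mat_obs \<Longrightarrow> nondegenerate M e \<Longrightarrow>
      \<phi> (Some M) = \<phi> (Some (deletion M e)) + \<phi> (Some (contraction M e))"
    and v: "v \<in> T"
  shows "\<phi> (on_obs G v) = (\<Sum>w | w \<in> leaves T \<and> prefix v w. \<phi> (on_obs G w))"
  using v
proof (induction "card {w \<in> T. prefix v w}" arbitrary: v rule: less_induct)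
  case less
  let ?S = "\<lambda>v. {w. w \<in> leaves T \<and> prefix v w}"
  have finT: "finite T" and down: "w \<in> T \<Longrightarrow> prefix u w \<Longrightarrow> u \<in> T" for u w
    using T by (auto simp: binary_tree_def)
  have finS: "finite (?S u)" for u by (rule finite_subset[OF _ finT]) (auto simp: leaves_def)
  have IH: "\<phi> (on_obs G c) = (\<Sum>w\<in>?S c. \<phi> (on_obs G w))" if c: "c \<in> children T v" for c
  proof (rule less.hyps)
    obtain b where "c = v @ [b]" "c \<in> T" using c by (auto simp: children_def)
    then have "{w \<in> T. prefix c w} \<subset> {w \<in> T. prefix v w}"
      using less.prems by (auto simp: prefix_def) 
    then show "card {w \<in> T. prefix c w} < card {w \<in> T. prefix v w}"
      using finT by (intro psubset_card_mono) auto
  qed (use c in \<open>simp add: children_def\<close>)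
  have below: "w = v \<or> (\<exists>c\<in>children T v. prefix c w)" if "w \<in> T" "prefix v w" for w
    using that prefix_strict_child[of v w] down by (auto simp: children_def)
  have split: "?S v = (\<Union>c\<in>children T v. ?S c)" if "children T v \<noteq> {}"
  proof (intro equalityI subsetI)
    fix w assume w: "w \<in> ?S v"
    then have "w \<noteq> v" "w \<in> T" using that by (auto simp: leaves_def)
    with w below show "w \<in> (\<Union>c\<in>children T v. ?S c)" by blast
  next
    fix w assume "w \<in> (\<Union>c\<in>children T v. ?S c)"
    then obtain b where "w \<in> leaves T" "prefix (v @ [b]) w" by (auto simp: children_def)
    then show "w \<in> ?S v" by (auto intro: append_prefixD)
  qed
  show ?case
  proof (cases rule: children_cases[of T v])
    case 1
    then have "?S v = {v}" using below less.prems by (auto simp: leaves_def)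
    then show ?thesis by simp
  next
    case (2 w)
    then have "on_obs G w = on_obs G v" using G less.prems by (auto simp: elementary_dc_tree_def)
    then show ?thesis using IH[of w] split 2 by simp
  next
    case (3 w1 w2)
    note G[unfolded elementary_dc_tree_def, THEN conjunct2, THEN conjunct2, THEN conjunct2,
        rule_format, OF less.prems conjI[OF 3]]
    then obtain N e where N: "on_obs G v = Some N" "nondegenerate N e"
      "(on_obs G w1 = Some (contraction N e) \<and> on_obs G w2 = Some (deletion N e)) \<or>
       (on_obs G w1 = Some (deletion N e) \<and> on_obs G w2 = Some (contraction N e))"
      by (elim exE conjE) assumption+
    have "on_obs G v \<in> obs Mat_plus"
      using G less.prems by (auto simp: elementary_dc_tree_def is_functor_def tree_cat_simps)
    then have "N \<in> Mat_obs" using N by (auto simp: Mat_plus_simps)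
    then have "\<phi> (on_obs G v) = \<phi> (on_obs G w1) + \<phi> (on_obs G w2)"
      using N dc[of N e] by (auto simp: add.commute)
    also have "\<dots> = (\<Sum>w\<in>?S w1. \<phi> (on_obs G w)) + (\<Sum>w\<in>?S w2. \<phi> (on_obs G w))"
      using IH 3 by simp
    also have "\<dots> = (\<Sum>w\<in>?S w1 \<union> ?S w2. \<phi> (on_obs G w))"
    proof (rule sum.union_disjoint[symmetric, OF finS finS])
      have "w1 \<in> children T v" "w2 \<in> children T v" using 3 by auto
      \<comment> \<open>Distinct children differ in the last step of their addresses, so no leaf
        lies below both.\<close>
      then obtain b1 b2 where "w1 = v @ [b1]" "w2 = v @ [b2]" unfolding children_def by blast
      moreover from this have "b1 \<noteq> b2" using 3(1) by auto
      ultimately show "?S w1 \<inter> ?S w2 = {}" by (auto simp: prefix_def)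
    qed
    also have "?S w1 \<union> ?S w2 = ?S v" using split 3 by simp
    finally show ?thesis .
  qed
qed

lemma obj_iso_naturally_isomorphic:
  assumes "naturally_isomorphic (tree_cat T) Mat_plus F G" "v \<in> T"
  shows "obj_iso (on_obs F v) (on_obs G v)"
  using assms iso_arr_imp_obj_iso unfolding naturally_isomorphic_def tree_cat_simps by metis

text \<open>A natural isomorphism changes each vertex only within its isomorphism class, so an
  invariant \<phi> has the same values on the elementary tree.\<close>

lemma dc_tree_leaf_sum:
  fixes \<phi> :: "mat_ob \<Rightarrow> 'r::ab_group_add"
  assumes T: "binary_tree T" and F: "dc_tree T F"
    and iso: "\<And>A B. obj_iso A B \<Longrightarrow> \<phi> A = \<phi> B"
    and dc: "\<And>M e. M \<in> Mat_obs \<Longrightarrow> nondegenerate M e \<Longrightarrow>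
      \<phi> (Some M) = \<phi> (Some (deletion M e)) + \<phi> (Some (contraction M e))"
  shows "\<phi> (on_obs F []) = (\<Sum>w\<in>leaves T. \<phi> (on_obs F w))"
proof -
  obtain G where G: "elementary_dc_tree T G" "naturally_isomorphic (tree_cat T) Mat_plus F G"
    using F by (auto simp: dc_tree_def)
  have eq: "\<phi> (on_obs F v) = \<phi> (on_obs G v)" if "v \<in> T" for v
    using obj_iso_naturally_isomorphic[OF G(2) that] by (rule iso)
  have root: "[] \<in> T" using T by (simp add: binary_tree_def)
  have "\<phi> (on_obs F []) = \<phi> (on_obs G [])" by (rule eq[OF root])
  also have "\<dots> = (\<Sum>w | w \<in> leaves T \<and> prefix [] w. \<phi> (on_obs G w))"
    by (rule elementary_dc_tree_leaf_sum[of T G \<phi>, OF T G(1) dc root])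
  also have "\<dots> = (\<Sum>w\<in>leaves T. \<phi> (on_obs F w))"
    by (intro sum.cong) (auto simp: eq leaves_def)
  finally show ?thesis .
qed

lemma dc_tree_source:
  assumes "binary_tree T" "dc_tree T F" "v \<in> T"
  shows "src Mat_plus (on_arrs F (v, [])) = on_obs F v" "on_obs F v \<in> obs Mat_plus"
proof -
  have F: "is_functor (tree_cat T) Mat_plus F" using assms by (simp add: dc_tree_def)
  then show "on_obs F v \<in> obs Mat_plus" using assms by (simp add: is_functor_def tree_cat_simps)
  have "(v, []) \<in> arrs (tree_cat T)" using assms by (simp add: tree_cat_simps binary_tree_def)
  moreover have "\<forall>f\<in>arrs (tree_cat T). src Mat_plus (on_arrs F f) = on_obs F (src (tree_cat T) f)"
    using F unfolding is_functor_def by blast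
  ultimately have "src Mat_plus (on_arrs F (v, [])) = on_obs F (src (tree_cat T) (v, []))" by blast
  then show "src Mat_plus (on_arrs F (v, [])) = on_obs F v" by (simp add: tree_cat_simps)
qed

lemma leaf_to_root_sum:
  fixes \<phi> :: "mat_ob \<Rightarrow> 'r::ab_group_add"
  assumes "binary_tree T" "dc_tree T F"
  shows "(\<Sum>f\<in>#leaf_to_root T F. \<phi> (src Mat_plus f)) = (\<Sum>w\<in>leaves T. \<phi> (on_obs F w))"
proof -
  have "(\<Sum>f\<in>#leaf_to_root T F. \<phi> (src Mat_plus f)) = (\<Sum>w\<in>leaves T. \<phi> (src Mat_plus (on_arrs F (w, []))))"
    by (simp add: leaf_to_root_def sum_unfold_sum_mset image_mset.compositionality comp_def)
  also have "\<dots> = (\<Sum>w\<in>leaves T. \<phi> (on_obs F w))"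
    using dc_tree_source(1)[OF assms] by (intro sum.cong) (auto simp: leaves_def)
  finally show ?thesis .
qed

lemma K0_relations_Mat_tc_cases:
  assumes "r \<in> K0_relations Mat_tc"
  obtains A G where "(A, G) \<in> base_families" "r = frag_of A - (\<Sum>f\<in>#G. frag_of (src Mat_plus f))"
  | T F where "binary_tree T" "dc_tree T F"
      "r = frag_of (on_obs F []) - (\<Sum>f\<in>#leaf_to_root T F. frag_of (src Mat_plus f))"
proof -
  obtain A G where AG: "(A, G) \<in> coverings Mat_tc" and r: "r = frag_of A - (\<Sum>f\<in>#G. frag_of (src Mat_tc f))"
    using assms unfolding K0_relations_def by blast
  from AG consider "(A, G) \<in> base_families"
    | M T F where "A = Some M" "G = leaf_to_root T F" "binary_tree T" "dc_tree T F" "on_obs F [] = Some M"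
    unfolding extend_Mat_plus_simps by blast
  then show thesis
  proof cases
    case 1
    show thesis by (rule that(1)[OF 1]) (simp add: r)
  next
    case 2
    show thesis by (rule that(2)[OF 2(3,4)]) (simp add: r 2)
  qed
qed

interpretation tc: K0_presentation Mat_tc
proof
  fix r assume "r \<in> K0_relations Mat_tc"
  then show "Poly_Mapping.keys r \<subseteq> obs Mat_tc"
  proof (cases rule: K0_relations_Mat_tc_cases)
    case (1 A G)
    show ?thesis
      unfolding 1(2) using base_family_sources[OF 1(1)] by (intro keys_relation) (simp_all add: Mat_plus_simps)
  next
    case (2 T F)
    have "finite (leaves T)" "[] \<in> T" using 2(1) by (auto simp: binary_tree_def leaves_def)
    then show ?thesis
      unfolding 2(3) using dc_tree_source[OF 2(1,2)]
      by (intro keys_relation) (auto simp: leaf_to_root_def leaves_def)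
  qed
qed

text \<open>The relation of an arbitrary Tutte covering is a consequence of single
  deletion-contraction steps and isomorphisms, so only these have to be tested.\<close>

lemma vanishes_on_Mat_tc_relations:
  assumes h: "additive h" "h (frag_of None) = 0"
    and iso: "\<And>M N. M \<in> Mat_obs \<Longrightarrow> N \<in> Mat_obs \<Longrightarrow> matroid_iso M N \<Longrightarrow> h (frag_of (Some M)) = h (frag_of (Some N))"
    and dc: "\<And>M e. M \<in> Mat_obs \<Longrightarrow> nondegenerate M e \<Longrightarrow>
      h (frag_of (Some M)) = h (frag_of (Some (deletion M e))) + h (frag_of (Some (contraction M e)))"
    and r: "r \<in> K0_relations Mat_tc"
  shows "h r = 0"
  using r
proof (cases rule: K0_relations_Mat_tc_cases)
  case (1 A G)
  then show ?thesis using base_relation_vanishes[OF h] by simp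
next
  case (2 T F)
  have "h (frag_of A) = h (frag_of B)" if "obj_iso A B" for A B
    using that iso by (auto simp: obj_iso_def)
  from dc_tree_leaf_sum[OF 2(1,2), of "\<lambda>A. h (frag_of A)", OF this dc]
  have "h (frag_of (on_obs F [])) = (\<Sum>w\<in>leaves T. h (frag_of (on_obs F w)))" by blast
  then show ?thesis
    using leaf_to_root_sum[OF 2(1,2), of "\<lambda>A. h (frag_of A)"]
    by (simp add: 2(3) additive.diff[OF h(1)] additive_sum_mset[OF h(1)])
qed

section \<open>Explicit Tutte coverings: one deletion-contraction step, and isomorphisms\<close>

lemma naturally_isomorphic_refl:
  assumes F: "is_functor (tree_cat T) Mat_plus F"
  shows "naturally_isomorphic (tree_cat T) Mat_plus F F"
  unfolding naturally_isomorphic_def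
proof (intro exI[of _ "\<lambda>v. incl (on_obs F v) (on_obs F v)"] conjI ballI)
  fix v assume "v \<in> obs (tree_cat T)"
  then have "on_obs F v \<in> obs Mat_plus" using F by (simp add: is_functor_def)
  then show "iso_arr Mat_plus (incl (on_obs F v) (on_obs F v))" by (rule iso_arr_ident)
next
  fix f assume f: "f \<in> arrs (tree_cat T)"
  then have a: "on_arrs F f \<in> arrs Mat_plus"
    "src Mat_plus (on_arrs F f) = on_obs F (src (tree_cat T) f)"
    "tgt Mat_plus (on_arrs F f) = on_obs F (tgt (tree_cat T) f)" using F by (auto simp: is_functor_def)
  show "cmp Mat_plus (on_arrs F f) (incl (on_obs F (src (tree_cat T) f)) (on_obs F (src (tree_cat T) f))) =
      cmp Mat_plus (incl (on_obs F (tgt (tree_cat T) f)) (on_obs F (tgt (tree_cat T) f))) (on_arrs F f)"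
    using Mat_ident_laws[OF a(1)] a(2,3) by simp
qed simp_all

lemma elementary_imp_dc_tree: "elementary_dc_tree T F \<Longrightarrow> dc_tree T F"
  using naturally_isomorphic_refl unfolding dc_tree_def elementary_dc_tree_def by blast

lemma dc_tree_relation:
  assumes "binary_tree T" "dc_tree T F" "on_obs F [] = Some M"
  shows "frag_of (Some M) - (\<Sum>w\<in>leaves T. frag_of (on_obs F w)) \<in> K0_relations Mat_tc"
proof -
  have "(Some M, leaf_to_root T F) \<in> coverings Mat_tc" using assms by auto
  then have "frag_of (Some M) - (\<Sum>f\<in>#leaf_to_root T F. frag_of (src Mat_tc f)) \<in> K0_relations Mat_tc"
    unfolding K0_relations_def by blast
  then show ?thesis using leaf_to_root_sum[OF assms(1,2), of frag_of] by simp
qed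

lemma incl_is_functor:
  assumes ob: "\<And>v. v \<in> T \<Longrightarrow> P v \<in> obs Mat_plus"
    and arr: "\<And>v w. v \<in> T \<Longrightarrow> w \<in> T \<Longrightarrow> prefix v w \<Longrightarrow> incl (P w) (P v) \<in> arrs Mat_plus"
  shows "is_functor (tree_cat T) Mat_plus \<lparr>on_obs = P, on_arrs = \<lambda>(w, v). incl (P w) (P v)\<rparr>"
proof -
  have "elements (P w) \<subseteq> elements (P v)" if "v \<in> T" "w \<in> T" "prefix v w" for v w
    using arr[OF that] by (cases rule: Mat_arr_cases) (auto simp: incl_def elements_def)
  then show ?thesis
    using ob arr unfolding is_functor_def
    by (auto simp: tree_cat_simps) (auto simp: Mat_plus_simps(4) cmp_incl)
qed

lemma deletion_in_Mat_obs: "M \<in> Mat_obs \<Longrightarrow> deletion M e \<in> Mat_obs"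
  using is_matroid_deletion[of M e] by (auto simp: Mat_obs_def)

lemma contraction_in_Mat_obs: "M \<in> Mat_obs \<Longrightarrow> {e} \<in> indeps M \<Longrightarrow> contraction M e \<in> Mat_obs"
  using is_matroid_contraction[of M e] by (auto simp: Mat_obs_def)

lemma nondegenerate_indep: "nondegenerate M e \<Longrightarrow> {e} \<in> indeps M"
  by (auto simp: nondegenerate_def loop_def)

lemma deletion_contraction_relation:
  assumes M: "M \<in> Mat_obs" and e: "nondegenerate M e"
  shows "frag_of (Some M) - (frag_of (Some (deletion M e)) + frag_of (Some (contraction M e))) \<in> K0_relations Mat_tc"
proof -
  let ?T = "{[], [False], [True]}"
  let ?O = "\<lambda>v. if v = [] then Some M else if v = [False] then Some (deletion M e) else Some (contraction M e)"
  let ?F = "\<lparr>on_obs = ?O, on_arrs = \<lambda>(w, v). incl (?O w) (?O v)\<rparr>"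
  have D: "deletion M e \<in> Mat_obs" and C: "contraction M e \<in> Mat_obs"
    using M e by (auto intro: deletion_in_Mat_obs contraction_in_Mat_obs nondegenerate_indep)
  have T: "binary_tree ?T" by (auto simp: binary_tree_def prefix_Cons)
  have ch: "children ?T [] = {[False], [True]}" "children ?T [b] = {}" for b by (auto simp: children_def)
  have "is_functor (tree_cat ?T) Mat_plus ?F"
  proof (rule incl_is_functor)
    show "?O v \<in> obs Mat_plus" if "v \<in> ?T" for v using M D C by (simp add: Mat_plus_simps)
    have "incl (Some (deletion M e)) (Some M) \<in> arrs Mat_plus"
      using M D by (intro incl_in_arrs) (auto simp: indeps_deletion[OF Mat_obsD(1)[OF M]])
    moreover have "incl (Some (contraction M e)) (Some M) \<in> arrs Mat_plus"
    proof (intro incl_in_arrs M C)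
      \<comment> \<open>An independent set of the contraction is contained in one of
        \<open>M\<close>, namely itself together with \<open>e\<close>; this makes the standard
        inclusion a morphism.\<close>
      show "indeps (contraction M e) \<subseteq> indeps M"
        using is_matroid_down[OF Mat_obsD(1)[OF M], OF _ subset_insertI]
        by (auto simp: indeps_contraction[OF Mat_obsD(1)[OF M]])
    qed auto
    moreover have "incl (Some N) (Some N) \<in> arrs Mat_plus" if "N \<in> Mat_obs" for N
      using that by (intro ident_in_arrs) (simp add: Mat_plus_simps)
    ultimately show "incl (?O w) (?O v) \<in> arrs Mat_plus" if "v \<in> ?T" "w \<in> ?T" "prefix v w" for v w
      using that M D C by auto
  qed
  moreover have "\<exists>N e. on_obs ?F v = Some N \<and> nondegenerate N e \<and>
      ((on_obs ?F w1 = Some (contraction N e) \<and> on_obs ?F w2 = Some (deletion N e)) \<or>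
       (on_obs ?F w1 = Some (deletion N e) \<and> on_obs ?F w2 = Some (contraction N e))) \<and>
      on_arrs ?F (w1, v) = incl (on_obs ?F w1) (Some N) \<and> on_arrs ?F (w2, v) = incl (on_obs ?F w2) (Some N)"
    if "v \<in> ?T" "w1 \<noteq> w2" "children ?T v = {w1, w2}" for v w1 w2
  proof -
    have v: "v = []" using that(1,3) ch(2)[of False] ch(2)[of True] by auto
    have "{w1, w2} = {[False], [True]}" using that(3) ch(1) unfolding v by simp
    then have w: "w1 = [False] \<and> w2 = [True] \<or> w1 = [True] \<and> w2 = [False]"
      by (simp add: doubleton_eq_iff)
    show ?thesis
    proof (intro exI[of _ M] exI[of _ e] conjI)
      show "(on_obs ?F w1 = Some (contraction M e) \<and> on_obs ?F w2 = Some (deletion M e)) \<or>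
          (on_obs ?F w1 = Some (deletion M e) \<and> on_obs ?F w2 = Some (contraction M e))"
        using w by (elim disjE conjE) simp_all
    qed (simp_all add: v e)
  qed
  moreover have "children ?T v \<noteq> {w}" if "v \<in> ?T" for v w
  proof
    assume w: "children ?T v = {w}"
    then have "v = []" using that ch(2)[of False] ch(2)[of True] by auto
    then have "[False] \<in> {w}" "[True] \<in> {w}" using w ch(1) by blast+
    then show False by auto
  qed
  moreover have "on_obs ?F [] \<noteq> None" by simp
  ultimately have "elementary_dc_tree ?T ?F" unfolding elementary_dc_tree_def by blast
  from dc_tree_relation[OF T elementary_imp_dc_tree[OF this], of M]
  have "frag_of (Some M) - (\<Sum>w\<in>leaves ?T. frag_of (?O w)) \<in> K0_relations Mat_tc" by simp
  moreover have "leaves ?T = {[False], [True]}" using ch by (auto simp: leaves_def)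
  ultimately show ?thesis by simp
qed

text \<open>Isomorphisms enter the Tutte coverings only through natural isomorphism of trees. The
  tree with one edge carries the constant elementary functor \<open>?G\<close> at \<open>N\<close>;
  replacing its leaf by \<open>M\<close> and its edge by \<open>a\<close> gives \<open>?F\<close>,
  and \<open>a\<close> at the leaf is the natural isomorphism.\<close>

lemma iso_relation_in_Mat_tc:
  assumes M: "M \<in> Mat_obs" and N: "N \<in> Mat_obs" and iso: "matroid_iso M N"
  shows "frag_of (Some N) - frag_of (Some M) \<in> K0_relations Mat_tc"
proof -
  obtain a where a: "iso_arr Mat_plus a" "src Mat_plus a = Some M" "tgt Mat_plus a = Some N"
    using matroid_iso_imp_iso_arr[OF assms] by blast
  then have a_arr: "a \<in> arrs Mat_plus" by (simp add: iso_arr_def)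
  let ?T = "{[], [False]}"
  let ?F = "\<lparr>on_obs = \<lambda>v. if v = [] then Some N else Some M,
    on_arrs = \<lambda>(w, v). if w = [] then incl (Some N) (Some N) else if v = [] then a else incl (Some M) (Some M)\<rparr>"
  let ?G = "\<lparr>on_obs = \<lambda>v. Some N, on_arrs = \<lambda>(w, v). incl (Some N) (Some N)\<rparr>"
  have T: "binary_tree ?T" by (auto simp: binary_tree_def prefix_Cons)
  have ch: "children ?T [] = {[False]}" "children ?T [False] = {}" by (auto simp: children_def)
  have MN: "Some M \<in> obs Mat_plus" "Some N \<in> obs Mat_plus" using M N by (auto simp: Mat_plus_simps)
  note ids = ident_in_arrs[OF MN(1)] ident_in_arrs[OF MN(2)]
  note laws = Mat_ident_laws[OF a_arr, unfolded a]
  have G: "is_functor (tree_cat ?T) Mat_plus ?G"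
    using incl_is_functor[of ?T "\<lambda>v. Some N"] MN ids by auto
  have "elementary_dc_tree ?T ?G"
    unfolding elementary_dc_tree_def using G ch by (auto simp: Mat_plus_simps)
  moreover have F: "is_functor (tree_cat ?T) Mat_plus ?F"
    unfolding is_functor_def using MN ids a a_arr laws
    by (auto simp: tree_cat_simps Mat_plus_simps(4) cmp_incl)
  moreover have "naturally_isomorphic (tree_cat ?T) Mat_plus ?F ?G"
    unfolding naturally_isomorphic_def
    using a laws iso_arr_ident[OF MN(2)]
    by (intro exI[of _ "\<lambda>v. if v = [] then incl (Some N) (Some N) else a"]) (auto simp: tree_cat_simps)
  ultimately have "dc_tree ?T ?F" unfolding dc_tree_def by blast
  from dc_tree_relation[OF T this, of N]
  have "frag_of (Some N) - (\<Sum>w\<in>leaves ?T. frag_of (on_obs ?F w)) \<in> K0_relations Mat_tc" by simp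
  moreover have "leaves ?T = {[False]}" using ch by (auto simp: leaves_def)
  ultimately show ?thesis by simp
qed

section \<open>\<open>K\<^sub>0(Mat\<^sup>t\<^sup>c)\<close> and the Tutte polynomial\<close>

text \<open>An additive map out of polynomials, prescribed coefficientwise; nesting it twice handles
  the polynomials in y whose coefficients are polynomials in x.\<close>

definition poly_sum :: "(nat \<Rightarrow> 'a::zero \<Rightarrow> 'b::ab_group_add) \<Rightarrow> 'a poly \<Rightarrow> 'b" where
  "poly_sum f p = (\<Sum>n\<le>degree p. f n (coeff p n))"

text \<open>The degree may drop in a sum of polynomials, so additivity needs a common summation
  bound.\<close>

lemma poly_sum_bound:
  fixes f :: "nat \<Rightarrow> 'a::ab_group_add \<Rightarrow> 'b::ab_group_add"
  assumes "\<And>n. additive (f n)" "degree p \<le> N"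
  shows "poly_sum f p = (\<Sum>n\<le>N. f n (coeff p n))"
  unfolding poly_sum_def using assms(2)
  by (intro sum.mono_neutral_left) (auto simp: additive.zero[OF assms(1)] coeff_eq_0)

lemma additive_poly_sum:
  fixes f :: "nat \<Rightarrow> 'a::ab_group_add \<Rightarrow> 'b::ab_group_add"
  assumes f: "\<And>n. additive (f n)"
  shows "additive (poly_sum f)"
proof
  fix p q :: "'a poly"
  let ?N = "max (degree p) (degree q)"
  have "degree (p + q) \<le> ?N" by (rule degree_add_le_max)
  then show "poly_sum f (p + q) = poly_sum f p + poly_sum f q"
    by (simp add: poly_sum_bound[OF f, of _ ?N] additive.add[OF f] sum.distrib)
qed

lemma poly_sum_monom:
  fixes f :: "nat \<Rightarrow> 'a::ab_group_add \<Rightarrow> 'b::ab_group_add"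
  assumes f: "\<And>n. additive (f n)"
  shows "poly_sum f (monom c n) = f n c"
proof -
  have "poly_sum f (monom c n) = (\<Sum>k\<le>n. f k (coeff (monom c n) k))"
    by (rule poly_sum_bound[OF f degree_monom_le])
  also have "\<dots> = (\<Sum>k\<le>n. if k = n then f k c else 0)"
    by (intro sum.cong) (auto simp: additive.zero[OF f])
  finally show ?thesis by simp
qed

lemma var_x_power_mult_var_y_power: "var_x ^ m * var_y ^ n = monom (monom 1 m) n"
proof -
  have x: "var_x = monom (monom 1 1) 0" and y: "var_y = monom 1 1"
    by (simp_all add: var_x_def var_y_def monom_altdef)
  show ?thesis unfolding x y by (simp add: monom_power mult_monom)
qed

text \<open>The additive section of the Tutte map: the coefficient of x^m y^n becomes the
  coefficient of \<open>monomial_matroid m n\<close>.\<close>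

definition poly_frag :: "int poly poly \<Rightarrow> (mat_ob \<Rightarrow>\<^sub>0 int)" where
  "poly_frag = poly_sum (\<lambda>n. poly_sum (\<lambda>m c. frag_cmul c (frag_of (Some (monomial_matroid m n)))))"

lemma additive_frag_cmul: "additive (\<lambda>c. frag_cmul c a)"
  by unfold_locales (rule frag_cmul_distrib)

lemma additive_poly_frag: "additive poly_frag"
  unfolding poly_frag_def by (intro additive_poly_sum additive_frag_cmul)

lemma poly_frag_monomial: "poly_frag (var_x ^ m * var_y ^ n) = frag_of (Some (monomial_matroid m n))"
  unfolding poly_frag_def var_x_power_mult_var_y_power
  by (simp add: poly_sum_monom additive_poly_sum additive_frag_cmul)

lemma keys_sum_subset:
  assumes "\<And>i. i \<in> I \<Longrightarrow> Poly_Mapping.keys (f i) \<subseteq> S"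
  shows "Poly_Mapping.keys (sum f I :: _ \<Rightarrow>\<^sub>0 int) \<subseteq> S"
  using sum_closed_free_Abelian_group[of I f S] assms by simp

lemma keys_poly_frag: "Poly_Mapping.keys (poly_frag p) \<subseteq> obs Mat_plus"
  unfolding poly_frag_def poly_sum_def
  using monomial_matroid_in_Mat_obs keys_cmul
  by (intro keys_sum_subset) (fastforce simp: Mat_plus_simps keys_frag_of)

definition tutte_ob :: "mat_ob \<Rightarrow> int poly poly" where
  "tutte_ob A = (case A of None \<Rightarrow> 0 | Some M \<Rightarrow> tutte M)"

definition tutte_frag :: "(mat_ob \<Rightarrow>\<^sub>0 int) \<Rightarrow> int poly poly" where
  "tutte_frag = frag_lift tutte_ob"

lemma additive_tutte_frag: "additive tutte_frag"
  unfolding tutte_frag_def by (rule additive_frag_lift)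

lemma tutte_frag_of: "tutte_frag (frag_of None) = 0" "tutte_frag (frag_of (Some M)) = tutte M"
  by (simp_all add: tutte_frag_def tutte_ob_def)

lemma tutte_nondegenerate:
  assumes M: "M \<in> Mat_obs" and e: "nondegenerate M e"
  shows "tutte M = tutte (deletion M e) + tutte (contraction M e)"
  using rank_poly_nondegenerate[OF Mat_obsD(1)[OF M] e]
    is_matroid_deletion[OF Mat_obsD(1)[OF M]] is_matroid_contraction[OF Mat_obsD(1)[OF M] nondegenerate_indep[OF e]]
  by (simp add: tutte_eq_rank_poly Mat_obsD(1)[OF M])

lemma tutte_frag_Mat_tc: "r \<in> K0_relations Mat_tc \<Longrightarrow> tutte_frag r = 0"
  by (rule vanishes_on_Mat_tc_relations[OF additive_tutte_frag])
    (auto simp: tutte_frag_of intro: tutte_iso Mat_obsD tutte_nondegenerate)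

lemma tutte_frag_Mat_iso: "r \<in> K0_relations Mat_iso \<Longrightarrow> tutte_frag r = 0"
  by (rule vanishes_on_Mat_iso_relations[OF additive_tutte_frag])
    (auto simp: tutte_frag_of intro: tutte_iso Mat_obsD)

text \<open>One half of the inversion, giving surjectivity of \<rho>: the Tutte polynomials of the
  split matroids are the monomials, so the polynomial is reassembled from its coefficients.\<close>

lemma tutte_frag_poly_frag: "tutte_frag (poly_frag p) = p"
proof -
  have *: "tutte_frag (frag_cmul c (frag_of (Some (monomial_matroid m n)))) = monom (monom c m) n" for c m n
  proof -
    have "tutte_frag (frag_cmul c (frag_of (Some (monomial_matroid m n)))) =
        of_int c * tutte (monomial_matroid m n)"
      unfolding tutte_frag_def
      by (subst frag_lift_superset[of "{Some (monomial_matroid m n)}"]) (auto simp: tutte_ob_def keys_frag_of)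
    then show ?thesis
      by (simp add: tutte_monomial_matroid var_x_power_mult_var_y_power of_int_poly smult_monom)
  qed
  show ?thesis
    unfolding poly_frag_def poly_sum_def additive.sum[OF additive_tutte_frag] * monom_sum[symmetric]
      poly_as_sum_of_monoms ..
qed

section \<open>Reduction of classes in \<open>K0 Mat_tc\<close>\<close>

lemma K0_class_None_tc: "K0_class Mat_tc None = \<one>\<^bsub>K0 Mat_tc\<^esub>"
proof -
  have "frag_of None - 0 \<in> tc.H" using tc.H_relation[OF base_family_relation(2)] by simp
  then show ?thesis
    unfolding tc.K0_class_eq tc.cls_zero[symmetric] by (subst tc.cls_eq_iff) (simp_all add: Mat_plus_simps keys_frag_of)
qed

lemma K0_class_None_iso: "K0_class Mat_iso None = \<one>\<^bsub>K0 Mat_iso\<^esub>"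
proof -
  have "frag_of None - 0 \<in> iso.H" using iso.H_relation[OF base_family_relation(1)] by simp
  then show ?thesis
    unfolding iso.K0_class_eq iso.cls_zero[symmetric] by (subst iso.cls_eq_iff) (simp_all add: Mat_plus_simps keys_frag_of)
qed

lemma K0_class_tc_iso:
  assumes "M \<in> Mat_obs" "N \<in> Mat_obs" "matroid_iso M N"
  shows "K0_class Mat_tc (Some M) = K0_class Mat_tc (Some N)"
  unfolding tc.K0_class_eq
  using tc.H_relation[OF iso_relation_in_Mat_tc[OF assms(2,1) matroid_iso_sym[OF assms(3)]]] assms
  by (subst tc.cls_eq_iff) (simp_all add: Mat_plus_simps keys_frag_of)

lemma K0_class_tc_deletion_contraction:
  assumes M: "M \<in> Mat_obs" and e: "nondegenerate M e"
  shows "K0_class Mat_tc (Some M) =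
    K0_class Mat_tc (Some (deletion M e)) \<otimes>\<^bsub>K0 Mat_tc\<^esub> K0_class Mat_tc (Some (contraction M e))"
proof -
  have obs: "Poly_Mapping.keys (frag_of (Some M)) \<subseteq> obs Mat_tc"
    "Poly_Mapping.keys (frag_of (Some (deletion M e))) \<subseteq> obs Mat_tc"
    "Poly_Mapping.keys (frag_of (Some (contraction M e))) \<subseteq> obs Mat_tc"
    using deletion_in_Mat_obs[OF M] contraction_in_Mat_obs[OF M nondegenerate_indep[OF e]] M
    by (simp_all add: Mat_plus_simps keys_frag_of)
  show ?thesis
    unfolding tc.K0_class_eq tc.cls_add[OF obs(2,3)]
    using tc.H_relation[OF deletion_contraction_relation[OF M e]] obs(1) keys_add_subset[OF obs(2,3)]
    by (subst tc.cls_eq_iff) simp_all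
qed

text \<open>Deletion-contraction reduces every class to classes of matroids \<open>\<epsilon>\<^sup>m \<oplus> \<sigma>\<^sup>n\<close>.\<close>

lemma hom_eq_on_K0_Mat_tc:
  assumes f: "f \<in> hom (K0 Mat_tc) G" and g: "g \<in> hom (K0 Mat_tc) G" and G: "group G"
    and eq: "\<And>m n. f (K0_class Mat_tc (Some (monomial_matroid m n))) = g (K0_class Mat_tc (Some (monomial_matroid m n)))"
    and U: "U \<in> carrier (K0 Mat_tc)"
  shows "f U = g U"
proof (rule tc.hom_eq_on_K0[OF f g G _ U])
  have mat: "f (K0_class Mat_tc (Some M)) = g (K0_class Mat_tc (Some M))" if "M \<in> Mat_obs" for M
    using that
  proof (induction "card (ground M)" arbitrary: M rule: less_induct)
    case less
    show ?case
    proof (cases "\<exists>e. nondegenerate M e")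
      case True
      then obtain e where e: "nondegenerate M e" by blast
      have DC: "deletion M e \<in> Mat_obs" "contraction M e \<in> Mat_obs"
        using less.prems e by (auto intro: deletion_in_Mat_obs contraction_in_Mat_obs nondegenerate_indep)
      have "e \<in> ground M" "finite (ground M)"
        using e is_matroid_finite[OF Mat_obsD(1)[OF less.prems]] by (simp_all add: nondegenerate_def)
      then have "card (ground M - {e}) < card (ground M)" by (rule card_Diff1_less[rotated])
      then have "f (K0_class Mat_tc (Some (deletion M e))) = g (K0_class Mat_tc (Some (deletion M e)))"
        "f (K0_class Mat_tc (Some (contraction M e))) = g (K0_class Mat_tc (Some (contraction M e)))"
        using DC by (auto intro: less.hyps)
      moreover have "K0_class Mat_tc (Some (deletion M e)) \<in> carrier (K0 Mat_tc)"
        "K0_class Mat_tc (Some (contraction M e)) \<in> carrier (K0 Mat_tc)"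
        using DC by (auto intro!: tc.K0_class_in_K0 simp: Mat_plus_simps)
      ultimately show ?thesis
        unfolding K0_class_tc_deletion_contraction[OF less.prems e]
        using f g by (simp add: hom_def)
    next
      case False
      then obtain m n where "split_type M m n" using split_type_degenerate[OF Mat_obsD(1)[OF less.prems]] by blast
      then have "K0_class Mat_tc (Some M) = K0_class Mat_tc (Some (monomial_matroid m n))"
        using split_type_monomial_matroid by (intro K0_class_tc_iso less.prems monomial_matroid_in_Mat_obs split_type_iso)
      then show ?thesis using eq by simp
    qed
  qed
  fix A assume "A \<in> obs Mat_tc"
  then consider "A = None" | M where "A = Some M" "M \<in> Mat_obs" by (auto simp: Mat_plus_simps)
  then show "f (K0_class Mat_tc A) = g (K0_class Mat_tc A)"
  proof cases
    case 1
    then show ?thesis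
      using group_hom.hom_one[of "K0 Mat_tc" G f] group_hom.hom_one[of "K0 Mat_tc" G g] f g G tc.group_K0
      by (simp add: K0_class_None_tc group_hom_def group_hom_axioms_def)
  qed (simp add: mat)
qed

abbreviation tutte_tc where "tutte_tc \<equiv> tc.lift tutte_frag"

lemmas tutte_tc_cls = tc.lift_cls[OF additive_tutte_frag tutte_frag_Mat_tc]
lemmas tutte_tc_add = tc.lift_add[OF additive_tutte_frag tutte_frag_Mat_tc]
lemmas tutte_tc_class = tc.lift_K0_class[OF additive_tutte_frag tutte_frag_Mat_tc]

lemma monomial_in_obs: "Some (monomial_matroid m n) \<in> obs Mat_plus"
  using monomial_matroid_in_Mat_obs by (simp add: Mat_plus_simps)

text \<open>The other half, giving injectivity: the composite and the identity are endomorphisms of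
  \<open>K0 Mat_tc\<close> that agree on the split matroids, to whose classes deletion-contraction
  reduces everything.\<close>

lemma cls_poly_frag_tutte_tc:
  assumes "U \<in> carrier (K0 Mat_tc)"
  shows "tc.cls (poly_frag (tutte_tc U)) = U"
proof (rule hom_eq_on_K0_Mat_tc[of "\<lambda>U. tc.cls (poly_frag (tutte_tc U))" _ "\<lambda>U. U", OF _ _ tc.group_K0 _ assms])
  show "(\<lambda>U. tc.cls (poly_frag (tutte_tc U))) \<in> hom (K0 Mat_tc) (K0 Mat_tc)"
    by (rule homI) (simp_all add: tc.cls_in_K0 tc.cls_add keys_poly_frag tutte_tc_add additive.add[OF additive_poly_frag])
  show "(\<lambda>U. U) \<in> hom (K0 Mat_tc) (K0 Mat_tc)" by (simp add: hom_def)
  show "tc.cls (poly_frag (tutte_tc (K0_class Mat_tc (Some (monomial_matroid m n))))) =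
      K0_class Mat_tc (Some (monomial_matroid m n))" for m n
    by (simp add: tutte_tc_class monomial_in_obs tutte_frag_of tutte_monomial_matroid poly_frag_monomial)
      (simp add: tc.K0_class_eq)
qed

section \<open>The ring structure for Tutte coverings and the map \<rho>\<close>

lemma osum_closed: "A \<in> obs Mat_plus \<Longrightarrow> B \<in> obs Mat_plus \<Longrightarrow> osum A B \<in> obs Mat_plus"
  by (auto simp: Mat_plus_simps osum_def Mat_sum_in_Mat_obs)

lemma empty_in_obs: "Some empty_matroid \<in> obs Mat_plus"
  using empty_matroid_in_Mat_obs by (simp add: Mat_plus_simps)

lemma tutte_frag_osum:
  "A \<in> obs Mat_plus \<Longrightarrow> B \<in> obs Mat_plus \<Longrightarrow>
    tutte_frag (frag_of (osum A B)) = tutte_frag (frag_of A) * tutte_frag (frag_of B)"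
  by (auto simp: Mat_plus_simps osum_def tutte_frag_of tutte_Mat_sum)

interpretation tc: K0_embedding Mat_tc tutte_frag osum "Some empty_matroid"
proof
  fix a assume a: "Poly_Mapping.keys a \<subseteq> obs Mat_tc" "tutte_frag a = 0"
  \<comment> \<open>A combination with zero Tutte polynomial has the class of
    \<open>poly_frag 0\<close>, hence the trivial class, so it lies in the subgroup of
    relations.\<close>
  then have "tc.cls a = tc.cls 0"
    using cls_poly_frag_tutte_tc[of "tc.cls a"]
    by (simp add: tc.cls_in_K0 tutte_tc_cls additive.zero[OF additive_poly_frag])
  then have "a \<in> tc.H" using a by (subst (asm) tc.cls_eq_iff) simp_all
  then show "a \<in> generate (free_Abelian_group (obs Mat_tc)) (K0_relations Mat_tc)" by (simp add: tc.H_def)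
qed (simp_all add: additive.add[OF additive_tutte_frag] tutte_frag_Mat_tc osum_closed empty_in_obs tutte_frag_osum
    tutte_frag_of tutte_empty)

abbreviation Zxy_group where "Zxy_group \<equiv> add_monoid Zxy"

lemma group_Zxy: "group Zxy_group"
  using abelian_group.a_group[OF ring.is_abelian_group] cring.axioms(1)[OF cring_class] by blast

lemma Zxy_simps: "carrier Zxy = UNIV" "p \<otimes>\<^bsub>Zxy\<^esub> q = p * q" "p \<oplus>\<^bsub>Zxy\<^esub> q = p + q" "\<one>\<^bsub>Zxy\<^esub> = 1"
  by (simp_all add: cring_class_ops_def)

lemma rho_eq: "\<rho> = tutte_tc"
  unfolding \<rho>_def
proof (rule the_map_with_eqI)
  have hom: "tutte_tc \<in> hom (K0 Mat_tc) Zxy_group"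
    by (rule homI) (simp_all add: Zxy_simps tutte_tc_add)
  moreover have "inj_on tutte_tc (carrier (K0 Mat_tc))" by (rule inj_onI) (rule tc.\<Theta>_inj)
  moreover have "UNIV \<subseteq> tutte_tc ` carrier (K0 Mat_tc)"
  proof
    fix p :: "int poly poly"
    have "p = tutte_tc (tc.cls (poly_frag p))" by (simp add: tutte_tc_cls keys_poly_frag tutte_frag_poly_frag)
    then show "p \<in> tutte_tc ` carrier (K0 Mat_tc)" by (rule image_eqI) (simp add: tc.cls_in_K0 keys_poly_frag)
  qed
  ultimately show "tutte_tc \<in> Group.iso (K0 Mat_tc) Zxy_group"
    by (simp add: Group.iso_def Zxy_simps bij_betw_def top.extremum_unique)
  show "tutte_tc \<in> extensional (carrier (K0 Mat_tc))" by (rule tc.lift_extensional)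
  show val: "tutte_tc (case mn of (m, n) \<Rightarrow> K0_class Mat_tc (Some (Mat_sum (Mat_power eps m) (Mat_power sig n)))) =
      (case mn of (m, n) \<Rightarrow> var_x ^ m * var_y ^ n)" for mn
    by (cases mn) (simp add: tutte_tc_class monomial_in_obs tutte_frag_of tutte_monomial_matroid flip: monomial_matroid_def)
  fix h' U assume h': "h' \<in> Group.iso (K0 Mat_tc) Zxy_group" and U: "U \<in> carrier (K0 Mat_tc)"
    and eq: "\<And>mn. mn \<in> UNIV \<Longrightarrow> h' (case mn of (m, n) \<Rightarrow> K0_class Mat_tc (Some (Mat_sum (Mat_power eps m) (Mat_power sig n)))) =
      (case mn of (m, n) \<Rightarrow> var_x ^ m * var_y ^ n)"
  show "h' U = tutte_tc U"
  \<comment> \<open>Of the competing isomorphism only additivity and its values on the split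
    matroids enter.\<close>
  proof (rule hom_eq_on_K0_Mat_tc[OF _ hom group_Zxy _ U])
    show "h' \<in> hom (K0 Mat_tc) Zxy_group" using h' by (simp add: Group.iso_def)
    show "h' (K0_class Mat_tc (Some (monomial_matroid m n))) = tutte_tc (K0_class Mat_tc (Some (monomial_matroid m n)))" for m n
      using eq[of "(m, n)"] val[of "(m, n)"] by (simp add: monomial_matroid_def)
  qed
qed

lemma rho_ring_hom: "\<rho> \<in> ring_hom K0_tc_ring Zxy"
  unfolding rho_eq
  by (rule tc.lift_ring_hom) (simp_all add: additive_tutte_frag tutte_frag_Mat_tc tutte_frag_osum tutte_frag_of tutte_empty)

section \<open>\<open>K\<^sub>0(Mat\<^sup>\<cong>)\<close> as a monoid ring\<close>

lemma iso_class_eq_iff: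
  assumes "M \<in> Mat_obs" "N \<in> Mat_obs"
  shows "iso_class M = iso_class N \<longleftrightarrow> matroid_iso M N"
proof
  assume "iso_class M = iso_class N"
  moreover have "N \<in> iso_class N" using assms matroid_iso_refl by (auto simp: iso_class_def)
  ultimately show "matroid_iso M N" by (auto simp: iso_class_def)
next
  assume "matroid_iso M N"
  then show "iso_class M = iso_class N"
    by (auto simp: iso_class_def intro: matroid_iso_trans matroid_iso_sym)
qed

text \<open>With isomorphism classes as a type of class \<^class>\<open>comm_monoid_add\<close>, the type \<open>mclass \<Rightarrow>\<^sub>0 int\<close> is their
  monoid ring, with convolution as multiplication.\<close>

typedef mclass = "iso_class ` Mat_obs"
  using empty_matroid_in_Mat_obs by blast

definition mclass_of :: "nat matroid \<Rightarrow> mclass" where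
  "mclass_of M = Abs_mclass (iso_class M)"

lemma mclass_of_eq_iff:
  "M \<in> Mat_obs \<Longrightarrow> N \<in> Mat_obs \<Longrightarrow> mclass_of M = mclass_of N \<longleftrightarrow> matroid_iso M N"
  by (simp add: mclass_of_def Abs_mclass_inject iso_class_eq_iff)

lemma mclass_cases [cases type: mclass]:
  obtains M where "M \<in> Mat_obs" "c = mclass_of M"
  by (cases c) (auto simp: mclass_of_def)

definition representative :: "mclass \<Rightarrow> nat matroid" where
  "representative c = (SOME M. M \<in> Mat_obs \<and> c = mclass_of M)"

lemma representative: "representative c \<in> Mat_obs" "mclass_of (representative c) = c"
proof -
  have "\<exists>M. M \<in> Mat_obs \<and> c = mclass_of M" by (cases c) blast
  then have "representative c \<in> Mat_obs \<and> c = mclass_of (representative c)"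
    unfolding representative_def by (rule someI_ex)
  then show "representative c \<in> Mat_obs" "mclass_of (representative c) = c" by simp_all
qed

instantiation mclass :: comm_monoid_add
begin

definition zero_mclass :: mclass where
  "zero_mclass = mclass_of empty_matroid"

definition plus_mclass :: "mclass \<Rightarrow> mclass \<Rightarrow> mclass" where
  "plus_mclass c d = mclass_of (Mat_sum (representative c) (representative d))"

text \<open>Independence of the chosen representatives: direct sum respects isomorphism in both
  arguments.\<close>

lemma mclass_of_Mat_sum:
  assumes "M \<in> Mat_obs" "N \<in> Mat_obs"
  shows "mclass_of (Mat_sum M N) = mclass_of M + mclass_of N"
proof -
  have "matroid_iso M (representative (mclass_of M))" "matroid_iso N (representative (mclass_of N))"
    using assms representative by (metis mclass_of_eq_iff)+
  then show ?thesis
    unfolding plus_mclass_def using assms representative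
    by (subst mclass_of_eq_iff) (auto intro!: Mat_sum_in_Mat_obs Mat_sum_iso_cong)
qed

instance
proof
  fix a b c :: mclass
  obtain M N P where "M \<in> Mat_obs" "a = mclass_of M" "N \<in> Mat_obs" "b = mclass_of N" "P \<in> Mat_obs" "c = mclass_of P"
    by (metis mclass_cases)
  note abc = this
  show "a + b + c = a + (b + c)"
    using abc by (simp add: Mat_sum_in_Mat_obs mclass_of_eq_iff Mat_sum_iso_assoc flip: mclass_of_Mat_sum)
  show "a + b = b + a"
    using abc by (simp add: Mat_sum_in_Mat_obs mclass_of_eq_iff Mat_sum_iso_commute flip: mclass_of_Mat_sum)
  show "0 + a = a"
    using abc unfolding zero_mclass_def
    by (simp add: Mat_sum_in_Mat_obs empty_matroid_in_Mat_obs mclass_of_eq_iff Mat_sum_iso_empty flip: mclass_of_Mat_sum)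
qed

end

text \<open>The invariant \<kappa> is a parameter because two copies of the isomorphism classes
  occur: the type \<open>mclass\<close>, whose combinations form a ring, and the sets
  \<open>iso_class M\<close>, on which \<open>ZM\<close> is built.\<close>

definition class_frag :: "(nat matroid \<Rightarrow> 'c) \<Rightarrow> (mat_ob \<Rightarrow>\<^sub>0 int) \<Rightarrow> ('c \<Rightarrow>\<^sub>0 int)" where
  "class_frag \<kappa> = frag_extend (\<lambda>A. case A of None \<Rightarrow> 0 | Some M \<Rightarrow> frag_of (\<kappa> M))"

lemma additive_frag_extend: "additive (frag_extend f)"
  by unfold_locales (rule frag_extend_add)

lemma additive_class_frag: "additive (class_frag \<kappa>)"
  unfolding class_frag_def by (rule additive_frag_extend)

lemma class_frag_of: "class_frag \<kappa> (frag_of None) = 0" "class_frag \<kappa> (frag_of (Some M)) = frag_of (\<kappa> M)"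
  by (simp_all add: class_frag_def)

text \<open>For a complete invariant, \<psi> replaces each class by a chosen representative. Going
  there and back changes a combination only by isomorphism and base-point relations, so a
  combination that is sent to 0 consists of such relations.\<close>

lemma class_frag_kernel:
  fixes \<kappa> :: "nat matroid \<Rightarrow> 'c"
  assumes \<kappa>: "\<And>M N. M \<in> Mat_obs \<Longrightarrow> N \<in> Mat_obs \<Longrightarrow> \<kappa> M = \<kappa> N \<longleftrightarrow> matroid_iso M N"
  shows class_frag_relation: "r \<in> K0_relations Mat_iso \<Longrightarrow> class_frag \<kappa> r = 0"
    and class_frag_eq_0: "Poly_Mapping.keys a \<subseteq> obs Mat_plus \<Longrightarrow> class_frag \<kappa> a = 0 \<Longrightarrow> a \<in> iso.H"
proof -
  show "class_frag \<kappa> r = 0" if "r \<in> K0_relations Mat_iso"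
  proof (rule vanishes_on_Mat_iso_relations[OF additive_class_frag _ _ that])
    fix M N assume "M \<in> Mat_obs" "N \<in> Mat_obs" "matroid_iso M N"
    then have "\<kappa> M = \<kappa> N" using \<kappa> by blast
    then show "class_frag \<kappa> (frag_of (Some M)) = class_frag \<kappa> (frag_of (Some N))" by (simp add: class_frag_of)
  qed (simp add: class_frag_of)
  define \<psi> where "\<psi> = frag_extend (\<lambda>c. frag_of (Some (SOME M. M \<in> Mat_obs \<and> \<kappa> M = c)))"
  have \<psi>: "additive \<psi>" unfolding \<psi>_def by (rule additive_frag_extend)
  have retract: "\<psi> (class_frag \<kappa> a) - a \<in> iso.H" if "Poly_Mapping.keys a \<subseteq> obs Mat_plus" for a
    using that
  proof (induction rule: frag_keys_induct)
    case zero
    then show ?case by (simp add: additive.zero[OF additive_class_frag] additive.zero[OF \<psi>] iso.H_zero)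
  next
    case (diff x y)
    have "\<psi> (class_frag \<kappa> (x - y)) - (x - y) = (\<psi> (class_frag \<kappa> x) - x) - (\<psi> (class_frag \<kappa> y) - y)"
      by (simp add: additive.diff[OF additive_class_frag] additive.diff[OF \<psi>])
    then show ?case using iso.H_diff[OF diff(3,4)] by (simp only:)
  next
    case (of A)
    show ?case
    proof (cases A)
      case None
      then show ?thesis
        using iso.H_minus[OF iso.H_relation[OF base_family_relation(1)]] by (simp add: class_frag_of additive.zero[OF \<psi>])
    next
      case (Some M)
      then have M: "M \<in> Mat_obs" using of by (auto simp: Mat_plus_simps)
      define N where "N = (SOME N. N \<in> Mat_obs \<and> \<kappa> N = \<kappa> M)"
      have N: "N \<in> Mat_obs \<and> \<kappa> N = \<kappa> M" unfolding N_def by (rule someI[of _ M]) (simp add: M)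
      then have "frag_of (Some N) - frag_of (Some M) \<in> iso.H"
        using M \<kappa>[of M N] by (intro iso.H_relation iso_relation_in_Mat_iso) simp_all
      then show ?thesis using Some by (simp add: class_frag_of \<psi>_def flip: N_def)
    qed
  qed
  show "a \<in> iso.H" if "Poly_Mapping.keys a \<subseteq> obs Mat_plus" "class_frag \<kappa> a = 0"
    using iso.H_minus[OF retract[OF that(1)]] that(2) by (simp add: additive.zero[OF \<psi>])
qed

text \<open>Convolution of two point masses is the point mass at the sum of their indices, and
  indices in \<open>mclass\<close> add by direct sum.\<close>

lemma class_frag_mclass_osum:
  assumes "A \<in> obs Mat_plus" "B \<in> obs Mat_plus"
  shows "class_frag mclass_of (frag_of (osum A B)) = class_frag mclass_of (frag_of A) * class_frag mclass_of (frag_of B)"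
  using assms by (auto simp: Mat_plus_simps osum_def class_frag_of mult_single mclass_of_Mat_sum)

interpretation iso: K0_embedding Mat_iso "class_frag mclass_of" osum "Some empty_matroid"
proof
  show "a \<in> generate (free_Abelian_group (obs Mat_iso)) (K0_relations Mat_iso)"
    if "Poly_Mapping.keys a \<subseteq> obs Mat_iso" "class_frag mclass_of a = 0" for a
    using class_frag_eq_0[of mclass_of a] that by (simp add: iso.H_def mclass_of_eq_iff)
  show "class_frag mclass_of (frag_of (Some empty_matroid)) = 1"
    by (simp add: class_frag_of flip: zero_mclass_def)
qed (simp_all add: additive.add[OF additive_class_frag] class_frag_relation mclass_of_eq_iff osum_closed empty_in_obs
    class_frag_mclass_osum)

section \<open>The maps \<open>\<gamma>\<close> and \<open>\<T>\<close>\<close>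

lemma iso_H_subset_tc_H: "iso.H \<subseteq> tc.H"
  unfolding iso.H_def
proof (rule group.generate_subgroup_incl[OF group_free_Abelian_group])
  show "subgroup tc.H (free_Abelian_group (obs Mat_iso))" using tc.subgroup_H by simp
  show "K0_relations Mat_iso \<subseteq> tc.H"
  proof
    fix r assume "r \<in> K0_relations Mat_iso"
    then show "r \<in> tc.H"
    proof (cases rule: K0_relations_Mat_iso_cases)
      case (1 A G)
      then have "(A, G) \<in> coverings Mat_tc" by simp
      from tc.H_covering[OF this] show ?thesis using 1 by simp
    next
      case (2 A B)
      then show ?thesis
        using tc.H_zero by (auto simp: obj_iso_def intro: tc.H_relation iso_relation_in_Mat_tc)
    qed
  qed
qed

abbreviation gamma_map where "gamma_map \<equiv> iso.lift tc.cls"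

lemma gamma_map_cls:
  assumes "Poly_Mapping.keys a \<subseteq> obs Mat_plus"
  shows "gamma_map (iso.cls a) = tc.cls a"
proof (rule iso.lift_cls_respects)
  fix a b assume "Poly_Mapping.keys a \<subseteq> obs Mat_iso" "Poly_Mapping.keys b \<subseteq> obs Mat_iso" "a - b \<in> iso.H"
  then show "tc.cls a = tc.cls b" using iso_H_subset_tc_H by (subst tc.cls_eq_iff) auto
qed (use assms in simp)

lemma iso_K0_E:
  assumes "U \<in> carrier (K0 Mat_iso)"
  obtains a where "Poly_Mapping.keys a \<subseteq> obs Mat_plus" "U = iso.cls a"
  using iso.K0_E[OF assms] by auto

lemma gamma_map_add:
  assumes "U \<in> carrier (K0 Mat_iso)" "V \<in> carrier (K0 Mat_iso)"
  shows "gamma_map (U \<otimes>\<^bsub>K0 Mat_iso\<^esub> V) = gamma_map U \<otimes>\<^bsub>K0 Mat_tc\<^esub> gamma_map V"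
proof -
  obtain a b where "Poly_Mapping.keys a \<subseteq> obs Mat_plus" "U = iso.cls a" "Poly_Mapping.keys b \<subseteq> obs Mat_plus" "V = iso.cls b"
    using assms by (metis iso_K0_E)
  then show ?thesis by (simp add: iso.cls_add tc.cls_add gamma_map_cls keys_add_subset)
qed

lemma gamma_map_closed: "U \<in> carrier (K0 Mat_iso) \<Longrightarrow> gamma_map U \<in> carrier (K0 Mat_tc)"
  by (erule iso_K0_E) (simp add: gamma_map_cls tc.cls_in_K0)

lemma gamma_map_class: "A \<in> obs Mat_plus \<Longrightarrow> gamma_map (K0_class Mat_iso A) = K0_class Mat_tc A"
  by (simp add: iso.K0_class_eq tc.K0_class_eq gamma_map_cls keys_frag_of)

lemma gamma_eq: "\<gamma> = gamma_map"
  unfolding \<gamma>_def K0_map_def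
proof (rule the_map_with_eqI)
  show hom: "gamma_map \<in> hom (K0 Mat_iso) (K0 Mat_tc)"
    by (rule homI) (simp_all add: gamma_map_closed gamma_map_add)
  show "gamma_map \<in> extensional (carrier (K0 Mat_iso))" by (rule iso.lift_extensional)
  show val: "gamma_map (K0_class Mat_iso A) = K0_class Mat_tc (on_obs id_functor A)" if "A \<in> obs Mat_iso" for A
    using that by (simp add: gamma_map_class id_functor_def)
  fix h U assume h: "h \<in> hom (K0 Mat_iso) (K0 Mat_tc)" and U: "U \<in> carrier (K0 Mat_iso)"
    and eq: "\<And>A. A \<in> obs Mat_iso \<Longrightarrow> h (K0_class Mat_iso A) = K0_class Mat_tc (on_obs id_functor A)"
  show "h U = gamma_map U"
    by (rule iso.hom_eq_on_K0[OF h hom tc.group_K0 _ U]) (rule trans[OF eq val[symmetric]])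
qed

abbreviation tutte_iso_K0 where "tutte_iso_K0 \<equiv> iso.lift tutte_frag"

lemmas tutte_iso_K0_cls = iso.lift_cls[OF additive_tutte_frag tutte_frag_Mat_iso]

lemma tutte_iso_K0_ring_hom: "tutte_iso_K0 \<in> ring_hom K0_iso_ring Zxy"
  by (rule iso.lift_ring_hom) (simp_all add: additive_tutte_frag tutte_frag_Mat_iso tutte_frag_osum tutte_frag_of tutte_empty)

text \<open>The identity of \<T> with \<rho> after \<gamma>, at the level of the concrete lifts; it
  transfers multiplicativity to \<gamma>.\<close>

lemma rho_gamma:
  assumes "U \<in> carrier (K0 Mat_iso)"
  shows "tutte_tc (gamma_map U) = tutte_iso_K0 U"
  using assms by (elim iso_K0_E) (simp add: gamma_map_cls tutte_tc_cls tutte_iso_K0_cls)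

lemma gamma_ring_hom: "\<gamma> \<in> ring_hom K0_iso_ring K0_tc_ring"
  unfolding gamma_eq
proof (rule ring_hom_memI)
  fix U V assume UV: "U \<in> carrier K0_iso_ring" "V \<in> carrier K0_iso_ring"
  then have UV': "U \<in> carrier (K0 Mat_iso)" "V \<in> carrier (K0 Mat_iso)" by (simp_all add: iso.K0_ring_simps)
  show "gamma_map U \<in> carrier K0_tc_ring" using UV' by (simp add: tc.K0_ring_simps gamma_map_closed)
  show "gamma_map (U \<oplus>\<^bsub>K0_iso_ring\<^esub> V) = gamma_map U \<oplus>\<^bsub>K0_tc_ring\<^esub> gamma_map V"
    using UV' by (simp add: iso.K0_ring_simps tc.K0_ring_simps gamma_map_add)
  \<comment> \<open>Both sides equal the product of the two Tutte polynomials: the left one because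
    the Tutte map on \<open>K0 Mat_iso\<close> is multiplicative, the right one by construction of
    the product. Injectivity of \<open>tutte_tc\<close> then removes it.\<close>
  have "tutte_tc (gamma_map (iso.prod U V)) = tutte_tc (tc.prod (gamma_map U) (gamma_map V))"
    using ring_hom_mult[OF tutte_iso_K0_ring_hom UV] UV'
    by (simp add: iso.K0_ring_simps Zxy_simps rho_gamma iso.prod_closed tc.\<Theta>_prod gamma_map_closed)
  then have "gamma_map (iso.prod U V) = tc.prod (gamma_map U) (gamma_map V)"
    using UV' by (intro tc.\<Theta>_inj) (simp_all add: gamma_map_closed iso.prod_closed tc.prod_closed)
  then show "gamma_map (U \<otimes>\<^bsub>K0_iso_ring\<^esub> V) = gamma_map U \<otimes>\<^bsub>K0_tc_ring\<^esub> gamma_map V"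
    by (simp add: iso.K0_ring_simps tc.K0_ring_simps)
next
  show "gamma_map \<one>\<^bsub>K0_iso_ring\<^esub> = \<one>\<^bsub>K0_tc_ring\<^esub>"
    by (simp add: iso.K0_ring_simps tc.K0_ring_simps gamma_map_class empty_in_obs)
qed

section \<open>The identification with the group on isomorphism classes, and the map \<T>\<close>

abbreviation ZM_map where "ZM_map \<equiv> iso.lift (class_frag iso_class)"

lemmas ZM_map_cls = iso.lift_cls[OF additive_class_frag class_frag_relation[OF iso_class_eq_iff]]

lemma keys_class_frag:
  assumes "Poly_Mapping.keys a \<subseteq> obs Mat_plus"
  shows "Poly_Mapping.keys (class_frag iso_class a) \<subseteq> iso_class ` Mat_obs"
  using keys_frag_extend[of "\<lambda>A. case A of None \<Rightarrow> 0 | Some M \<Rightarrow> frag_of (iso_class M)" a] assms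
  unfolding class_frag_def by (fastforce simp: Mat_plus_simps keys_frag_of split: option.splits)

lemma K0_iso_to_ZM_eq: "K0_iso_to_ZM = ZM_map"
  unfolding K0_iso_to_ZM_def
proof (rule the_map_with_eqI)
  have hom: "ZM_map \<in> hom (K0 Mat_iso) ZM"
  proof (rule homI)
    show "ZM_map U \<in> carrier ZM" if "U \<in> carrier (K0 Mat_iso)" for U
      using that by (elim iso_K0_E) (simp add: ZM_map_cls ZM_def keys_class_frag)
    show "ZM_map (U \<otimes>\<^bsub>K0 Mat_iso\<^esub> V) = ZM_map U \<otimes>\<^bsub>ZM\<^esub> ZM_map V"
      if "U \<in> carrier (K0 Mat_iso)" "V \<in> carrier (K0 Mat_iso)" for U V
      using iso.lift_add[OF additive_class_frag class_frag_relation[OF iso_class_eq_iff] that] by (simp add: ZM_def)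
  qed
  have inj: "inj_on ZM_map (carrier (K0 Mat_iso))"
  proof (rule inj_onI)
    fix U V assume UV: "U \<in> carrier (K0 Mat_iso)" "V \<in> carrier (K0 Mat_iso)" "ZM_map U = ZM_map V"
    obtain a b where ab: "Poly_Mapping.keys a \<subseteq> obs Mat_plus" "U = iso.cls a"
      "Poly_Mapping.keys b \<subseteq> obs Mat_plus" "V = iso.cls b"
      using UV(1,2) by (metis iso_K0_E)
    then have "class_frag iso_class (a - b) = 0"
      using UV(3) by (simp add: ZM_map_cls additive.diff[OF additive_class_frag])
    then have "a - b \<in> iso.H" using ab by (intro class_frag_eq_0[OF iso_class_eq_iff] keys_diff_subset)
    then show "U = V" using ab by (simp add: iso.cls_eq_iff)
  qed
  have surj: "\<exists>a. Poly_Mapping.keys a \<subseteq> obs Mat_plus \<and> class_frag iso_class a = c"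
    if "Poly_Mapping.keys c \<subseteq> iso_class ` Mat_obs" for c
    using that
  proof (induction rule: frag_keys_induct)
    case zero
    show ?case by (rule exI[of _ 0]) (simp add: additive.zero[OF additive_class_frag])
  next
    case (diff x y)
    then obtain a b where "Poly_Mapping.keys a \<subseteq> obs Mat_plus" "class_frag iso_class a = x"
      "Poly_Mapping.keys b \<subseteq> obs Mat_plus" "class_frag iso_class b = y" by blast
    then show ?case
      by (intro exI[of _ "a - b"]) (simp add: keys_diff_subset additive.diff[OF additive_class_frag])
  next
    case (of c)
    then obtain M where "M \<in> Mat_obs" "c = iso_class M" by blast
    then show ?case by (intro exI[of _ "frag_of (Some M)"]) (simp add: class_frag_of Mat_plus_simps keys_frag_of)
  qed
  have "c \<in> ZM_map ` carrier (K0 Mat_iso)" if c: "c \<in> carrier ZM" for c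
  proof -
    obtain a where "Poly_Mapping.keys a \<subseteq> obs Mat_plus" "class_frag iso_class a = c"
      using surj[of c] c by (auto simp: ZM_def)
    then have "c = ZM_map (iso.cls a)" "iso.cls a \<in> carrier (K0 Mat_iso)" by (simp_all add: ZM_map_cls iso.cls_in_K0)
    then show ?thesis by (rule image_eqI)
  qed
  moreover have "ZM_map ` carrier (K0 Mat_iso) \<subseteq> carrier ZM" using hom by (auto simp: hom_def)
  ultimately show "ZM_map \<in> Group.iso (K0 Mat_iso) ZM"
    using hom inj unfolding Group.iso_def bij_betw_def by blast
  show "ZM_map \<in> extensional (carrier (K0 Mat_iso))" by (rule iso.lift_extensional)
  show val: "ZM_map (K0_class Mat_iso (Some M)) = frag_of (iso_class M)" if "M \<in> Mat_obs" for M
    using that iso.lift_K0_class[OF additive_class_frag class_frag_relation[OF iso_class_eq_iff], of "Some M"]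
    by (simp add: Mat_plus_simps class_frag_of)
  fix h U assume h: "h \<in> Group.iso (K0 Mat_iso) ZM" and U: "U \<in> carrier (K0 Mat_iso)"
    and eq: "\<And>M. M \<in> Mat_obs \<Longrightarrow> h (K0_class Mat_iso (Some M)) = frag_of (iso_class M)"
  have ZM: "group ZM" by (simp add: ZM_def)
  have hh: "h \<in> hom (K0 Mat_iso) ZM" using h by (simp add: Group.iso_def)
  show "h U = ZM_map U"
  proof (rule iso.hom_eq_on_K0[OF hh hom ZM _ U])
    fix A assume "A \<in> obs Mat_iso"
    then consider "A = None" | M where "A = Some M" "M \<in> Mat_obs" by (auto simp: Mat_plus_simps)
    then show "h (K0_class Mat_iso A) = ZM_map (K0_class Mat_iso A)"
    proof cases
      \<comment> \<open>The description prescribes values on matroids only; at the base-point the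
        value is forced, because its class is the neutral element.\<close>
      case 1
      then show ?thesis
        using group_hom.hom_one[of "K0 Mat_iso" ZM h] group_hom.hom_one[of "K0 Mat_iso" ZM ZM_map] hh hom ZM iso.group_K0
        by (simp add: K0_class_None_iso group_hom_def group_hom_axioms_def)
    qed (simp add: eq val)
  qed
qed

definition tutte_class :: "nat matroid set \<Rightarrow> int poly poly" where
  "tutte_class c = tutte (SOME M. M \<in> Mat_obs \<and> iso_class M = c)"

lemma tutte_class_iso_class:
  assumes M: "M \<in> Mat_obs"
  shows "tutte_class (iso_class M) = tutte M"
proof -
  let ?N = "SOME N. N \<in> Mat_obs \<and> iso_class N = iso_class M"
  have "?N \<in> Mat_obs \<and> iso_class ?N = iso_class M" by (rule someI[of _ M]) (simp add: M)
  then show ?thesis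
    unfolding tutte_class_def using M by (intro tutte_iso) (auto simp: Mat_obsD iso_class_eq_iff)
qed

lemma tutte_hom_eq: "tutte_hom = restrict (frag_lift tutte_class) (carrier ZM)"
  unfolding tutte_hom_def
proof (rule the_map_with_eqI)
  have c: "x + y \<in> carrier ZM" if "x \<in> carrier ZM" "y \<in> carrier ZM" for x y
    using that by (simp add: ZM_def keys_add_subset subset_trans[OF keys_add])
  then show "restrict (frag_lift tutte_class) (carrier ZM) \<in> hom ZM Zxy_group"
    by (intro homI) (simp_all add: Zxy_simps ZM_def additive.add[OF additive_frag_lift])
  show "restrict (frag_lift tutte_class) (carrier ZM) (frag_of (iso_class M)) = tutte M" if "M \<in> Mat_obs" for M
    using that by (simp add: ZM_def tutte_class_iso_class keys_frag_of)
  fix h a assume h: "h \<in> hom ZM Zxy_group" and eq: "\<And>M. M \<in> Mat_obs \<Longrightarrow> h (frag_of (iso_class M)) = tutte M"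
    and a: "a \<in> carrier ZM"
  have add: "h (x + y) = h x + h y" if "x \<in> carrier ZM" "y \<in> carrier ZM" for x y
    using h that by (simp add: hom_def Zxy_simps ZM_def)
  have "h a = frag_lift tutte_class a"
    using a[unfolded ZM_def carrier_free_Abelian_group_iff]
  proof (induction rule: frag_keys_induct)
    case zero
    show ?case using add[of 0 0] by (simp add: ZM_def additive.zero[OF additive_frag_lift])
  next
    case (diff x y)
    then have "h x = h (x - y) + h y"
      using add[of "x - y" y] keys_diff[of x y] by (simp add: ZM_def subset_trans)
    then show ?case using diff by (simp add: additive.diff[OF additive_frag_lift])
  next
    case (of c)
    then show ?case using eq by (auto simp: tutte_class_iso_class)
  qed
  then show "h a = restrict (frag_lift tutte_class) (carrier ZM) a" using a by simp
qed simp

text \<open>Both maps are additive on formal combinations, so it suffices to compare generators. The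
  comparison is confined to the carrier, since outside it the composite defining \<T> is evaluated
  at an unspecified argument.\<close>

lemma T_eq:
  assumes "U \<in> carrier (K0 Mat_iso)"
  shows "\<T> U = tutte_iso_K0 U"
  using assms
proof (rule iso_K0_E)
  fix a assume a: "Poly_Mapping.keys a \<subseteq> obs Mat_plus" "U = iso.cls a"
  have "frag_lift tutte_class (class_frag iso_class a) = tutte_frag a"
    using a(1)
  proof (induction rule: frag_keys_induct)
    case (of A)
    then show ?case
      by (cases A) (auto simp: Mat_plus_simps class_frag_of tutte_frag_of tutte_class_iso_class additive.zero[OF additive_frag_lift])
  qed (simp_all add: additive.zero[OF additive_frag_lift] additive.zero[OF additive_class_frag]
      additive.zero[OF additive_tutte_frag] additive.diff[OF additive_frag_lift]
      additive.diff[OF additive_class_frag] additive.diff[OF additive_tutte_frag])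
  then show ?thesis
    using a by (simp add: \<T>_def K0_iso_to_ZM_eq tutte_hom_eq ZM_map_cls tutte_iso_K0_cls ZM_def keys_class_frag)
qed

text \<open>Being a ring homomorphism depends only on the values on the carrier, so the property
  passes from the concrete lift to \<T>.\<close>

lemma T_ring_hom: "\<T> \<in> ring_hom K0_iso_ring Zxy"
  by (rule ring.ring_hom_restrict[OF cring.axioms(1)[OF iso.cring_K0_ring] tutte_iso_K0_ring_hom])
    (simp add: iso.K0_ring_simps T_eq)

theorem theoremB:
  shows "(\<forall>C\<in>{Mat_iso, Mat_tc}.
            (\<forall>M\<in>obs C. \<forall>M'\<in>obs C. \<forall>N\<in>obs C. \<forall>N'\<in>obs C.
               K0_class C M = K0_class C M' \<and> K0_class C N = K0_class C N' \<longrightarrow>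
               K0_class C (osum M N) = K0_class C (osum M' N')) \<and>
            (\<exists>!p. K0_product C osum p)) \<and>
         cring K0_iso_ring \<and> cring K0_tc_ring \<and>
         \<rho> \<in> ring_hom K0_tc_ring Zxy \<and>
         \<gamma> \<in> ring_hom K0_iso_ring K0_tc_ring \<and>
         \<T> \<in> ring_hom K0_iso_ring Zxy"
proof (intro conjI ballI impI)
  fix C assume C: "C \<in> {Mat_iso, Mat_tc}"
  show "\<exists>!p. K0_product C osum p" using C iso.ex1_K0_product tc.ex1_K0_product by blast
  fix M M' N N' assume "M \<in> obs C" "M' \<in> obs C" "N \<in> obs C" "N' \<in> obs C"
    "K0_class C M = K0_class C M' \<and> K0_class C N = K0_class C N'"
  then show "K0_class C (osum M N) = K0_class C (osum M' N')"
    using C iso.K0_class_mult_cong[of M M' N N'] tc.K0_class_mult_cong[of M M' N N'] by blast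
qed (rule iso.cring_K0_ring tc.cring_K0_ring rho_ring_hom gamma_ring_hom T_ring_hom)+

end
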